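(* Let $G$ be a simple $2$-connected positively LLY-curved outerplanar graph. Then $|V(G)|\leq 10$. Moreover, the upper bound is sharp: there exists a simple $2$-connected positively LLY-curved outerplanar graph with exactly $10$ vertices.
   Context: For a graph $G$, $N(x)$ is the neighborhood of a vertex $x$, $d(x)=|N(x)|$ is its degree, and $d(x,y)$ is the graph distance. For $0\le\alpha<1$ the $\alpha$-lazy random walk at $x$ is the probability distribution on $V(G)$ given by $m_x^{\alpha}(x)=\alpha$, $m_x^{\alpha}(v)=(1-\alpha)/d(x)$ for $v\in N(x)$, and $m_x^{\alpha}(v)=0$ otherwise. The Wasserstein-1 distance between finitely supported probability distributions $m_1,m_2$ on $V(G)$ is $W(m_1,m_2)=\inf_A\sum_{u,v\in V(G)}A(u,v)d(u,v)$, where the infimum is over all couplings $A:V(G)\times V(G)\to[0,1]$ with finite support and marginals $m_1$ and $m_2$. For $x\ne y$ let $\kappa_\alpha(x,y)=1-\frac{W(m_x^\alpha,m_y^\alpha)}{d(x,y)}$. The Lin-Lu-Yau (LLY) curvature is $\kappa_{\mathrm{LLY}}(x,y)=\lim_{\alpha\to1}\frac{\kappa_\alpha(x,y)}{1-\alpha}$. $G$ is called positively LLY-curved if $\kappa_{\mathrm{LLY}}(x,y)>0$ for all $x\ne y\in V(G)$. A graph is outerplanar if it can be drawn in the plane without crossings with all vertices on the boundary of the outer face. *)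

theory Defs
  imports "HOL-Analysis.Analysis"
begin

(* A graph is given by its vertex set V and its set E of two-element edges. V may be infinite. *)

definition simple_graph :: "'a set \<Rightarrow> 'a set set \<Rightarrow> bool" where
  "simple_graph V E \<longleftrightarrow> (\<forall>e\<in>E. e \<subseteq> V \<and> card e = 2)"

definition nbhd :: "'a set set \<Rightarrow> 'a \<Rightarrow> 'a set" where
  "nbhd E x = {y. {x, y} \<in> E}"

definition degree :: "'a set set \<Rightarrow> 'a \<Rightarrow> nat" where
  "degree E x = card (nbhd E x)"

definition locally_finite :: "'a set \<Rightarrow> 'a set set \<Rightarrow> bool" where
  "locally_finite V E \<longleftrightarrow> (\<forall>x\<in>V. finite (nbhd E x))"

definition adj_rel :: "'a set set \<Rightarrow> 'a rel" where
  "adj_rel E = {(x, y). {x, y} \<in> E}"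

definition connected_graph :: "'a set \<Rightarrow> 'a set set \<Rightarrow> bool" where
  "connected_graph V E \<longleftrightarrow> V \<noteq> {} \<and> (\<forall>x\<in>V. \<forall>y\<in>V. (x, y) \<in> (adj_rel E)\<^sup>*)"

(* The guard on the cardinality is needed because card is 0 on infinite sets. *)
definition two_connected :: "'a set \<Rightarrow> 'a set set \<Rightarrow> bool" where
  "two_connected V E \<longleftrightarrow>
     (finite V \<longrightarrow> 2 < card V) \<and> connected_graph V E \<and>
     (\<forall>x\<in>V. connected_graph (V - {x}) {e \<in> E. x \<notin> e})"

(* Length of a shortest walk; only meaningful for vertices in the same component. *)
definition graph_dist :: "'a set set \<Rightarrow> 'a \<Rightarrow> 'a \<Rightarrow> nat" where
  "graph_dist E x y = (LEAST n. (x, y) \<in> adj_rel E ^^ n)"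

definition lazy_walk :: "'a set set \<Rightarrow> real \<Rightarrow> 'a \<Rightarrow> 'a \<Rightarrow> real" where
  "lazy_walk E \<alpha> x v =
     (if v = x then \<alpha>
      else if v \<in> nbhd E x then (1 - \<alpha>) / real (degree E x)
      else 0)"

(* The support condition makes every infinite sum below a finite one. *)
definition is_coupling ::
    "'a set \<Rightarrow> ('a \<Rightarrow> real) \<Rightarrow> ('a \<Rightarrow> real) \<Rightarrow> ('a \<times> 'a \<Rightarrow> real) \<Rightarrow> bool" where
  "is_coupling V m\<^sub>1 m\<^sub>2 A \<longleftrightarrow>
     (\<forall>p \<in> V \<times> V. A p \<in> {0..1}) \<and>
     finite {p \<in> V \<times> V. A p \<noteq> 0} \<and>
     (\<forall>u\<in>V. (\<Sum>\<^sub>\<infinity>v\<in>V. A (u, v)) = m\<^sub>1 u) \<and>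
     (\<forall>v\<in>V. (\<Sum>\<^sub>\<infinity>u\<in>V. A (u, v)) = m\<^sub>2 v)"

definition wasserstein ::
    "'a set \<Rightarrow> 'a set set \<Rightarrow> ('a \<Rightarrow> real) \<Rightarrow> ('a \<Rightarrow> real) \<Rightarrow> real" where
  "wasserstein V E m\<^sub>1 m\<^sub>2 =
     (INF A \<in> {A. is_coupling V m\<^sub>1 m\<^sub>2 A}.
        \<Sum>\<^sub>\<infinity>(u, v)\<in>V \<times> V. A (u, v) * real (graph_dist E u v))"

definition lazy_curvature :: "'a set \<Rightarrow> 'a set set \<Rightarrow> real \<Rightarrow> 'a \<Rightarrow> 'a \<Rightarrow> real" where
  "lazy_curvature V E \<alpha> x y =
     1 - wasserstein V E (lazy_walk E \<alpha> x) (lazy_walk E \<alpha> y) / real (graph_dist E x y)"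

(* The limit exists for distinct vertices of a connected locally finite graph on at least two
   vertices, since the quotient is nondecreasing and bounded above on [0,1). *)
definition lly_curvature :: "'a set \<Rightarrow> 'a set set \<Rightarrow> 'a \<Rightarrow> 'a \<Rightarrow> real" where
  "lly_curvature V E x y = Lim (at_left 1) (\<lambda>\<alpha>. lazy_curvature V E \<alpha> x y / (1 - \<alpha>))"

definition positively_LLY_curved :: "'a set \<Rightarrow> 'a set set \<Rightarrow> bool" where
  "positively_LLY_curved V E \<longleftrightarrow> (\<forall>x\<in>V. \<forall>y\<in>V. x \<noteq> y \<longrightarrow> 0 < lly_curvature V E x y)"

definition plane_drawing ::
    "'a set \<Rightarrow> 'a set set \<Rightarrow> ('a \<Rightarrow> complex) \<Rightarrow> ('a set \<Rightarrow> real \<Rightarrow> complex) \<Rightarrow> bool" where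
  "plane_drawing V E p \<gamma> \<longleftrightarrow>
     inj_on p V \<and>
     (\<forall>e\<in>E. arc (\<gamma> e) \<and> {pathstart (\<gamma> e), pathfinish (\<gamma> e)} = p ` e \<and>
            path_image (\<gamma> e) \<inter> p ` V = p ` e) \<and>
     (\<forall>e\<in>E. \<forall>f\<in>E. e \<noteq> f \<longrightarrow> path_image (\<gamma> e) \<inter> path_image (\<gamma> f) = p ` (e \<inter> f))"

definition drawing_points ::
    "'a set \<Rightarrow> 'a set set \<Rightarrow> ('a \<Rightarrow> complex) \<Rightarrow> ('a set \<Rightarrow> real \<Rightarrow> complex) \<Rightarrow> complex set" where
  "drawing_points V E p \<gamma> = p ` V \<union> (\<Union>e\<in>E. path_image (\<gamma> e))"

(* outside S is the union of the unbounded components of the complement of S, so for a finite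
   graph it is the outer face of the drawing. *)
definition outerplanar :: "'a set \<Rightarrow> 'a set set \<Rightarrow> bool" where
  "outerplanar V E \<longleftrightarrow>
     (\<exists>p \<gamma>. plane_drawing V E p \<gamma> \<and> p ` V \<subseteq> frontier (outside (drawing_points V E p \<gamma>)))"

end

(*
By convexity of the Wasserstein distance, kappa_LLY(x, y) is the supremum of kappa_alpha(x, y) / (1 - alpha); hence
explicit couplings bound it from below, and every 1-Lipschitz f with f y - f x = d(x, y) bounds it from above by
(Lap f x - Lap f y) / d(x, y).

By Janiszewski's theorem an outerplanar drawing contains neither a theta graph whose three paths have inner vertices
nor a cycle with two crossing chords. In a 2-connected graph every finite vertex set therefore lies on a cycle, to
which ears attach only at consecutive vertices, and the graph becomes a polygon with noncrossing chords.

Along an edge with end degrees a and b the upper bound depends only on a, b and on the faces next to the edge. It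
forces degrees at most 9, so the Laplacian of a distance function, which drops strictly along outgoing edges, takes
finitely many values and the graph is finite. It also restricts the faces so much that the neighbours v_1, ..., v_d of
a vertex of maximal degree d leave at most 9 - d further vertices between consecutive v_i if d >= 5; for d <= 4 the
polygon has at most 10 vertices by inspection. The extremal example is the fan with one hub and a path on 9 vertices.
*)

theory Submission
  imports Defs
begin

section \<open>Plane drawings and vertex paths\<close>

text \<open>The transfer to polygons is therefore local: the cycle need only contain the vertices
  within distance 2 of one end of the edge. This is enough because the test functions take integer
  values from -1 to 2 on the neighbours of the two ends; a violated Lipschitz condition shows up
  along a walk of length at most 2, and a walk of length 2 begins at a neighbour of that end.

  A polygon edge separates its two sides, so the test function is chosen on each side independently.
  Each side contributes one of a few pairs such as (1, 3), (3, 1) or (1, 1), which bound the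
  deviations from the ideal values at the two ends, and every curvature condition becomes a
  numerical inequality bilinear in two degrees. Many of these are used at equality: the excluded
  configuration has curvature bound exactly 0.\<close>

definition arc_between :: "complex set \<Rightarrow> complex \<Rightarrow> complex \<Rightarrow> bool" where
  "arc_between A a b \<longleftrightarrow> (\<exists>g. arc g \<and> path_image g = A \<and> pathstart g = a \<and> pathfinish g = b)"

lemma arc_betweenE:
  assumes "arc_between A a b"
  obtains g where "arc g" "path_image g = A" "pathstart g = a" "pathfinish g = b"
  using assms unfolding arc_between_def by blast

lemma arc_between_sym: "arc_between A a b \<Longrightarrow> arc_between A b a"
  unfolding arc_between_def
  by (metis arc_reversepath path_image_reversepath pathfinish_reversepath pathstart_reversepath)

lemma arc_between_join:
  assumes "arc_between A a b" "arc_between B b c" "A \<inter> B \<subseteq> {b}"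
  shows "arc_between (A \<union> B) a c"
proof -
  obtain f where f: "arc f" "path_image f = A" "pathstart f = a" "pathfinish f = b"
    using assms(1) by (rule arc_betweenE)
  obtain g where g: "arc g" "path_image g = B" "pathstart g = b" "pathfinish g = c"
    using assms(2) by (rule arc_betweenE)
  have "arc (f +++ g)" using f g assms(3) by (intro arc_join) auto
  then show ?thesis unfolding arc_between_def
    using f g by (intro exI[of _ "f +++ g"]) (simp add: path_image_join)
qed

text \<open>The last clause makes the ends limits of the open arc; it later places the ends of a
  chord in the closure of the region that contains the chord.\<close>

lemma arc_between_props:
  assumes "arc_between A a b"
  shows "a \<noteq> b" "compact A" "connected A" "connected (A - {a, b})" "A - {a, b} \<noteq> {}"
    "a \<in> A" "b \<in> A" "A \<subseteq> closure (A - {a, b})"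
proof -
  obtain g where g: "arc g" "path_image g = A" "pathstart g = a" "pathfinish g = b"
    using assms by (rule arc_betweenE)
  show "a \<noteq> b" using arc_distinct_ends[OF g(1)] g by simp
  show "compact A" "connected A" using compact_arc_image[OF g(1)] connected_arc_image[OF g(1)] g by auto
  show c: "connected (A - {a, b})"
    using connected_simple_path_endless[OF arc_imp_simple_path[OF g(1)]] g by simp
  show "A - {a, b} \<noteq> {}"
    using nonempty_simple_path_endless[OF arc_imp_simple_path[OF g(1)]] g by simp
  show "a \<in> A" "b \<in> A" using g pathstart_in_path_image pathfinish_in_path_image by blast+
  have inj: "inj_on g {0..1}" and cont: "continuous_on {0..1} g"
    using g(1) unfolding arc_def path_def by auto
  have "g ` {0<..<1} \<subseteq> A - {a, b}"
  proof
    fix z assume "z \<in> g ` {0<..<1}"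
    then obtain t where t: "0 < t" "t < 1" "z = g t" by auto
    have "g t \<noteq> g 0" "g t \<noteq> g 1" using inj_onD[OF inj, of t 0] inj_onD[OF inj, of t 1] t by auto
    then show "z \<in> A - {a, b}" using t g unfolding path_image_def pathstart_def pathfinish_def by auto
  qed
  then have "g ` closure {0<..<1} \<subseteq> closure (A - {a, b})"
    using cont closure_subset[of "A - {a, b}"]
    by (intro image_closure_subset) (auto intro: order_trans)
  then show "A \<subseteq> closure (A - {a, b})" using g(2) by (simp add: path_image_def)
qed

text \<open>The Jordan curve theorem for a closed curve given as two arcs, the form in which a drawn
  cycle is cut at two of its vertices.\<close>

lemma arcs_Jordan:
  assumes "arc_between A a b" "arc_between B a b" "A \<inter> B = {a, b}"
  shows "inside (A \<union> B) \<noteq> {}" "open (inside (A \<union> B))" "connected (inside (A \<union> B))"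
    "open (outside (A \<union> B))" "connected (outside (A \<union> B))" "bounded (A \<union> B)"
    "frontier (inside (A \<union> B)) = A \<union> B"
proof -
  obtain f where f: "arc f" "path_image f = A" "pathstart f = a" "pathfinish f = b"
    using assms(1) by (rule arc_betweenE)
  obtain g where g: "arc g" "path_image g = B" "pathstart g = b" "pathfinish g = a"
    using arc_between_sym[OF assms(2)] by (rule arc_betweenE)
  have "simple_path (f +++ g)"
    using f g assms(3) by (intro simple_path_join_loop) auto
  moreover have "path_image (f +++ g) = A \<union> B" using f g by (simp add: path_image_join)
  moreover have "pathfinish (f +++ g) = pathstart (f +++ g)" using f g by simp
  ultimately show "inside (A \<union> B) \<noteq> {}" "open (inside (A \<union> B))" "connected (inside (A \<union> B))"
    "open (outside (A \<union> B))" "connected (outside (A \<union> B))"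
    "frontier (inside (A \<union> B)) = A \<union> B"
    using Jordan_inside_outside[of "f +++ g"] by auto
  show "bounded (A \<union> B)"
    using arc_between_props(2)[OF assms(1)] arc_between_props(2)[OF assms(2)] compact_imp_bounded by auto
qed

lemma connected_subset_inside:
  assumes "arc_between A a b" "arc_between B a b" "A \<inter> B = {a, b}"
    and X: "connected X" "X \<inter> (A \<union> B) = {}" "X \<inter> inside (A \<union> B) \<noteq> {}"
  shows "X \<subseteq> inside (A \<union> B)"
proof -
  have "X \<subseteq> inside (A \<union> B) \<union> outside (A \<union> B)" using X(2) by auto
  then have "X \<inter> outside (A \<union> B) = {}"
    using connectedD[OF X(1) arcs_Jordan(2)[OF assms(1-3)] arcs_Jordan(4)[OF assms(1-3)]] X(3)
      inside_Int_outside[of "A \<union> B"] by blast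
  then show ?thesis using \<open>X \<subseteq> inside (A \<union> B) \<union> outside (A \<union> B)\<close> by blast
qed

text \<open>If the two inner domains met, each would be a connected set missing the other curve,
  hence they would be equal and have equal frontiers; but the open arc of \<open>B\<close> lies on
  only one of these.\<close>

lemma theta_inside_eq:
  assumes "arc_between A a b" "arc_between B a b" "arc_between C a b"
    and AB: "A \<inter> B = {a, b}" and AC: "A \<inter> C = {a, b}" and BC: "B \<inter> C = {a, b}"
    and "C \<inter> inside (A \<union> B) = {}" "B \<inter> inside (A \<union> C) = {}"
  shows "inside (A \<union> B) \<inter> inside (A \<union> C) = {}"
proof (rule ccontr)
  assume ne: "inside (A \<union> B) \<inter> inside (A \<union> C) \<noteq> {}"
  have "inside (A \<union> C) \<subseteq> inside (A \<union> B)"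
  proof (rule connected_subset_inside[OF assms(1,2) AB])
    show "connected (inside (A \<union> C))" by (rule arcs_Jordan(3)[OF assms(1,3) AC])
    show "inside (A \<union> C) \<inter> (A \<union> B) = {}" using assms(8) inside_no_overlap[of "A \<union> C"] by blast
  qed (use ne in blast)
  moreover have "inside (A \<union> B) \<subseteq> inside (A \<union> C)"
  proof (rule connected_subset_inside[OF assms(1,3) AC])
    show "connected (inside (A \<union> B))" by (rule arcs_Jordan(3)[OF assms(1,2) AB])
    show "inside (A \<union> B) \<inter> (A \<union> C) = {}" using assms(7) inside_no_overlap[of "A \<union> B"] by blast
  qed (use ne in blast)
  ultimately have "A \<union> B = A \<union> C"
    using arcs_Jordan(7)[OF assms(1,2) AB] arcs_Jordan(7)[OF assms(1,3) AC] by simp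
  then show False using arc_between_props(5)[OF assms(2)] AB BC by blast
qed

text \<open>If every arc avoided the inner domain of the other two, the three inner domains would be pairwise
  disjoint; Janiszewski's theorem then connects a point of the first one to infinity.\<close>

lemma theta_curve:
  assumes A: "arc_between A a b" and B: "arc_between B a b" and C: "arc_between C a b"
    and AB: "A \<inter> B = {a, b}" and AC: "A \<inter> C = {a, b}" and BC: "B \<inter> C = {a, b}"
  shows "A - {a, b} \<subseteq> inside (B \<union> C) \<or> B - {a, b} \<subseteq> inside (A \<union> C) \<or> C - {a, b} \<subseteq> inside (A \<union> B)"
proof (rule ccontr)
  assume c: "\<not> ?thesis"
  have a: "A \<inter> inside (B \<union> C) = {}"
  proof (rule ccontr)
    assume ne: "A \<inter> inside (B \<union> C) \<noteq> {}"
    have d: "(A - {a, b}) \<inter> (B \<union> C) = {}" using AB AC BC by blast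
    have "{a, b} \<inter> inside (B \<union> C) = {}"
      using inside_no_overlap[of "B \<union> C"] BC by blast
    then have "(A - {a, b}) \<inter> inside (B \<union> C) \<noteq> {}" using ne by blast
    from connected_subset_inside[OF B C BC arc_between_props(4)[OF A] d this] c show False by blast
  qed
  have b: "B \<inter> inside (A \<union> C) = {}"
  proof (rule ccontr)
    assume ne: "B \<inter> inside (A \<union> C) \<noteq> {}"
    have d: "(B - {a, b}) \<inter> (A \<union> C) = {}" using AB AC BC by blast
    have "{a, b} \<inter> inside (A \<union> C) = {}"
      using inside_no_overlap[of "A \<union> C"] AC by blast
    then have "(B - {a, b}) \<inter> inside (A \<union> C) \<noteq> {}" using ne by blast
    from connected_subset_inside[OF A C AC arc_between_props(4)[OF B] d this] c show False by blast
  qed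
  have cc: "C \<inter> inside (A \<union> B) = {}"
  proof (rule ccontr)
    assume ne: "C \<inter> inside (A \<union> B) \<noteq> {}"
    have d: "(C - {a, b}) \<inter> (A \<union> B) = {}" using AB AC BC by blast
    have "{a, b} \<inter> inside (A \<union> B) = {}"
      using inside_no_overlap[of "A \<union> B"] AB by blast
    then have "(C - {a, b}) \<inter> inside (A \<union> B) \<noteq> {}" using ne by blast
    from connected_subset_inside[OF A B AB arc_between_props(4)[OF C] d this] c show False by blast
  qed
  obtain i where i: "i \<in> inside (A \<union> B)" using arcs_Jordan(1)[OF A B AB] by blast
  have i2: "i \<notin> inside (A \<union> C)" using theta_inside_eq[OF A B C AB AC BC cc b] i by blast
  have i3: "i \<notin> inside (B \<union> C)"
    using theta_inside_eq[OF B A C _ BC AC _ a] AB cc i by (auto simp: Un_commute Int_commute)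
  have iABC: "i \<notin> A \<union> B \<union> C" using i cc inside_no_overlap[of "A \<union> B"] by blast
  let ?S = "(A \<union> C) \<union> (B \<union> C)"
  have cpt: "compact (A \<union> C)" "compact (B \<union> C)"
    using arc_between_props(2)[OF A] arc_between_props(2)[OF B] arc_between_props(2)[OF C] by auto
  then have "bounded ?S" using compact_imp_bounded bounded_Un by blast
  then have "outside ?S \<noteq> {}" by (rule outside_bounded_nonempty)
  then obtain o' where o: "o' \<in> outside ?S" by blast
  have "connected_component (- (A \<union> C)) i o'"
  proof (rule connected_component_of_subset)
    have "i \<in> outside (A \<union> C)" using i2 iABC inside_Un_outside[of "A \<union> C"] by blast
    moreover have "o' \<in> outside (A \<union> C)" using o outside_mono[of "A \<union> C" ?S] by blast
    ultimately show "connected_component (outside (A \<union> C)) i o'"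
      using arcs_Jordan(5)[OF A C AC] by (simp add: connected_iff_connected_component)
  qed (use outside_no_overlap in blast)
  moreover have "connected_component (- (B \<union> C)) i o'"
  proof (rule connected_component_of_subset)
    have "i \<in> outside (B \<union> C)" using i3 iABC inside_Un_outside[of "B \<union> C"] by blast
    moreover have "o' \<in> outside (B \<union> C)" using o outside_mono[of "B \<union> C" ?S] by blast
    ultimately show "connected_component (outside (B \<union> C)) i o'"
      using arcs_Jordan(5)[OF B C BC] by (simp add: connected_iff_connected_component)
  qed (use outside_no_overlap in blast)
  \<comment> \<open>Janiszewski's theorem asks for a connected intersection of the two closed sets;
    here it is the single arc \<open>C\<close>.\<close>
  moreover have "(A \<union> C) \<inter> (B \<union> C) = C" using AB AC BC by blast
  then have "connected ((A \<union> C) \<inter> (B \<union> C))" using arc_between_props(3)[OF C] by simp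
  ultimately have "connected_component (- ?S) i o'"
    by (intro Janiszewski[OF cpt(1) compact_imp_closed[OF cpt(2)]])
  then have "i \<in> outside ?S"
    using o outside_same_component connected_component_sym by blast
  then have "i \<in> outside (A \<union> B)" using outside_mono[of "A \<union> B" ?S] by blast
  then show False using i inside_Int_outside[of "A \<union> B"] by blast
qed

text \<open>Enlarging \<open>J\<close> to \<open>S\<close> shrinks the outside, and the open set
  \<open>inside J\<close> misses the closure of \<open>outside J\<close>.\<close>

lemma inside_not_outer:
  assumes "open (inside J)" "v \<in> inside J" "J \<subseteq> S"
  shows "v \<notin> frontier (outside S)"
proof
  assume "v \<in> frontier (outside S)"
  then have "v \<in> closure (outside J)"
    using closure_mono[OF outside_mono[OF assms(3)]] unfolding frontier_def by blast
  moreover have "inside J \<inter> closure (outside J) = {}"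
    using open_Int_closure_eq_empty[OF assms(1)] inside_Int_outside by blast
  ultimately show False using assms(2) by blast
qed

text \<open>Outer points on the open arcs \<open>A\<close> and \<open>B\<close> exclude two of the
  three cases of \<open>theta_curve\<close>. Applied with \<open>C\<close> a chord of the cycle
  formed by \<open>A\<close> and \<open>B\<close>.\<close>

lemma theta_not_outer:
  assumes A: "arc_between A a b" and B: "arc_between B a b" and C: "arc_between C a b"
    and AB: "A \<inter> B = {a, b}" and AC: "A \<inter> C = {a, b}" and BC: "B \<inter> C = {a, b}"
    and S: "A \<union> B \<union> C \<subseteq> S"
    and o: "u \<in> A - {a, b}" "u \<in> frontier (outside S)" "v \<in> B - {a, b}" "v \<in> frontier (outside S)"
  shows "C - {a, b} \<subseteq> inside (A \<union> B)"
proof -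
  have "\<not> A - {a, b} \<subseteq> inside (B \<union> C)"
    using inside_not_outer[OF arcs_Jordan(2)[OF B C BC], of u S] S o by blast
  moreover have "\<not> B - {a, b} \<subseteq> inside (A \<union> C)"
    using inside_not_outer[OF arcs_Jordan(2)[OF A C AC], of v S] S o by blast
  ultimately show ?thesis using theta_curve[OF A B C AB AC BC] by blast
qed

text \<open>Both chords run inside the cycle. \<open>C\<close> cuts the inner domain in two, and the
  open arc of \<open>D\<close>, being connected and disjoint from \<open>C\<close>, stays in one
  part, whose closure then contains both ends of \<open>D\<close>; but \<open>b\<close> and
  \<open>d\<close> lie on opposite arcs of the cycle. The cycle is given twice, cut at
  \<open>a\<close>, \<open>c\<close> and cut at \<open>b\<close>, \<open>d\<close>.\<close>

lemma crossing_chords_not_outer: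
  assumes A: "arc_between A a c" and B: "arc_between B a c" and C: "arc_between C a c"
    and AB: "A \<inter> B = {a, c}" and AC: "A \<inter> C = {a, c}" and BC: "B \<inter> C = {a, c}"
    and A': "arc_between A' b d" and B': "arc_between B' b d" and D: "arc_between D b d"
    and AB': "A' \<inter> B' = {b, d}" and AD: "A' \<inter> D = {b, d}" and BD: "B' \<inter> D = {b, d}"
    and CD: "C \<inter> D = {}" and eq: "A \<union> B = A' \<union> B'" and S: "A \<union> B \<union> C \<union> D \<subseteq> S"
    and b: "b \<in> A - {a, c}" and d: "d \<in> B - {a, c}" and a: "a \<in> B' - {b, d}" and c: "c \<in> A' - {b, d}"
    and o: "{a, b, c, d} \<subseteq> frontier (outside S)"
  shows False
proof -
  have C_in: "C - {a, c} \<subseteq> inside (A \<union> B)"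
  proof (rule theta_not_outer[OF A B C AB AC BC])
    show "A \<union> B \<union> C \<subseteq> S" using S by blast
  qed (use o b d in auto)
  have D_in: "D - {b, d} \<subseteq> inside (A \<union> B)"
    unfolding eq
  proof (rule theta_not_outer[OF A' B' D AB' AD BD])
    show "A' \<union> B' \<union> D \<subseteq> S" using S unfolding eq by blast
  qed (use o a c in auto)
  obtain f where f: "arc f" "path_image f = A" "pathstart f = a" "pathfinish f = c"
    using A by (rule arc_betweenE)
  obtain g where g: "arc g" "path_image g = B" "pathstart g = a" "pathfinish g = c"
    using B by (rule arc_betweenE)
  obtain h where h: "arc h" "path_image h = C" "pathstart h = a" "pathfinish h = c"
    using C by (rule arc_betweenE)
  have ne: "path_image h \<inter> inside (path_image f \<union> path_image g) \<noteq> {}"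
    using C_in arc_between_props(5)[OF C] f g h by blast
  have inter: "path_image f \<inter> path_image g = {a, c}" "path_image f \<inter> path_image h = {a, c}"
    "path_image g \<inter> path_image h = {a, c}"
    using AB AC BC f g h by simp_all
  have split: "inside (A \<union> C) \<inter> inside (B \<union> C) = {} \<and>
      inside (A \<union> C) \<union> inside (B \<union> C) \<union> (C - {a, c}) = inside (A \<union> B)"
    unfolding f(2)[symmetric] g(2)[symmetric] h(2)[symmetric]
    by (rule split_inside_simple_closed_curve[OF arc_imp_simple_path[OF f(1)] f(3,4)
        arc_imp_simple_path[OF g(1)] g(3,4) arc_imp_simple_path[OF h(1)] h(3,4)
        arc_between_props(1)[OF A] inter ne]) (rule conjI)
  note split = split[THEN conjunct1] split[THEN conjunct2]
  have cover: "D - {b, d} \<subseteq> inside (A \<union> C) \<union> inside (B \<union> C)"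
    using D_in split CD by blast
  have opens: "open (inside (A \<union> C))" "open (inside (B \<union> C))"
    using arcs_Jordan(2)[OF A C AC] arcs_Jordan(2)[OF B C BC] by auto
  have "inside (A \<union> C) \<inter> (D - {b, d}) = {} \<or> inside (B \<union> C) \<inter> (D - {b, d}) = {}"
    using connectedD[OF arc_between_props(4)[OF D] opens] split cover by blast
  then have sub: "D - {b, d} \<subseteq> inside (B \<union> C) \<or> D - {b, d} \<subseteq> inside (A \<union> C)"
    using cover by blast
  have clos: "closure (inside (X \<union> C)) \<subseteq> inside (X \<union> C) \<union> X \<union> C" if "X = A \<or> X = B" for X
    using closure_inside_subset[of "X \<union> C"] arc_between_props(2)[OF A] arc_between_props(2)[OF B]
      arc_between_props(2)[OF C] that compact_imp_closed by blast
  have "b \<in> closure (D - {b, d})" "d \<in> closure (D - {b, d})"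
    using arc_between_props(6-8)[OF D] by blast+
  then have "b \<in> inside (B \<union> C) \<union> B \<union> C \<or> d \<in> inside (A \<union> C) \<union> A \<union> C"
    using sub closure_mono clos by blast
  moreover have "b \<notin> B \<union> C" "d \<notin> A \<union> C" using b d AB AC BC by blast+
  moreover have "b \<notin> inside (B \<union> C)" "d \<notin> inside (A \<union> C)"
    using split b d inside_no_overlap[of "A \<union> B"] by blast+
  ultimately show False by blast
qed

section \<open>Paths of vertices and their images in a drawing\<close>

fun path_edges :: "'a list \<Rightarrow> 'a set set" where
  "path_edges (x # y # zs) = insert {x, y} (path_edges (y # zs))"
| "path_edges _ = {}"

lemma path_edges_append: "path_edges (us @ v # ws) = path_edges (us @ [v]) \<union> path_edges (v # ws)"
  by (induction us rule: path_edges.induct) auto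

lemma path_edges_rev: "path_edges (rev xs) = path_edges xs"
proof (induction xs rule: path_edges.induct)
  case (1 x y zs)
  have "path_edges (rev (x # y # zs)) = path_edges (rev zs @ y # [x])" by simp
  also have "\<dots> = path_edges (rev (y # zs)) \<union> {{y, x}}"
    by (subst path_edges_append) simp
  finally show ?case using 1 by (simp add: insert_commute)
qed simp_all

lemma path_edges_subset: "e \<in> path_edges xs \<Longrightarrow> e \<subseteq> set xs"
  by (induction xs rule: path_edges.induct) auto

lemma Union_path_edges: "2 \<le> length xs \<Longrightarrow> \<Union> (path_edges xs) = set xs"
proof (induction xs rule: path_edges.induct)
  case (1 x y zs)
  then show ?case by (cases zs) auto
qed simp_all

text \<open>The edge between the common ends is the only one that two internally disjoint paths
  could share; this rules it out.\<close>

lemma path_ends_not_edge: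
  assumes "distinct xs" "3 \<le> length xs"
  shows "{hd xs, last xs} \<notin> path_edges xs"
proof -
  obtain x y z zs where xs: "xs = x # y # z # zs"
    using assms(2) by (cases xs; cases "tl xs"; cases "tl (tl xs)") auto
  have l: "last xs \<in> set (z # zs)" unfolding xs by simp
  then have "last xs \<noteq> y" using assms(1) unfolding xs by auto
  moreover have "x \<notin> e" if "e \<in> path_edges (y # z # zs)" for e
    using path_edges_subset[OF that] assms(1) unfolding xs by auto
  ultimately show ?thesis unfolding xs by (auto simp: doubleton_eq_iff)
qed

definition drawn :: "('a set \<Rightarrow> real \<Rightarrow> complex) \<Rightarrow> 'a set set \<Rightarrow> complex set" where
  "drawn \<gamma> F = (\<Union>e\<in>F. path_image (\<gamma> e))"

lemma drawn_Un: "drawn \<gamma> (F \<union> G) = drawn \<gamma> F \<union> drawn \<gamma> G"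
  unfolding drawn_def by blast

lemma drawn_Int_subset:
  assumes "plane_drawing V E p \<gamma>" "F \<subseteq> E" "G \<subseteq> E" "F \<inter> G = {}"
  shows "drawn \<gamma> F \<inter> drawn \<gamma> G \<subseteq> p ` (\<Union>F \<inter> \<Union>G)"
proof
  fix z assume "z \<in> drawn \<gamma> F \<inter> drawn \<gamma> G"
  then obtain e f where ef: "e \<in> F" "f \<in> G" "z \<in> path_image (\<gamma> e) \<inter> path_image (\<gamma> f)"
    unfolding drawn_def by blast
  then have "e \<noteq> f" "e \<in> E" "f \<in> E" using assms by blast+
  then have "z \<in> p ` (e \<inter> f)" using assms(1) ef(3) unfolding plane_drawing_def by blast
  then show "z \<in> p ` (\<Union>F \<inter> \<Union>G)" using ef by blast
qed

lemma edge_arc: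
  assumes "plane_drawing V E p \<gamma>" "{x, y} \<in> E"
  shows "arc_between (path_image (\<gamma> {x, y})) (p x) (p y)"
proof -
  have g: "arc (\<gamma> {x, y})" "{pathstart (\<gamma> {x, y}), pathfinish (\<gamma> {x, y})} = {p x, p y}"
    using assms unfolding plane_drawing_def by auto
  then have "pathstart (\<gamma> {x, y}) = p x \<and> pathfinish (\<gamma> {x, y}) = p y \<or>
      pathstart (\<gamma> {x, y}) = p y \<and> pathfinish (\<gamma> {x, y}) = p x"
    by (simp add: doubleton_eq_iff)
  then show ?thesis using g(1) arc_between_sym unfolding arc_between_def by blast
qed

lemma path_arc:
  assumes "plane_drawing V E p \<gamma>"
  shows "distinct xs \<Longrightarrow> 2 \<le> length xs \<Longrightarrow> path_edges xs \<subseteq> E \<Longrightarrow>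
    arc_between (drawn \<gamma> (path_edges xs)) (p (hd xs)) (p (last xs))"
proof (induction xs rule: path_edges.induct)
  case (1 x y zs)
  show ?case
  proof (cases "zs = []")
    case True
    then show ?thesis using edge_arc[OF assms, of x y] 1(4) by (simp add: drawn_def)
  next
    case False
    have IH: "arc_between (drawn \<gamma> (path_edges (y # zs))) (p y) (p (last (y # zs)))"
      using 1 False by (cases zs) auto
    have e: "arc_between (drawn \<gamma> {{x, y}}) (p x) (p y)"
      using edge_arc[OF assms, of x y] 1(4) by (simp add: drawn_def)
    have sub: "\<Union> (path_edges (y # zs)) \<subseteq> set (y # zs)" using path_edges_subset by blast
    then have "{x, y} \<notin> path_edges (y # zs)" using 1(2) by auto
    then have "drawn \<gamma> {{x, y}} \<inter> drawn \<gamma> (path_edges (y # zs)) \<subseteq> p ` (\<Union> {{x, y}} \<inter> \<Union> (path_edges (y # zs)))"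
      using 1(4) by (intro drawn_Int_subset[OF assms]) auto
    also have "\<dots> \<subseteq> {p y}" using sub 1(2) by auto
    finally have "arc_between (drawn \<gamma> {{x, y}} \<union> drawn \<gamma> (path_edges (y # zs))) (p x) (p (last (y # zs)))"
      by (rule arc_between_join[OF e IH])
    moreover have "drawn \<gamma> (path_edges (x # y # zs)) = drawn \<gamma> {{x, y}} \<union> drawn \<gamma> (path_edges (y # zs))"
      unfolding drawn_def by simp
    ultimately show ?thesis by simp
  qed
qed simp_all

lemma vertex_on_path:
  assumes "plane_drawing V E p \<gamma>" "path_edges xs \<subseteq> E" "2 \<le> length xs" "v \<in> set xs"
  shows "p v \<in> drawn \<gamma> (path_edges xs)"
proof -
  obtain e where e: "e \<in> path_edges xs" "v \<in> e" using Union_path_edges[OF assms(3)] assms(4) by blast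
  then have "e \<in> E" using assms(2) by blast
  then have "path_image (\<gamma> e) \<inter> p ` V = p ` e"
    using assms(1) unfolding plane_drawing_def by simp
  then have "p v \<in> path_image (\<gamma> e)" using e(2) by (metis IntD1 imageI)
  then show ?thesis using e(1) unfolding drawn_def by blast
qed

text \<open>A shared edge would be \<open>{a, b}\<close>, which a path with an inner vertex does not
  contain. Only \<open>ys\<close> is required to have one, so that \<open>xs\<close> may be a single
  chord.\<close>

lemma paths_drawn_Int:
  assumes "plane_drawing V E p \<gamma>"
    and xs: "distinct xs" "2 \<le> length xs" "path_edges xs \<subseteq> E" "hd xs = a" "last xs = b"
    and ys: "distinct ys" "3 \<le> length ys" "path_edges ys \<subseteq> E" "hd ys = a" "last ys = b"
    and "simple_graph V E" "set xs \<inter> set ys = {a, b}"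
  shows "drawn \<gamma> (path_edges xs) \<inter> drawn \<gamma> (path_edges ys) = {p a, p b}"
proof
  have "path_edges xs \<inter> path_edges ys = {}"
  proof (rule ccontr)
    assume "\<not> ?thesis"
    then obtain e where e: "e \<in> path_edges xs" "e \<in> path_edges ys" by blast
    then have "e \<subseteq> {a, b}" using path_edges_subset assms(13) by blast
    moreover have "card e = 2" using e(1) xs(3) assms(12) unfolding simple_graph_def by blast
    moreover have "card {a, b} \<le> 2" by (simp add: card_insert_if)
    ultimately have "e = {a, b}" by (intro card_seteq) auto
    then show False using path_ends_not_edge[OF ys(1,2)] ys(4,5) e(2) by simp
  qed
  then have "drawn \<gamma> (path_edges xs) \<inter> drawn \<gamma> (path_edges ys) \<subseteq> p ` (set xs \<inter> set ys)"
    using drawn_Int_subset[OF assms(1) xs(3) ys(3)] Union_path_edges[of xs] Union_path_edges[of ys] xs(2) ys(2)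
    by simp
  then show "drawn \<gamma> (path_edges xs) \<inter> drawn \<gamma> (path_edges ys) \<subseteq> {p a, p b}"
    using assms(13) by simp
  have "a \<in> set xs" "b \<in> set xs" "a \<in> set ys" "b \<in> set ys" using assms(13) by auto
  then show "{p a, p b} \<subseteq> drawn \<gamma> (path_edges xs) \<inter> drawn \<gamma> (path_edges ys)"
    using vertex_on_path[OF assms(1) xs(3,2), of a] vertex_on_path[OF assms(1) xs(3,2), of b]
      vertex_on_path[OF assms(1) ys(3), of a] vertex_on_path[OF assms(1) ys(3), of b] ys(2) by auto
qed

text \<open>One path of a theta graph; the length bound provides an inner vertex, which can be
  tested against the outer face.\<close>

definition link :: "'a set \<Rightarrow> 'a set set \<Rightarrow> 'a \<Rightarrow> 'a list \<Rightarrow> 'a \<Rightarrow> bool" where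
  "link V E a xs b \<longleftrightarrow> distinct xs \<and> 3 \<le> length xs \<and> path_edges xs \<subseteq> E \<and> set xs \<subseteq> V \<and> hd xs = a \<and> last xs = b"

lemma link_inner_vertex:
  assumes "link V E a xs b"
  obtains v where "v \<in> set xs" "v \<noteq> a" "v \<noteq> b"
proof -
  have l: "distinct xs" "3 \<le> length xs" "hd xs = a" "last xs = b" using assms unfolding link_def by auto
  obtain x y z zs where xs: "xs = x # y # z # zs"
    using l(2) by (cases xs; cases "tl xs"; cases "tl (tl xs)") auto
  have "last xs \<in> set (z # zs)" unfolding xs by simp
  then have "y \<noteq> last xs" using l(1) unfolding xs by auto
  then show ?thesis using that[of y] l unfolding xs by auto
qed

text \<open>\<open>theta_curve\<close> puts one of the three arcs inside the cycle of the other two,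
  where its inner vertex cannot touch the outer face.\<close>

theorem outerplanar_no_theta:
  assumes "simple_graph V E" "outerplanar V E" "link V E a xs b" "link V E a ys b" "link V E a zs b"
    and "set xs \<inter> set ys = {a, b}" "set xs \<inter> set zs = {a, b}" "set ys \<inter> set zs = {a, b}"
  shows False
proof -
  obtain p \<gamma> where d: "plane_drawing V E p \<gamma>" and o: "p ` V \<subseteq> frontier (outside (drawing_points V E p \<gamma>))"
    using assms(2) unfolding outerplanar_def by blast
  define S where "S = drawing_points V E p \<gamma>"
  define D where "D ws = drawn \<gamma> (path_edges ws)" for ws
  have arc: "arc_between (D ws) (p a) (p b)" if "link V E a ws b" for ws
    using path_arc[OF d, of ws] that unfolding link_def D_def by auto
  have int: "D ws \<inter> D vs = {p a, p b}" if "link V E a ws b" "link V E a vs b" "set ws \<inter> set vs = {a, b}" for ws vs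
    unfolding D_def using that unfolding link_def by (intro paths_drawn_Int[OF d _ _ _ _ _ _ _ _ _ _ assms(1)]) auto
  have sub: "D ws \<subseteq> S" if "link V E a ws b" for ws
    using that unfolding link_def D_def S_def drawn_def drawing_points_def by blast
  have bad: False if l: "link V E a ws b" "link V E a us b" "link V E a vs b" "set us \<inter> set vs = {a, b}"
    and i: "D ws - {p a, p b} \<subseteq> inside (D us \<union> D vs)" for us vs ws
  proof -
    obtain v where v: "v \<in> set ws" "v \<noteq> a" "v \<noteq> b" using link_inner_vertex[OF l(1)] .
    have "set ws \<subseteq> V" "a \<in> set ws" "b \<in> set ws" using l(1) unfolding link_def
      by (auto intro!: hd_in_set last_in_set)
    then have V: "v \<in> V" "a \<in> V" "b \<in> V" using v(1) by auto
    have "inj_on p V" using d unfolding plane_drawing_def by simp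
    then have "p v \<noteq> p a" "p v \<noteq> p b" using v V by (auto dest: inj_onD)
    moreover have "p v \<in> frontier (outside S)" using o V unfolding S_def by blast
    moreover have on: "p v \<in> D ws"
      using vertex_on_path[OF d, of ws v] l(1) v(1) unfolding link_def D_def by simp
    moreover have "D us \<union> D vs \<subseteq> S" using sub[OF l(2)] sub[OF l(3)] by blast
    moreover have "p v \<in> inside (D us \<union> D vs)" if "p v \<noteq> p a" "p v \<noteq> p b" using i on that by blast
    ultimately show False
      using inside_not_outer[OF arcs_Jordan(2)[OF arc[OF l(2)] arc[OF l(3)] int[OF l(2-4)]], of "p v" S] by simp
  qed
  show False
    using theta_curve[OF arc[OF assms(3)] arc[OF assms(4)] arc[OF assms(5)] int[OF assms(3,4,6)]
        int[OF assms(3,5,7)] int[OF assms(4,5,8)]]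
      bad[OF assms(3,4,5,8)] bad[OF assms(4,3,5,7)] bad[OF assms(5,3,4,6)] by blast
qed

theorem outerplanar_no_crossing:
  assumes G: "simple_graph V E" "outerplanar V E" and dist: "distinct (a # P @ b # Q @ c # R @ d # S)"
    and cyc: "path_edges (a # P @ b # Q @ c # R @ d # S @ [a]) \<subseteq> E"
    and V: "set (a # P @ b # Q @ c # R @ d # S) \<subseteq> V" and ac: "{a, c} \<in> E" and bd: "{b, d} \<in> E"
  shows False
proof -
  obtain p \<gamma> where dr: "plane_drawing V E p \<gamma>" and o: "p ` V \<subseteq> frontier (outside (drawing_points V E p \<gamma>))"
    using G(2) unfolding outerplanar_def by blast
  define T where "T = drawing_points V E p \<gamma>"
  define D where "D ws = drawn \<gamma> (path_edges ws)" for ws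
  \<comment> \<open>The same cycle, cut at the ends of the chord \<open>a c\<close> and at the ends
    of the chord \<open>b d\<close>.\<close>
  let ?A = "a # P @ b # Q @ [c]" and ?B = "a # rev S @ d # rev R @ [c]"
  let ?A' = "b # Q @ c # R @ [d]" and ?B' = "b # rev P @ a # rev S @ [d]"
  have pe: "path_edges (a # P @ b # Q @ c # R @ d # S @ [a]) =
      path_edges (a # P @ [b]) \<union> path_edges (b # Q @ [c]) \<union> path_edges (c # R @ [d]) \<union> path_edges (d # S @ [a])"
    using path_edges_append[of "a # P" b "Q @ c # R @ d # S @ [a]"] path_edges_append[of "b # Q" c "R @ d # S @ [a]"]
      path_edges_append[of "c # R" d "S @ [a]"] by auto
  have r: "path_edges (d # rev R @ [c]) = path_edges (c # R @ [d])" "path_edges (a # rev S @ [d]) = path_edges (d # S @ [a])"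
    "path_edges (b # rev P @ [a]) = path_edges (a # P @ [b])"
    using path_edges_rev[of "c # R @ [d]"] path_edges_rev[of "d # S @ [a]"] path_edges_rev[of "a # P @ [b]"] by simp_all
  have eA: "path_edges ?A = path_edges (a # P @ [b]) \<union> path_edges (b # Q @ [c])"
    using path_edges_append[of "a # P" b "Q @ [c]"] by simp
  have eB: "path_edges ?B = path_edges (d # S @ [a]) \<union> path_edges (c # R @ [d])"
    using path_edges_append[of "a # rev S" d "rev R @ [c]"] r by simp
  have eA': "path_edges ?A' = path_edges (b # Q @ [c]) \<union> path_edges (c # R @ [d])"
    using path_edges_append[of "b # Q" c "R @ [d]"] by simp
  have eB': "path_edges ?B' = path_edges (a # P @ [b]) \<union> path_edges (d # S @ [a])"
    using path_edges_append[of "b # rev P" a "rev S @ [d]"] r by simp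
  have lA: "link V E a ?A c" using dist V cyc pe eA unfolding link_def by auto
  have lB: "link V E a ?B c" using dist V cyc pe eB unfolding link_def by auto
  have lA': "link V E b ?A' d" using dist V cyc pe eA' unfolding link_def by auto
  have lB': "link V E b ?B' d" using dist V cyc pe eB' unfolding link_def by auto
  have arc: "arc_between (D ws) (p x) (p y)" if "link V E x ws y" for ws x y
    using path_arc[OF dr, of ws] that unfolding link_def D_def by auto
  have int: "D ws \<inter> D vs = {p x, p y}"
    if "distinct ws" "2 \<le> length ws" "path_edges ws \<subseteq> E" "hd ws = x" "last ws = y"
      "link V E x vs y" "set ws \<inter> set vs = {x, y}" for ws vs x y
    unfolding D_def using that unfolding link_def by (intro paths_drawn_Int[OF dr _ _ _ _ _ _ _ _ _ _ G(1)]) auto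
  have sub: "D ws \<subseteq> T" if "path_edges ws \<subseteq> E" for ws
    using that unfolding D_def T_def drawn_def drawing_points_def by blast
  have C: "arc_between (D [a, c]) (p a) (p c)" "arc_between (D [b, d]) (p b) (p d)"
    using edge_arc[OF dr ac] edge_arc[OF dr bd] by (simp_all add: D_def drawn_def)
  have AB: "D ?A \<inter> D ?B = {p a, p c}"
    using lA lB dist by (intro int) (auto simp: link_def)
  have AC: "D ?A \<inter> D [a, c] = {p a, p c}"
    using lA ac dist by (subst Int_commute, intro int) auto
  have BC: "D ?B \<inter> D [a, c] = {p a, p c}"
    using lB ac dist by (subst Int_commute, intro int) auto
  have AB': "D ?A' \<inter> D ?B' = {p b, p d}"
    using lA' lB' dist by (intro int) (auto simp: link_def)
  have AD: "D ?A' \<inter> D [b, d] = {p b, p d}"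
    using lA' bd dist by (subst Int_commute, intro int) auto
  have BD: "D ?B' \<inter> D [b, d] = {p b, p d}"
    using lB' bd dist by (subst Int_commute, intro int) auto
  have CD: "D [a, c] \<inter> D [b, d] = {}"
  proof -
    have "{a, c} \<noteq> {b, d}" using dist by (auto simp: doubleton_eq_iff)
    then have "D [a, c] \<inter> D [b, d] \<subseteq> p ` (\<Union>{{a, c}} \<inter> \<Union>{{b, d}})"
      unfolding D_def path_edges.simps using ac bd by (intro drawn_Int_subset[OF dr]) auto
    also have "\<dots> = {}" using dist by auto
    finally show ?thesis by blast
  qed
  have eq: "D ?A \<union> D ?B = D ?A' \<union> D ?B'"
    unfolding D_def eA eB eA' eB' drawn_Un by blast
  have inj: "p x \<noteq> p y" if "x \<in> {a, b, c, d}" "y \<in> {a, b, c, d}" "x \<noteq> y" for x y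
    using dr V that unfolding plane_drawing_def inj_on_def by auto
  have on: "p v \<in> D ws" if "link V E x ws y" "v \<in> set ws" for v ws x y
    using vertex_on_path[OF dr, of ws v] that unfolding link_def D_def by simp
  show False
  proof (rule crossing_chords_not_outer[OF arc[OF lA] arc[OF lB] C(1) AB AC BC arc[OF lA'] arc[OF lB'] C(2)
        AB' AD BD CD eq])
    show "D ?A \<union> D ?B \<union> D [a, c] \<union> D [b, d] \<subseteq> T"
      using sub lA lB ac bd unfolding link_def by simp
    show "p b \<in> D ?A - {p a, p c}" using on[OF lA, of b] inj[of b] dist by auto
    show "p d \<in> D ?B - {p a, p c}" using on[OF lB, of d] inj[of d] dist by auto
    show "p a \<in> D ?B' - {p b, p d}" using on[OF lB', of a] inj[of a] dist by auto
    show "p c \<in> D ?A' - {p b, p d}" using on[OF lA', of c] inj[of c] dist by auto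
    show "{p a, p b, p c, p d} \<subseteq> frontier (outside T)" using o V unfolding T_def by auto
  qed
qed

section \<open>Noncrossing chords of a polygon and their gains\<close>

text \<open>For an edge \<open>i j\<close> of a polygon with chords, \<open>gain_map\<close> describes how a Lipschitz function with values \<open>0\<close> at
  \<open>i\<close> and \<open>1\<close> at \<open>j\<close> may be chosen on the arc from \<open>i\<close> to \<open>j\<close>. The ideal values \<open>-1\<close> on neighbours of \<open>i\<close> and \<open>2\<close>
  on neighbours of \<open>j\<close> would give \<open>\<kappa> \<le> 2/a + 2/b - 2\<close> for the degrees \<open>a\<close>, \<open>b\<close> of \<open>i\<close>, \<open>j\<close>; the total deviations \<open>k\<close> and \<open>l\<close>
  from them increase this bound by \<open>k/a + l/b\<close>. So \<open>curved_edge\<close> is what \<open>\<kappa> > 0\<close> implies.\<close>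

definition gain_map :: "(int \<Rightarrow> int \<Rightarrow> bool) \<Rightarrow> int \<Rightarrow> int \<Rightarrow> (int \<Rightarrow> int) \<Rightarrow> bool" where
  "gain_map R i j g \<longleftrightarrow>
     (\<forall>u\<in>{i<..<j}. R i u \<longrightarrow> - 1 \<le> g u \<and> g u \<le> 1) \<and>
     (\<forall>u\<in>{i<..<j}. R u j \<longrightarrow> 0 \<le> g u \<and> g u \<le> 2) \<and>
     (\<forall>u\<in>{i<..<j}. \<forall>w\<in>{i<..<j}. (R i u \<or> R u j) \<longrightarrow> (R i w \<or> R w j) \<longrightarrow> R u w \<longrightarrow>
        g w - g u \<le> 1) \<and>
     (\<forall>u\<in>{i<..<j}. \<forall>t\<in>{i<..<j}. \<forall>w\<in>{i<..<j}. R i u \<longrightarrow> R u t \<longrightarrow> R t w \<longrightarrow> R w j \<longrightarrow>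
        g w - g u \<le> 2)"

definition side_gain :: "(int \<Rightarrow> int \<Rightarrow> bool) \<Rightarrow> int \<Rightarrow> int \<Rightarrow> int \<Rightarrow> int \<Rightarrow> bool" where
  "side_gain R i j k l \<longleftrightarrow> (\<exists>g. gain_map R i j g \<and>
     (\<Sum>u\<in>{u\<in>{i<..<j}. R i u}. g u + 1) \<le> k \<and> (\<Sum>u\<in>{u\<in>{i<..<j}. R u j}. 2 - g u) \<le> l)"

definition cyc_degree :: "int \<Rightarrow> (int \<Rightarrow> int \<Rightarrow> bool) \<Rightarrow> int \<Rightarrow> int" where
  "cyc_degree n R i = int (card {k\<in>{i<..<i+n}. R i k})"

text \<open>When \<open>i j\<close> is an edge and chords do not cross, this says that the face next
  to it on the arc from \<open>i\<close> to \<open>j\<close> is a triangle.\<close>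

definition apex :: "(int \<Rightarrow> int \<Rightarrow> bool) \<Rightarrow> int \<Rightarrow> int \<Rightarrow> bool" where
  "apex R i j \<longleftrightarrow> (\<exists>m. i < m \<and> m < j \<and> R i m \<and> R m j)"

definition curved_edge :: "int \<Rightarrow> (int \<Rightarrow> int \<Rightarrow> bool) \<Rightarrow> int \<Rightarrow> int \<Rightarrow> bool" where
  "curved_edge n R i j \<longleftrightarrow> (\<forall>k1 l1 k2 l2. side_gain R i j k1 l1 \<longrightarrow> side_gain R j (i + n) l2 k2 \<longrightarrow>
     2 * cyc_degree n R i * cyc_degree n R j
       < (2 + k1 + k2) * cyc_degree n R j + (2 + l1 + l2) * cyc_degree n R i)"

lemma side_gain_mono: "side_gain R i j k l \<Longrightarrow> k \<le> k' \<Longrightarrow> l \<le> l' \<Longrightarrow> side_gain R i j k' l'"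
  unfolding side_gain_def by (meson order_trans)

lemma finite_int_filter [simp]: "finite {k :: int. s \<le> k \<and> k < t \<and> P k}" "finite {k :: int. s < k \<and> k < t \<and> P k}"
  by (rule finite_subset[of _ "{s..<t}"]; auto)+

text \<open>The function \<open>1 - g (- u)\<close> exchanges the two ends together with their
  values 0 and 1, hence also \<open>k\<close> and \<open>l\<close>.\<close>

lemma side_gain_mirror:
  assumes "side_gain R i j k l" and sym: "\<And>a b. R a b \<longleftrightarrow> R b a"
  shows "side_gain (\<lambda>a b. R (- a) (- b)) (- j) (- i) l k"
proof -
  obtain g :: "int \<Rightarrow> int" where g:
    "\<forall>u\<in>{i<..<j}. R i u \<longrightarrow> - 1 \<le> g u \<and> g u \<le> 1"
    "\<forall>u\<in>{i<..<j}. R u j \<longrightarrow> 0 \<le> g u \<and> g u \<le> 2"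
    "\<forall>u\<in>{i<..<j}. \<forall>w\<in>{i<..<j}. (R i u \<or> R u j) \<longrightarrow> (R i w \<or> R w j) \<longrightarrow> R u w \<longrightarrow> g w - g u \<le> 1"
    "\<forall>u\<in>{i<..<j}. \<forall>t\<in>{i<..<j}. \<forall>w\<in>{i<..<j}. R i u \<longrightarrow> R u t \<longrightarrow> R t w \<longrightarrow> R w j \<longrightarrow> g w - g u \<le> 2"
    "(\<Sum>u\<in>{u\<in>{i<..<j}. R i u}. g u + 1) \<le> k" "(\<Sum>u\<in>{u\<in>{i<..<j}. R u j}. 2 - g u) \<le> l"
    using assms(1) unfolding side_gain_def gain_map_def by blast
  have mem: "- u \<in> {i<..<j} \<longleftrightarrow> u \<in> {- j<..<- i}" for u by auto
  define h where "h u = 1 - g (- u)" for u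
  have s1: "(\<Sum>u\<in>{u\<in>{- j<..<- i}. R (- (- j)) (- u)}. h u + 1) = (\<Sum>u\<in>{u\<in>{i<..<j}. R u j}. 2 - g u)"
    by (rule sum.reindex_bij_witness[of _ uminus uminus]) (auto simp: h_def sym)
  have s2: "(\<Sum>u\<in>{u\<in>{- j<..<- i}. R (- u) (- (- i))}. 2 - h u) = (\<Sum>u\<in>{u\<in>{i<..<j}. R i u}. g u + 1)"
    by (rule sum.reindex_bij_witness[of _ uminus uminus]) (auto simp: h_def sym)
  have c1: "\<forall>u\<in>{- j<..<- i}. R (- (- j)) (- u) \<longrightarrow> - 1 \<le> h u \<and> h u \<le> 1"
    using g(2) sym mem unfolding h_def by fastforce
  have c2: "\<forall>u\<in>{- j<..<- i}. R (- u) (- (- i)) \<longrightarrow> 0 \<le> h u \<and> h u \<le> 2"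
    using g(1) sym mem unfolding h_def by fastforce
  have c3: "h w - h u \<le> 1"
    if "u \<in> {- j<..<- i}" "w \<in> {- j<..<- i}" "R (- (- j)) (- u) \<or> R (- u) (- (- i))"
       "R (- (- j)) (- w) \<or> R (- w) (- (- i))" "R (- u) (- w)" for u w
  proof -
    have "R i (- w) \<or> R (- w) j" "R i (- u) \<or> R (- u) j" "R (- w) (- u)"
      using that(3-5) sym by auto
    then have "g (- u) - g (- w) \<le> 1" using g(3) that(1,2) mem by blast
    then show ?thesis by (simp add: h_def)
  qed
  have c4: "h w - h u \<le> 2"
    if "u \<in> {- j<..<- i}" "t \<in> {- j<..<- i}" "w \<in> {- j<..<- i}" "R (- (- j)) (- u)" "R (- u) (- t)"
       "R (- t) (- w)" "R (- w) (- (- i))" for u t w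
  proof -
    have "R i (- w)" "R (- w) (- t)" "R (- t) (- u)" "R (- u) j" using that(4-7) sym by auto
    then have "g (- u) - g (- w) \<le> 2" using g(4) that(1-3) mem by blast
    then show ?thesis by (simp add: h_def)
  qed
  show ?thesis unfolding side_gain_def gain_map_def
    using c1 c2 c3 c4 s1 s2 g(5,6) by (intro exI[of _ h] conjI) (blast | simp)+
qed

text \<open>Vertices are integers modulo \<open>n\<close>, with \<open>R\<close> lifted
  periodically: every arc is then an interval, even when it passes 0, and an edge \<open>i j\<close>
  has the sides from \<open>i\<close> to \<open>j\<close> and from \<open>j\<close> to
  \<open>i + n\<close>.\<close>

locale polygon =
  fixes n :: int and R :: "int \<Rightarrow> int \<Rightarrow> bool"
  assumes n3: "3 \<le> n"
    and sym: "R i j \<longleftrightarrow> R j i"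
    and periodic: "R (i + n) j \<longleftrightarrow> R i j"
    and irrefl: "\<not> R i i"
    and R_succ: "R i (i + 1)"
    and noncrossing: "i < k \<Longrightarrow> k < j \<Longrightarrow> j < l \<Longrightarrow> l < i + n \<Longrightarrow> R i j \<Longrightarrow> \<not> R k l"
begin

abbreviation "deg \<equiv> cyc_degree n R"
abbreviation "gain \<equiv> side_gain R"
abbreviation "tri \<equiv> apex R"
abbreviation "curved \<equiv> curved_edge n R"

lemma R_pred: "R i (i - 1)"
  using R_succ[of "i - 1"] sym[of i "i - 1"] by simp

lemma periodic2: "R i (j + n) \<longleftrightarrow> R i j"
  using periodic sym by blast

lemma periodic_minus: "R (i - n) j \<longleftrightarrow> R i j" "R i (j - n) \<longleftrightarrow> R i j"
  using periodic[of "i - n" j] periodic2[of i "j - n"] by auto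

text \<open>Reflection exchanges the sides before and after a vertex; several of the left and right
  lemmas below are obtained from one another in this way.\<close>

lemma mirror: "polygon n (\<lambda>i j. R (- i) (- j))"
proof
  show "3 \<le> n" by (rule n3)
next
  fix i j show "R (- i) (- j) \<longleftrightarrow> R (- j) (- i)" by (rule sym)
next
  fix i j show "R (- (i + n)) (- j) \<longleftrightarrow> R (- i) (- j)"
    using periodic_minus(1)[of "- i" "- j"] by simp
next
  fix i show "\<not> R (- i) (- i)" by (rule irrefl)
next
  fix i show "R (- i) (- (i + 1))" using R_pred[of "- i"] by (metis minus_add_distrib uminus_add_conv_diff add.commute)
next
  fix i j k l :: int assume a: "i < k" "k < j" "j < l" "l < i + n" and r: "R (- i) (- j)"
  have "R (- j) (n - i)" using r sym periodic2[of "- j" "- i"] by (simp add: algebra_simps)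
  with noncrossing[of "- l" "- j" "- k" "n - i"] a have "\<not> R (- l) (- k)"
    by (auto simp: algebra_simps) (smt (verit) noncrossing periodic_minus(2) sym)
  then show "\<not> R (- k) (- l)" using sym by blast
qed

lemma window_eq:
  "card {k\<in>{s..<s+n}. R v k} = card {k\<in>{t..<t+n}. R v k}"
proof -
  have step: "card {k\<in>{s..<s+n}. R v k} = card {k\<in>{s+1..<s+1+n}. R v k}" for s
  proof -
    have *: "{k\<in>{s..<s+n}. R v k} = (if R v s then {s} else {}) \<union> {k\<in>{s+1..<s+n}. R v k}"
      using n3 by (auto split: if_splits; smt (verit))
    have **: "{k\<in>{s+1..<s+1+n}. R v k} = (if R v s then {s+n} else {}) \<union> {k\<in>{s+1..<s+n}. R v k}"
      using n3 periodic2[of v s] by (auto split: if_splits; smt (verit))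
    have f: "finite {k\<in>{s+1..<s+n}. R v k}" by simp
    show ?thesis unfolding * ** using f by auto
  qed
  have A: "card {k\<in>{s..<s+n}. R v k} = card {k\<in>{s+int m..<s+int m+n}. R v k}" for s m
    by (induction m) (use step[of "s + int _"] in \<open>auto simp: algebra_simps\<close>)
  show ?thesis
  proof (cases "s \<le> t")
    case True then show ?thesis using A[of s "nat (t - s)"] by simp
  next
    case False then show ?thesis using A[of t "nat (s - t)"] by simp
  qed
qed

lemma deg_window: "deg v = int (card {k\<in>{s..<s+n}. R v k})"
proof -
  have "{k\<in>{v<..<v+n}. R v k} = {k\<in>{v..<v+n}. R v k}"
    using irrefl by (auto simp: order_le_less)
  then show ?thesis unfolding cyc_degree_def using window_eq[of v v s] by simp
qed

lemma deg_ge: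
  assumes "A \<subseteq> {s..<s+n}" "\<And>k. k \<in> A \<Longrightarrow> R v k"
  shows "int (card A) \<le> deg v"
proof -
  have "card A \<le> card {k\<in>{s..<s+n}. R v k}" by (rule card_mono) (use assms in auto)
  then show ?thesis using deg_window[of v s] by simp
qed

text \<open>The counting principle used throughout: once as many neighbours are named as the degree
  allows, there are no others.\<close>

lemma nbrs_eq:
  assumes "A \<subseteq> {s..<s+n}" "\<And>k. k \<in> A \<Longrightarrow> R v k" "deg v \<le> int (card A)"
  shows "{k\<in>{s..<s+n}. R v k} = A"
proof -
  have "A = {k\<in>{s..<s+n}. R v k}"
    by (rule card_seteq) (use assms deg_window[of v s] in auto)
  then show ?thesis by simp
qed

lemma deg_ge2: "2 \<le> deg v"
  proof -
  have "R v (v + n - 1)" using R_pred[of v] periodic2[of v "v - 1"] by (simp add: algebra_simps)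
  then have "int (card {v + 1, v + n - 1}) \<le> deg v"
    using n3 R_succ by (intro deg_ge[of _ v]) auto
  then show ?thesis using n3 by simp
qed

lemma deg_shift: "deg (i + n) = deg i"
proof -
  have "R (i + n) = R i" using periodic by blast
  then show ?thesis using deg_window[of i 0] deg_window[of "i + n" 0] by simp
qed

text \<open>All gains come from an assignment that is \<open>-1\<close> near \<open>i\<close>, \<open>2\<close> near \<open>j\<close> and changes value around the
  face at the chord \<open>i j\<close>; a violated Lipschitz condition would yield a pair of crossing chords.\<close>

lemma gain_first:
  assumes ij: "j < i + n" and w: "i < w" "w < j" "R w j" "\<And>u. i < u \<Longrightarrow> u < w \<Longrightarrow> \<not> R u j"
  shows "gain i j (if R i w then 1 else 0) (if tri w j then 3 else 2)"
proof -
  define g :: "int \<Rightarrow> int" where "g u = (if u < w then - 1 else if u = w then 0 else if R w u then 1 else 2)" for u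
  have nc: "\<not> R u x" if "i \<le> u" "u < w" "w < x" "x < j" for u x
    using noncrossing[of u w x j] that ij w by auto
  have s1: "(\<Sum>u\<in>{u\<in>{i<..<j}. R i u}. g u + 1) \<le> (if R i w then 1 else 0)"
  proof -
    have "(\<Sum>u\<in>{u\<in>{i<..<j}. R i u}. g u + 1) = (\<Sum>u\<in>{u\<in>{i<..<j}. R i u}. if u = w then 1 else 0)"
    proof (rule sum.cong)
      fix u assume u: "u \<in> {u\<in>{i<..<j}. R i u}"
      then have "\<not> w < u" using nc[of i u] w by auto
      then show "g u + 1 = (if u = w then 1 else 0)" by (auto simp: g_def)
    qed simp
    then show ?thesis using w by simp
  qed
  have s2: "(\<Sum>u\<in>{u\<in>{i<..<j}. R u j}. 2 - g u) \<le> (if tri w j then 3 else 2)"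
  proof (cases "tri w j")
    case False
    have "(\<Sum>u\<in>{u\<in>{i<..<j}. R u j}. 2 - g u) = (\<Sum>u\<in>{u\<in>{i<..<j}. R u j}. if u = w then 2 else 0)"
    proof (rule sum.cong)
      fix u assume u: "u \<in> {u\<in>{i<..<j}. R u j}"
      then have "\<not> u < w" "w < u \<Longrightarrow> \<not> R w u" using w(4)[of u] False by (auto simp: apex_def)
      then show "2 - g u = (if u = w then 2 else 0)" by (auto simp: g_def)
    qed simp
    then show ?thesis using False w by simp
  next
    case True
    then obtain s where s: "w < s" "s < j" "R w s" "R s j" unfolding apex_def by blast
    have un: "u = s" if "w < u" "u < j" "R w u" "R u j" for u
      using noncrossing[of w s u j] noncrossing[of w u s j] s that ij w by force
    have "(\<Sum>u\<in>{u\<in>{i<..<j}. R u j}. 2 - g u)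
      = (\<Sum>u\<in>{u\<in>{i<..<j}. R u j}. (if u = w then 2 else 0) + (if u = s then 1 else 0))"
    proof (rule sum.cong)
      fix u assume u: "u \<in> {u\<in>{i<..<j}. R u j}"
      then have "u = w \<or> w < u \<and> (R w u \<longleftrightarrow> u = s)"
        using w(4)[of u] un[of u] s(3) by (metis (no_types, lifting) greaterThanLessThan_iff linorder_less_linear mem_Collect_eq)
      moreover have "w \<noteq> s" using s(1) by simp
      ultimately show "2 - g u = (if u = w then 2 else 0) + (if u = s then 1 else 0)"
        by (elim disjE) (simp_all add: g_def)
    qed simp
    then show ?thesis using True s w by (simp add: sum.distrib)
  qed
  have c1: "\<forall>u\<in>{i<..<j}. R i u \<longrightarrow> - 1 \<le> g u \<and> g u \<le> 1"
  proof (intro ballI impI)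
    fix u assume "u \<in> {i<..<j}" "R i u"
    then have "\<not> w < u" using nc[of i u] w by auto
    then show "- 1 \<le> g u \<and> g u \<le> 1" by (auto simp: g_def)
  qed
  have c2: "\<forall>u\<in>{i<..<j}. R u j \<longrightarrow> 0 \<le> g u \<and> g u \<le> 2"
    using w(4) by (auto simp: g_def)
  have c3: "\<forall>u\<in>{i<..<j}. \<forall>x\<in>{i<..<j}. (R i u \<or> R u j) \<longrightarrow> (R i x \<or> R x j) \<longrightarrow> R u x \<longrightarrow> g x - g u \<le> 1"
  proof (intro ballI impI)
    fix u x assume "u \<in> {i<..<j}" "x \<in> {i<..<j}" "R u x"
    then show "g x - g u \<le> 1" using nc[of u x] by (auto simp: g_def)
  qed
  have c4: "g x - g u \<le> 2"
    if "u\<in>{i<..<j}" "t\<in>{i<..<j}" "x\<in>{i<..<j}" "R u t" "R t x" for u t x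
    using nc[of u x] nc[of u t] nc[of t x] that
    by (cases t w rule: linorder_cases) (auto simp: g_def split: if_splits)
  show ?thesis unfolding side_gain_def gain_map_def
    using s1 s2 c1 c2 c3 c4 by (intro exI[of _ g] conjI) blast+
qed

text \<open>Serves faces with at least four vertices: \<open>m\<close> is the last neighbour of
  \<open>i\<close>, \<open>w\<close> the first one of \<open>j\<close>. The values climb through
  \<open>- 1, e, 0, 1, 2\<close> along the arc, so only \<open>m\<close> and \<open>w\<close> can
  deviate from the ideal. Taking \<open>e = - 1\<close> removes the deviation at \<open>i\<close>
  but puts \<open>m\<close> and \<open>w\<close> two apart, which is why they must not be
  adjacent.\<close>

lemma gain_remote:
  fixes e :: int
  assumes ij: "j < i + n" and m: "i < m" "R i m" "\<And>u. m < u \<Longrightarrow> u < j \<Longrightarrow> \<not> R i u"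
    and w: "w < j" "R w j" "\<And>u. i < u \<Longrightarrow> u < w \<Longrightarrow> \<not> R u j" and mw: "m < w" and e: "e = 0 \<or> e = - 1 \<and> \<not> R m w"
  shows "gain i j (e + 1) 1"
proof -
  define g :: "int \<Rightarrow> int" where
    "g u = (if u < m then - 1 else if u = m then e else if u < w then 0 else if u = w then 1 else 2)" for u
  have nc: "\<not> R u x" if "i \<le> u" "u < w" "w < x" "x < j" for u x
    using noncrossing[of u w x j] that ij w by auto
  have nc': "\<not> R u x" if "i < u" "u < m" "m < x" "x \<le> j" for u x
    using noncrossing[of i u m x] that ij m by auto
  have s1: "(\<Sum>u\<in>{u\<in>{i<..<j}. R i u}. g u + 1) = (\<Sum>u\<in>{u\<in>{i<..<j}. R i u}. if u = m then e + 1 else 0)"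
  proof (rule sum.cong)
    fix u assume u: "u \<in> {u\<in>{i<..<j}. R i u}"
    then have "\<not> m < u" using m(3)[of u] by auto
    then show "g u + 1 = (if u = m then e + 1 else 0)" using mw by (auto simp: g_def)
  qed simp
  have s2: "(\<Sum>u\<in>{u\<in>{i<..<j}. R u j}. 2 - g u) = (\<Sum>u\<in>{u\<in>{i<..<j}. R u j}. if u = w then 1 else 0)"
  proof (rule sum.cong)
    fix u assume u: "u \<in> {u\<in>{i<..<j}. R u j}"
    then have "\<not> u < w" using w(3)[of u] by auto
    then show "2 - g u = (if u = w then 1 else 0)" using mw by (auto simp: g_def)
  qed simp
  have c1: "\<forall>u\<in>{i<..<j}. R i u \<longrightarrow> - 1 \<le> g u \<and> g u \<le> 1"
  proof (intro ballI impI)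
    fix u assume "u \<in> {i<..<j}" "R i u"
    then have "\<not> m < u" using m(3)[of u] by auto
    then show "- 1 \<le> g u \<and> g u \<le> 1" using mw e by (auto simp: g_def)
  qed
  have c2: "\<forall>u\<in>{i<..<j}. R u j \<longrightarrow> 0 \<le> g u \<and> g u \<le> 2"
  proof (intro ballI impI)
    fix u assume "u \<in> {i<..<j}" "R u j"
    then have "\<not> u < w" using w(3)[of u] by auto
    then show "0 \<le> g u \<and> g u \<le> 2" using mw by (auto simp: g_def)
  qed
  have c3: "g x - g u \<le> 1"
    if "u\<in>{i<..<j}" "x\<in>{i<..<j}" "R i u \<or> R u j" "R i x \<or> R x j" "R u x" for u x
  proof -
    have "\<not> m < u \<or> \<not> u < w" "\<not> m < x \<or> \<not> x < w" using that m(3)[of u] w(3)[of u] m(3)[of x] w(3)[of x] by auto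
    then show ?thesis
      using nc[of u x] nc'[of u x] mw e that by (cases "u = m"; cases "x = w") (auto simp: g_def)
  qed
  have c4: "g x - g u \<le> 2"
    if "u\<in>{i<..<j}" "t\<in>{i<..<j}" "x\<in>{i<..<j}" "R u t" "R t x" for u t x
  proof (rule ccontr)
    assume "\<not> g x - g u \<le> 2"
    then have "u < m \<or> u = m \<and> e = - 1" "w < x" using e by (auto simp: g_def split: if_splits)
    then show False
      using nc[of u t] nc[of t x] nc'[of u w] mw e that w(1)
      by (cases t w rule: linorder_cases; cases "u = m") auto
  qed
  have "gain_map R i j g" unfolding gain_map_def
    using c1 c2 c3 c4 by (intro conjI ballI impI) blast+
  moreover have "(\<Sum>u\<in>{u\<in>{i<..<j}. R i u}. g u + 1) \<le> e + 1" "(\<Sum>u\<in>{u\<in>{i<..<j}. R u j}. 2 - g u) \<le> 1"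
    unfolding s1 s2 using m(1,2) w(1,2) mw by simp_all
  ultimately show ?thesis unfolding side_gain_def by blast
qed

lemma gain_outer: "gain i (i + 1) 0 0"
proof -
  have "{i<..<i+1} = {}" by auto
  then show ?thesis unfolding side_gain_def gain_map_def by simp
qed

end

text \<open>Degrees are mostly known only through lower bounds; expanding
  \<open>(a - p) * (b - q)\<close> makes their product accessible to linear arithmetic.\<close>

lemma int_mult_lower:
  fixes a b p q :: int
  assumes "p \<le> a" "q \<le> b"
  shows "q * a + p * b - p * q \<le> a * b"
proof -
  have "0 \<le> (a - p) * (b - q)" using assms by simp
  then show ?thesis by (simp add: algebra_simps)
qed

context polygon
begin

lemma gain_shift: "gain (i + n) (j + n) k l \<Longrightarrow> gain i j k l"
proof -
  assume "gain (i + n) (j + n) k l"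
  then obtain g where g: "gain_map R (i + n) (j + n) g"
    "(\<Sum>u\<in>{u\<in>{i+n<..<j+n}. R (i + n) u}. g u + 1) \<le> k"
    "(\<Sum>u\<in>{u\<in>{i+n<..<j+n}. R u (j + n)}. 2 - g u) \<le> l"
    unfolding side_gain_def by blast
  define h where "h u = g (u + n)" for u
  have s1: "(\<Sum>u\<in>{u\<in>{i<..<j}. R i u}. h u + 1) = (\<Sum>u\<in>{u\<in>{i+n<..<j+n}. R (i + n) u}. g u + 1)"
    by (rule sum.reindex_bij_witness[of _ "\<lambda>u. u - n" "\<lambda>u. u + n"])
       (auto simp: h_def periodic periodic2 periodic_minus)
  have s2: "(\<Sum>u\<in>{u\<in>{i<..<j}. R u j}. 2 - h u) = (\<Sum>u\<in>{u\<in>{i+n<..<j+n}. R u (j + n)}. 2 - g u)"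
    by (rule sum.reindex_bij_witness[of _ "\<lambda>u. u - n" "\<lambda>u. u + n"])
       (auto simp: h_def periodic periodic2 periodic_minus)
  have mem: "u + n \<in> {i+n<..<j+n} \<longleftrightarrow> u \<in> {i<..<j}" for u by auto
  have "gain_map R i j h"
    unfolding gain_map_def
  proof (intro conjI ballI impI)
    note G = g(1)[unfolded gain_map_def, THEN conjunct1] g(1)[unfolded gain_map_def, THEN conjunct2]
    fix u assume u: "u \<in> {i<..<j}"
    show "- 1 \<le> h u" "h u \<le> 1" if "R i u"
      using G(1) u that mem[of u] by (auto simp: h_def periodic periodic2)
    show "0 \<le> h u" "h u \<le> 2" if "R u j"
      using G(2) u that mem[of u] by (auto simp: h_def periodic periodic2)
    show "h w - h u \<le> 1"
      if "w \<in> {i<..<j}" "R i u \<or> R u j" "R i w \<or> R w j" "R u w" for w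
      using G(2)[THEN conjunct2, THEN conjunct1, rule_format, of "u + n" "w + n"] u that mem
      by (simp add: h_def periodic periodic2)
    show "h w - h u \<le> 2"
      if "t \<in> {i<..<j}" "w \<in> {i<..<j}" "R i u" "R u t" "R t w" "R w j" for t w
      using G(2)[THEN conjunct2, THEN conjunct2, rule_format, of "u + n" "t + n" "w + n"] u that mem
      by (simp add: h_def periodic periodic2)
  qed
  then show ?thesis unfolding side_gain_def using s1 s2 g(2,3) by (intro exI[of _ h] conjI) simp_all
qed

lemma gain_mirror_iff: "side_gain (\<lambda>a b. R (- a) (- b)) (- j) (- i) l k \<longleftrightarrow> gain i j k l"
proof
  assume "side_gain (\<lambda>a b. R (- a) (- b)) (- j) (- i) l k"
  then have "side_gain (\<lambda>a b. R (- (- a)) (- (- b))) (- (- i)) (- (- j)) k l"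
    by (rule side_gain_mirror) (rule sym)
  then show "gain i j k l" by simp
next
  assume "gain i j k l"
  then show "side_gain (\<lambda>a b. R (- a) (- b)) (- j) (- i) l k"
    by (rule side_gain_mirror) (rule sym)
qed

lemma gain_last:
  assumes ij: "j < i + n" and m: "i < m" "m < j" "R i m" "\<And>u. m < u \<Longrightarrow> u < j \<Longrightarrow> \<not> R i u"
  shows "gain i j (if tri i m then 3 else 2) (if R m j then 1 else 0)"
proof -
  interpret M: polygon n "\<lambda>i j. R (- i) (- j)" by (rule mirror)
  have a: "apex (\<lambda>i j. R (- i) (- j)) (- m) (- i) = tri i m"
    unfolding apex_def using sym by (metis add.inverse_inverse neg_less_iff_less)
  have "M.gain (- j) (- i) (if R j m then 1 else 0) (if tri i m then 3 else 2)"
    using M.gain_first[of "- i" "- j" "- m"] m ij sym a by (auto simp: minus_less_iff)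
  then show ?thesis using gain_mirror_iff[of j i] sym[of m j] by simp
qed

lemma mirror_degree: "cyc_degree n (\<lambda>i j. R (- i) (- j)) i = deg (- i)"
proof -
  interpret M: polygon n "\<lambda>i j. R (- i) (- j)" by (rule mirror)
  have "card {k\<in>{1 - n..<1 - n + n}. R (- i) (- k)} = card {k\<in>{0..<0 + n}. R (- i) k}"
    by (rule bij_betw_same_card[of uminus], rule bij_betwI[of _ _ _ uminus]) auto
  then show ?thesis using M.deg_window[of i "1 - n"] deg_window[of "- i" 0] by simp
qed

lemma mirror_curved:
  assumes "curved i j"
  shows "curved_edge n (\<lambda>i j. R (- i) (- j)) (- j) (- i)"
proof -
  have *: "2 * deg i * deg j < (2 + k1 + k2) * deg j + (2 + l1 + l2) * deg i"
    if "gain i j k1 l1" "gain j (i + n) l2 k2" for k1 l1 k2 l2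
    using assms that unfolding curved_edge_def by blast
  show ?thesis
    unfolding curved_edge_def mirror_degree
  proof (intro allI impI)
    fix k1 l1 k2 l2
    assume a: "side_gain (\<lambda>i j. R (- i) (- j)) (- j) (- i) k1 l1"
      and b: "side_gain (\<lambda>i j. R (- i) (- j)) (- i) (- j + n) l2 k2"
    have "side_gain (\<lambda>i j. R (- i) (- j)) (- i) (- (j - n)) l2 k2" using b by simp
    then have "gain (j - n) i k2 l2" using gain_mirror_iff[of i "j - n"] by simp
    then have "gain j (i + n) k2 l2"
    proof -
      interpret N: polygon n "\<lambda>i j. R (- i) (- j)" by (rule mirror)
      have "side_gain (\<lambda>i j. R (- i) (- j)) (- (i + n) + n) (- j + n) l2 k2"
        using b by simp
      then have "side_gain (\<lambda>i j. R (- i) (- j)) (- (i + n)) (- j) l2 k2" by (rule N.gain_shift)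
      then show ?thesis using gain_mirror_iff[of "i + n" j] by simp
    qed
    with a have "2 * deg i * deg j < (2 + l1 + l2) * deg j + (2 + k1 + k2) * deg i"
      using *[of l1 k1 k2 l2] gain_mirror_iff[of j i] by simp
    then show "2 * deg (- (- j)) * deg (- (- i)) < (2 + k1 + k2) * deg (- (- i)) + (2 + l1 + l2) * deg (- (- j))"
      by (simp add: algebra_simps)
  qed
qed

lemma first_nbr:
  assumes "p + 1 < q"
  obtains w where "p < w" "w < q" "R w q" "\<And>u. p < u \<Longrightarrow> u < w \<Longrightarrow> \<not> R u q"
proof -
  let ?S = "{u. p < u \<and> u < q \<and> R u q}"
  have "R (q - 1) q" using R_succ[of "q - 1"] by simp
  then have "q - 1 \<in> ?S" using assms by (intro CollectI conjI) auto
  then have "?S \<noteq> {}" by blast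
  moreover have "finite ?S" by simp
  ultimately have "Min ?S \<in> ?S" by (intro Min_in)
  moreover have "\<not> R u q" if "p < u" "u < Min ?S" for u
  proof
    assume "R u q"
    then have "u \<in> ?S" using that \<open>Min ?S \<in> ?S\<close> by auto
    then have "Min ?S \<le> u" by (intro Min_le) auto
    then show False using that by simp
  qed
  ultimately show ?thesis using that[of "Min ?S"] by blast
qed

lemma last_nbr:
  assumes "p + 1 < q"
  obtains m where "p < m" "m < q" "R p m" "\<And>u. m < u \<Longrightarrow> u < q \<Longrightarrow> \<not> R p u"
proof -
  let ?S = "{u. p < u \<and> u < q \<and> R p u}"
  have "p + 1 \<in> ?S" using assms R_succ[of p] by (intro CollectI conjI) auto
  then have "?S \<noteq> {}" by blast
  moreover have "finite ?S" by simp
  ultimately have "Max ?S \<in> ?S" by (intro Max_in)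
  moreover have "\<not> R p u" if "Max ?S < u" "u < q" for u
  proof
    assume "R p u"
    then have "u \<in> ?S" using that \<open>Max ?S \<in> ?S\<close> by auto
    then have "u \<le> Max ?S" by (intro Max_ge) auto
    then show False using that by simp
  qed
  ultimately show ?thesis using that[of "Max ?S"] by blast
qed

text \<open>The worst case of \<open>gain_first\<close>, available on every arc with an inner
  vertex.\<close>

lemma gain_first_any:
  assumes "p + 1 < q" "q < p + n" shows "gain p q 1 3"
proof -
  obtain w where "p < w" "w < q" "R w q" "\<And>u. p < u \<Longrightarrow> u < w \<Longrightarrow> \<not> R u q"
    using first_nbr[OF assms(1)] by metis
  from gain_first[OF assms(2) this] show ?thesis by (rule side_gain_mono) auto
qed

lemma gain_last_any:
  assumes "p + 1 < q" "q < p + n" shows "gain p q 3 1"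
proof -
  obtain m where "p < m" "m < q" "R p m" "\<And>u. m < u \<Longrightarrow> u < q \<Longrightarrow> \<not> R p u"
    using last_nbr[OF assms(1)] by metis
  from gain_last[OF assms(2) this] show ?thesis by (rule side_gain_mono) auto
qed

lemma nbr_order:
  assumes "q < p + n" "p < m" "m < q" "R p m" "p < w" "w < q" "R w q"
  shows "m \<le> w"
  using noncrossing[of p w m q] assms by (meson not_less)

text \<open>Without a triangle the last neighbour \<open>m\<close> of \<open>p\<close> strictly
  precedes the first neighbour \<open>w\<close> of \<open>q\<close>. This permits the balanced
  assignment of \<open>gain_remote\<close>, and in the two one-sided assignments it saves the
  deviation that a common neighbour would cause.\<close>

lemma gain_nontri:
  assumes "p + 1 < q" "q < p + n" "\<not> tri p q"
  shows "gain p q 1 1" "gain p q 0 3" "gain p q 3 0"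
proof -
  obtain m where m: "p < m" "m < q" "R p m" "\<And>u. m < u \<Longrightarrow> u < q \<Longrightarrow> \<not> R p u"
    using last_nbr[OF assms(1)] by metis
  obtain w where w: "p < w" "w < q" "R w q" "\<And>u. p < u \<Longrightarrow> u < w \<Longrightarrow> \<not> R u q"
    using first_nbr[OF assms(1)] by metis
  have n: "\<not> R m q" "\<not> R p w" using assms(3) m w unfolding apex_def by blast+
  have "m \<le> w" using nbr_order[of q p m w] assms(2) m w by blast
  then have "m < w" using n m by (cases "m = w") (use w in auto)
  then show "gain p q 1 1" using gain_remote[of q p m w 0] assms m w by simp
  have "gain p q 0 (if tri w q then 3 else 2)" using gain_first[of q p w] n w assms by simp
  then show "gain p q 0 3" by (rule side_gain_mono) auto
  have "gain p q (if tri p m then 3 else 2) 0" using gain_last[of q p m] n m assms by simp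
  then show "gain p q 3 0" by (rule side_gain_mono) auto
qed

lemma curvedD:
  assumes "curved i j" "gain i j k1 l1" "gain j (i + n) l2 k2"
  shows "2 * (deg i * deg j) < (2 + k1 + k2) * deg j + (2 + l1 + l2) * deg i"
  using assms unfolding curved_edge_def by (auto simp: mult.assoc)

text \<open>The worst case \<open>(1, 3)\<close> on the nonempty side gives
  \<open>2 a b < 5 b + 3 a\<close> for the degrees \<open>a\<close>, \<open>b\<close> of the two
  ends. This is weakest for \<open>b = 2\<close>, where it reads \<open>a < 10\<close>.\<close>

lemma degree_le_9:
  assumes "curved i (i + 1)"
  shows "deg i \<le> 9"
proof (rule ccontr)
  assume "\<not> deg i \<le> 9"
  then have a: "10 \<le> deg i" by simp
  have "gain (i + 1) (i + n) 1 3" using n3 by (intro gain_first_any) auto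
  from curvedD[OF assms gain_outer this]
  show False using int_mult_lower[OF a deg_ge2[of "i + 1"]] a deg_ge2[of "i + 1"] by (simp add: algebra_simps)
qed

end

section \<open>Outer edges of a curved polygon\<close>

locale curved_polygon = polygon +
  assumes curved: "i < j \<Longrightarrow> j < i + n \<Longrightarrow> R i j \<Longrightarrow> curved i j"
begin

lemma mirror: "curved_polygon n (\<lambda>i j. R (- i) (- j))"
proof -
  interpret M: polygon n "\<lambda>i j. R (- i) (- j)" by (rule mirror)
  show ?thesis
  proof
    fix i j assume "i < j" "j < i + n" "R (- i) (- j)"
    then show "curved_edge n (\<lambda>i j. R (- i) (- j)) i j"
      using mirror_curved[of "- j" "- i"] curved[of "- j" "- i"] sym by simp
  qed
qed

lemma outer_ineq:
  assumes "gain (i + 1) (i + n) l k"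
  shows "2 * (deg i * deg (i + 1)) < (2 + k) * deg (i + 1) + (2 + l) * deg i"
  using curvedD[OF curved gain_outer assms] n3 R_succ by simp

lemma outer_ge3_tri:
  assumes "3 \<le> deg i" "3 \<le> deg (i + 1)"
  shows "tri (i + 1) (i + n)"
proof (rule ccontr)
  assume "\<not> tri (i + 1) (i + n)"
  then have "gain (i + 1) (i + n) 1 1" using n3 by (intro gain_nontri) auto
  from outer_ineq[OF this] int_mult_lower[OF assms] assms show False by (simp add: algebra_simps)
qed

text \<open>The sum of the inequalities from the gains \<open>(1, 3)\<close> and
  \<open>(3, 1)\<close> is \<open>4 a b < 8 a + 8 b\<close>.\<close>

lemma outer_not_both_ge4: "\<not> (4 \<le> deg i \<and> 4 \<le> deg (i + 1))"
proof
  assume a: "4 \<le> deg i \<and> 4 \<le> deg (i + 1)"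
  have "gain (i + 1) (i + n) 1 3" "gain (i + 1) (i + n) 3 1"
    using n3 by (intro gain_first_any gain_last_any; simp)+
  from outer_ineq[OF this(1)] outer_ineq[OF this(2)] a int_mult_lower[of 4 "deg i" 4 "deg (i + 1)"]
  show False by (simp add: algebra_simps)
qed

text \<open>The inequality \<open>2 a b < 5 b + 3 a\<close> fails for \<open>a \<ge> 5\<close> and
  \<open>b \<ge> 3\<close>. Once \<open>b = 2\<close>, a face other than a triangle would improve
  the gain to \<open>(0, 3)\<close>, and \<open>4 a < 10 + 2 a\<close> fails too.\<close>

lemma outer_big:
  assumes "5 \<le> deg i"
  shows "deg (i + 1) = 2" "tri (i + 1) (i + n)"
proof -
  have "gain (i + 1) (i + n) 1 3" using n3 by (intro gain_first_any) auto
  from outer_ineq[OF this] int_mult_lower[of 5 "deg i" 3 "deg (i + 1)"] assms deg_ge2[of "i + 1"]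
  show d: "deg (i + 1) = 2" by (cases "3 \<le> deg (i + 1)") (auto simp: algebra_simps)
  show "tri (i + 1) (i + n)"
  proof (rule ccontr)
    assume "\<not> tri (i + 1) (i + n)"
    then have "gain (i + 1) (i + n) 0 3" using n3 by (intro gain_nontri) auto
    from outer_ineq[OF this] d assms show False by simp
  qed
qed

lemma deg2_nbrs:
  assumes "deg v = 2" "v < k" "k < v + n" "R v k"
  shows "k = v + 1 \<or> k = v + n - 1"
proof -
  have "R v (v + n - 1)" using R_pred[of v] periodic2[of v "v - 1"] by (simp add: algebra_simps)
  then have "{k\<in>{v..<v+n}. R v k} = {v + 1, v + n - 1}"
    using assms(1) n3 R_succ by (intro nbrs_eq) auto
  moreover have "k \<in> {k\<in>{v..<v+n}. R v k}" using assms by simp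
  ultimately show ?thesis by blast
qed

text \<open>A face with five or more vertices would admit \<open>gain_remote\<close> with
  \<open>e = - 1\<close>; the resulting gain \<open>(0, 1)\<close> is too small for
  \<open>deg i \<ge> 3\<close>. So the face is the quadrilateral \<open>i\<close>,
  \<open>i + 1\<close>, \<open>i + 2\<close>, \<open>w\<close>.\<close>

lemma outer_nontri:
  assumes "\<not> tri (i + 1) (i + n)" "3 \<le> deg i"
  shows "deg (i + 1) = 2"
    and "i + 1 < w \<Longrightarrow> w < i + n \<Longrightarrow> R w i \<Longrightarrow> (\<And>x. i + 1 < x \<Longrightarrow> x < w \<Longrightarrow> \<not> R x i) \<Longrightarrow>
      i + 2 < w \<Longrightarrow> R (i + 2) w"
proof -
  show d: "deg (i + 1) = 2"
    using outer_ge3_tri[of i] assms deg_ge2[of "i + 1"] by force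
  assume w: "i + 1 < w" "w < i + n" "R w i" "\<And>x. i + 1 < x \<Longrightarrow> x < w \<Longrightarrow> \<not> R x i" "i + 2 < w"
  show "R (i + 2) w"
  proof (rule ccontr)
    assume "\<not> R (i + 2) w"
    moreover have "\<not> R (i + 1) u" if "i + 2 < u" "u < i + n" for u
      using deg2_nbrs[OF d, of u] that by auto
    ultimately have "gain (i + 1) (i + n) 0 1"
      using gain_remote[of "i + n" "i + 1" "i + 2" w "- 1"] w n3 R_succ[of "i + 1"] periodic2
      by (simp add: add.commute)
    from outer_ineq[OF this] d assms show False by simp
  qed
qed

text \<open>As \<open>i\<close> and \<open>j\<close> have no further neighbours on the arc, a long
  arc leaves no triangle at the outer edge \<open>i\<close>, \<open>i + 1\<close>. By
  \<open>outer_nontri\<close> its face is then a quadrilateral in which \<open>i + 2\<close> is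
  adjacent to \<open>j\<close>, so \<open>i + 2\<close> is the vertex just before
  \<open>j\<close>.\<close>

lemma narrow_arc:
  assumes ij: "i < j" "j < i + n" "R i j" and d: "3 \<le> deg i"
    and i: "\<And>x. i < x \<Longrightarrow> x < j \<Longrightarrow> R i x \<Longrightarrow> x = i + 1"
    and j: "\<And>x. i < x \<Longrightarrow> x < j \<Longrightarrow> R x j \<Longrightarrow> x = j - 1"
  shows "j \<le> i + 3"
proof (rule ccontr)
  assume c: "\<not> j \<le> i + 3"
  have "\<not> tri (i + 1) (i + n)"
  proof
    assume "tri (i + 1) (i + n)"
    then obtain t where t: "i + 1 < t" "t < i + n" "R (i + 1) t" "R t (i + n)"
      unfolding apex_def by blast
    then have "R i t" using periodic2 sym by blast
    then show False
      using t i[of t] j[of "i + 1"] noncrossing[of i "i + 1" j t] ij c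
      by (cases t j rule: linorder_cases) auto
  qed
  then have "R (i + 2) j"
    using outer_nontri(2)[of i j] d ij c i sym[of i j] sym[of i] by force
  then show False using j[of "i + 2"] c by simp
qed

end

section \<open>Curved polygons have at most ten vertices\<close>

context polygon
begin

text \<open>Consecutive neighbours \<open>u\<close>, \<open>v\<close> of \<open>y\<close> in cyclic
  order. Seen from \<open>y\<close> the polygon consists of \<open>deg y - 1\<close> sectors, so
  bounds on their widths \<open>v - u\<close> bound \<open>n\<close>.\<close>

definition sector :: "int \<Rightarrow> int \<Rightarrow> int \<Rightarrow> bool" where
  "sector y u v \<longleftrightarrow> y < u \<and> u < v \<and> v < y + n \<and> R y u \<and> R y v \<and>
     (\<forall>x. u < x \<longrightarrow> x < v \<longrightarrow> \<not> R y x)"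

lemma sectorD:
  assumes "sector y u v"
  shows "y < u" "u < v" "v < y + n" "R y u" "R y v" "R u y" "R v y" "R u (y + n)" "R v (y + n)"
  using assms sym[of y u] sym[of y v] periodic2[of u y] periodic2[of v y]
  unfolding sector_def by simp_all

lemma sector_gap: "sector y u v \<Longrightarrow> u < x \<Longrightarrow> x < v \<Longrightarrow> \<not> R y x"
  unfolding sector_def by blast

lemma sector_enumeration:
  obtains v :: "nat \<Rightarrow> int" where "v 0 = y + 1" "v (nat (deg y) - 1) = y + n - 1"
    "\<And>t. t < nat (deg y) - 1 \<Longrightarrow> sector y (v t) (v (Suc t))"
proof -
  define S where "S = {k\<in>{y<..<y+n}. R y k}"
  have fin: "finite S" unfolding S_def by simp
  define xs where "xs = sorted_list_of_set S"
  have len: "length xs = nat (deg y)" unfolding xs_def cyc_degree_def S_def by simp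
  have set: "set xs = S" unfolding xs_def using fin by simp
  have sorted: "sorted_wrt (<) xs" unfolding xs_def by simp
  have less: "xs ! a < xs ! b" if "a < b" "b < length xs" for a b
    using sorted_wrt_nth_less[OF sorted that] .
  have memS: "xs ! a \<in> S" if "a < length xs" for a using that set nth_mem by blast
  have pos: "2 \<le> length xs" using len deg_ge2[of y] by simp
  have "R y (y + n - 1)" using R_pred[of y] periodic2[of y "y - 1"] by (simp add: algebra_simps)
  then have "y + n - 1 \<in> S" "y + 1 \<in> S" using n3 R_succ[of y] by (auto simp: S_def)
  then obtain a b where ab: "a < length xs" "xs ! a = y + 1" "b < length xs" "xs ! b = y + n - 1"
    using set by (metis in_set_conv_nth)
  have a0: "a = 0"
  proof (rule ccontr)
    assume "a \<noteq> 0"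
    moreover have "xs ! 0 \<in> S" using pos by (intro memS) linarith
    ultimately show False using less[of 0 a] ab(1,2) by (auto simp: S_def)
  qed
  have bl: "b = length xs - 1"
  proof (rule ccontr)
    assume c: "b \<noteq> length xs - 1"
    have "xs ! (length xs - 1) \<in> S" using pos by (intro memS) linarith
    moreover have "b < length xs - 1" using c ab(3) by linarith
    moreover have "length xs - 1 < length xs" using pos by linarith
    ultimately show False using less[of b "length xs - 1"] ab(4) by (simp add: S_def)
  qed
  have sec: "sector y (xs ! t) (xs ! Suc t)" if t': "t < length xs - 1" for t
  proof -
    have t: "t < length xs" "Suc t < length xs" using t' by linarith+
    have "\<not> R y x" if x: "xs ! t < x" "x < xs ! Suc t" for x
    proof
      assume "R y x"
      then have "x \<in> S" using x memS[of t] memS[of "Suc t"] t by (auto simp: S_def)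
      then obtain c where c: "c < length xs" "xs ! c = x" using set by (metis in_set_conv_nth)
      have "\<not> c \<le> t" using c x less[of c t] t by (cases "c = t") auto
      moreover have "\<not> Suc t \<le> c" using c x less[of "Suc t" c] by (cases "c = Suc t") auto
      ultimately show False by simp
    qed
    then show ?thesis
      using less[of t "Suc t"] memS[of t] memS[of "Suc t"] t by (auto simp: sector_def S_def)
  qed
  show ?thesis
    by (rule that[of "\<lambda>t. xs ! t"]) (use ab a0 bl sec len in simp_all)
qed

text \<open>On either side of the chord \<open>y v\<close> three assignments are available: cheap at
  \<open>y\<close>, cheap at \<open>v\<close>, or balanced when the face is not a triangle.\<close>

lemma left_gain1:
  assumes "sector y u v" "R u v"
  shows "gain y v 1 (if tri u v then 3 else 2)"
proof -
  note s = sectorD[OF assms(1)]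
  have "\<not> R x v" if "y < x" "x < u" for x
    using noncrossing[of y x u v] that s by auto
  then show ?thesis using gain_first[of v y u] s assms(2) by auto
qed

lemma left_gain2:
  assumes "sector y u v"
  shows "gain y v (if tri y u then 3 else 2) (if R u v then 1 else 0)"
  by (rule gain_last) (use sectorD[OF assms] sector_gap[OF assms] in blast)+

lemma left_gain3:
  assumes "sector y u v" "\<not> R u v"
  shows "gain y v 1 1"
proof -
  note s = sectorD[OF assms(1)]
  have "\<not> tri y v"
  proof
    assume "tri y v"
    then obtain m where m: "y < m" "m < v" "R y m" "R m v" unfolding apex_def by blast
    then have "m < u" using assms(2) sector_gap[OF assms(1), of m] by (cases m u rule: linorder_cases) auto
    then show False using noncrossing[of y m u v] m s by auto
  qed
  then show ?thesis using gain_nontri(1)[of y v] s by simp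
qed

lemma right_gain1:
  assumes "sector y v w" "R v w"
  shows "gain v (y + n) (if tri v w then 3 else 2) 1"
proof -
  note s = sectorD[OF assms(1)]
  have "\<not> R v x" if "w < x" "x < y + n" for x
    using noncrossing[of v w x "y + n"] that s by auto
  then show ?thesis using gain_last[of "y + n" v w] s assms(2) by auto
qed

lemma right_gain2:
  assumes "sector y v w"
  shows "gain v (y + n) (if R v w then 1 else 0) (if tri w (y + n) then 3 else 2)"
proof -
  note s = sectorD[OF assms(1)]
  have "\<not> R x (y + n)" if "v < x" "x < w" for x
    using sector_gap[OF assms, of x] that periodic2[of x y] sym[of x y] by auto
  then have "gain v (y + n) (if R v w then 1 else 0) (if tri w (y + n) then 3 else 2)"
    by (intro gain_first) (use s in auto)
  then show ?thesis .
qed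

lemma right_nontri:
  assumes "sector y v w" "\<not> R v w"
  shows "\<not> tri v (y + n)"
proof
  note s = sectorD[OF assms(1)]
  assume "tri v (y + n)"
  then obtain m where m: "v < m" "m < y + n" "R v m" "R m (y + n)" unfolding apex_def by blast
  then have "R y m" using periodic2[of m y] sym[of m y] by simp
  then have "w < m" using assms(2) sector_gap[OF assms(1), of m] m by (cases m w rule: linorder_cases) auto
  then show False using noncrossing[of v w m "y + n"] m s by auto
qed

lemma right_gain3:
  assumes "sector y v w" "\<not> R v w"
  shows "gain v (y + n) 1 1"
  using gain_nontri(1)[of v "y + n"] right_nontri[OF assms] sectorD[OF assms(1)] by simp

lemma not_tri_short: "\<not> tri i (i + 1)"
  unfolding apex_def by auto

lemma sector_mirror:
  assumes "sector y u v"
  shows "polygon.sector n (\<lambda>i j. R (- i) (- j)) (- (y + n)) (- v) (- u)"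
proof -
  interpret M: polygon n "\<lambda>i j. R (- i) (- j)" by (rule mirror)
  note s = sectorD[OF assms]
  have "\<not> R (y + n) (- x)" if "- v < x" "x < - u" for x
    using sector_gap[OF assms, of "- x"] that periodic[of y "- x"] by auto
  then show ?thesis
    unfolding M.sector_def using s periodic[of y u] periodic[of y v] by (simp add: add.commute)
qed

lemma interior_nbrs:
  assumes "sector y u v" "sector y v w"
  shows "{y, v - 1, v + 1} \<subseteq> {y..<y+n}" "\<And>k. k \<in> {y, v - 1, v + 1} \<Longrightarrow> R v k"
    "card {y, v - 1, v + 1} = 3"
  using sectorD[OF assms(1)] sectorD[OF assms(2)] R_succ[of v] R_pred[of v] by auto

lemma interior_deg: "sector y u v \<Longrightarrow> sector y v w \<Longrightarrow> 3 \<le> deg v"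
  using deg_ge[of "{y, v - 1, v + 1}" y v] interior_nbrs[of y u v w] by auto

lemma nbrs3:
  assumes "sector y u v" "sector y v w" "deg v \<le> 3" "y \<le> k" "k < y + n" "R v k"
  shows "k = y \<or> k = v - 1 \<or> k = v + 1"
proof -
  have "{k\<in>{y..<y+n}. R v k} = {y, v - 1, v + 1}"
    using interior_nbrs[OF assms(1,2)] assms(3) by (intro nbrs_eq) auto
  moreover have "k \<in> {k\<in>{y..<y+n}. R v k}" using assms by simp
  ultimately show ?thesis by blast
qed

text \<open>A neighbour \<open>v\<close> of \<open>y\<close> between two sectors always has the
  three distinct neighbours \<open>y\<close>, \<open>v - 1\<close>, \<open>v + 1\<close>;
  \<open>A\<close> collects further ones.\<close>

lemma deg_with:
  assumes "sector y u v" "sector y v w" "A \<subseteq> {y..<y+n}" "\<And>k. k \<in> A \<Longrightarrow> R v k"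
    "A \<inter> {y, v - 1, v + 1} = {}"
  shows "3 + int (card A) \<le> deg v"
proof -
  have f: "finite A" using assms(3) finite_subset by blast
  have "int (card (A \<union> {y, v - 1, v + 1})) \<le> deg v"
    using interior_nbrs[OF assms(1,2)] assms(3,4) by (intro deg_ge[of _ y]) blast+
  then show ?thesis
    using card_Un_disjoint[OF f _ assms(5)] interior_nbrs(3)[OF assms(1,2)] by simp
qed

lemma nbrs_with:
  assumes "sector y u v" "sector y v w" "A \<subseteq> {y..<y+n}" "\<And>k. k \<in> A \<Longrightarrow> R v k"
    "A \<inter> {y, v - 1, v + 1} = {}" "deg v \<le> 3 + int (card A)" "y \<le> k" "k < y + n" "R v k"
  shows "k \<in> A \<or> k = y \<or> k = v - 1 \<or> k = v + 1"
proof (rule ccontr)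
  assume c: "\<not> ?thesis"
  then have "3 + int (card (insert k A)) \<le> deg v"
    using assms by (intro deg_with[of y u v w]) auto
  moreover have "card (insert k A) = Suc (card A)"
    using c assms(3) finite_subset by (intro card_insert_disjoint) blast+
  ultimately show False using assms(6) by simp
qed

end

section \<open>Sectors of a curved polygon and vertices of degree at least six\<close>

context curved_polygon
begin

lemma chord_ineq:
  assumes "sector y u v" "gain y v ky1 kv1" "gain v (y + n) kv2 ky2"
  shows "2 * (deg y * deg v) < (2 + ky1 + ky2) * deg v + (2 + kv1 + kv2) * deg y"
  using curvedD[OF curved assms(2,3)] sectorD[OF assms(1)] by simp

lemma outer_big_succ:
  assumes "5 \<le> deg i"
  shows "deg (i + 1) = 2" "R i (i + 2)"
proof -
  show d: "deg (i + 1) = 2" using outer_big(1)[OF assms] .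
  obtain t where t: "i + 1 < t" "t < i + n" "R (i + 1) t" "R t (i + n)"
    using outer_big(2)[OF assms] unfolding apex_def by blast
  then have "t = i + 2" using deg2_nbrs[OF d, of t] by auto
  then show "R i (i + 2)" using t(4) periodic2[of t i] sym[of t i] by simp
qed

lemma outer_big_pred:
  assumes "5 \<le> deg i"
  shows "deg (i - 1) = 2" "R i (i - 2)"
proof -
  interpret M: curved_polygon n "\<lambda>i j. R (- i) (- j)" by (rule mirror)
  have "5 \<le> M.deg (- i)" using assms mirror_degree[of "- i"] by simp
  from M.outer_big_succ[OF this] mirror_degree[of "- i + 1"]
  show "deg (i - 1) = 2" "R i (i - 2)" by simp_all
qed

lemma first_sector:
  assumes "5 \<le> deg y" "sector y (y + 1) v"
  shows "v = y + 2"
proof -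
  have "\<not> (y + 1 < y + 2 \<and> y + 2 < v)"
    using outer_big_succ(2)[OF assms(1)] sector_gap[OF assms(2), of "y + 2"] by auto
  then show ?thesis using sectorD(2)[OF assms(2)] by simp
qed

lemma last_sector:
  assumes "5 \<le> deg y" "sector y u (y + n - 1)"
  shows "u = y + n - 2"
proof -
  have "R y (y + n - 2)"
    using outer_big_pred(2)[OF assms(1)] periodic2[of y "y - 2"] by (simp add: algebra_simps)
  then have "\<not> u < y + n - 2"
    using sector_gap[OF assms(2), of "y + n - 2"] by auto
  then show ?thesis using sectorD(2)[OF assms(2)] by simp
qed

text \<open>As \<open>v\<close> has no neighbours besides \<open>y\<close>, \<open>v - 1\<close>,
  \<open>v + 1\<close>, the outer edge \<open>v\<close>, \<open>v + 1\<close> is on no triangle. By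
  \<open>outer_nontri\<close> its face is a quadrilateral in which \<open>v + 2\<close> is adjacent
  to \<open>y\<close>, which forces \<open>w = v + 2\<close>.\<close>

lemma sector_quad_right:
  assumes "sector y u v" "sector y v w" "\<not> R v w" "deg v \<le> 3"
  shows "w = v + 2"
proof -
  note su = sectorD[OF assms(1)] and sw = sectorD[OF assms(2)]
  have d: "deg v = 3" using interior_deg[OF assms(1,2)] assms(4) by simp
  have nt: "\<not> tri (v + 1) (v + n)"
  proof
    assume "tri (v + 1) (v + n)"
    then obtain t where t: "v + 1 < t" "t < v + n" "R (v + 1) t" "R v t"
      unfolding apex_def using periodic2 sym by blast
    consider "t < y + n" | "t = y + n" | "y + n < t" by linarith
    then show False
    proof cases
      case 1
      then show ?thesis using nbrs3[OF assms(1,2,4), of t] t su by auto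
    next
      case 2
      then have "R y (v + 1)" using t periodic2[of "v + 1" y] sym[of y "v + 1"] by simp
      then have "v + 1 = w" using sw(2) sector_gap[OF assms(2), of "v + 1"] by (cases "v + 1 < w") auto
      then show ?thesis using assms(3) R_succ[of v] by simp
    next
      case 3
      then have "R v (t - n)" using t periodic_minus by blast
      then have "t - n = v - 1" using nbrs3[OF assms(1,2,4), of "t - n"] t su 3 by auto
      then have "R (v - 1) (v + 1)" using t(3) periodic_minus(2)[of "v + 1" t] sym[of "v + 1" "t - n"] by simp
      then show ?thesis using noncrossing[of y "v - 1" v "v + 1"] su sw by auto
    qed
  qed
  have first: "\<not> R x v" if "v + 1 < x" "x < y + n" for x
    using nbrs3[OF assms(1,2,4), of x] that su sym[of x v] by auto
  have ne: "v + 1 \<noteq> w" using assms(3) R_succ[of v] by auto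
  have "R (v + 2) (y + n)" if "v + 2 < y + n"
    using outer_nontri(2)[OF nt, of "y + n"] d su first that
      periodic[of y v] sw by auto
  then have "R y (v + 2)" using periodic2[of "v + 2" y] sym[of y "v + 2"] ne sw by auto
  then show ?thesis using ne sw(2) sector_gap[OF assms(2), of "v + 2"] by (cases "v + 2 < w") auto
qed

lemma sector_quad_left:
  assumes "sector y u v" "sector y v w" "\<not> R u v" "deg v \<le> 3"
  shows "u = v - 2"
proof -
  interpret M: curved_polygon n "\<lambda>i j. R (- i) (- j)" by (rule mirror)
  have "- u = - v + 2"
    using M.sector_quad_right[OF sector_mirror[OF assms(2)] sector_mirror[OF assms(1)]]
      assms(3,4) sym[of v u] mirror_degree[of "- v"] by simp
  then show ?thesis by simp
qed

text \<open>A gap costs degree: if \<open>y\<close>, \<open>u\<close>, \<open>v\<close> form a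
  triangle and \<open>u\<close> is not \<open>v - 1\<close>, then \<open>u\<close> is a fourth
  neighbour of \<open>v\<close>, and likewise for \<open>w\<close>.\<close>

lemma tri_gap_deg:
  assumes "sector y u v" "sector y v w"
  shows "R u v \<Longrightarrow> u + 1 < v \<Longrightarrow> 4 \<le> deg v"
    and "R v w \<Longrightarrow> v + 1 < w \<Longrightarrow> 4 \<le> deg v"
    and "R u v \<Longrightarrow> u + 1 < v \<Longrightarrow> R v w \<Longrightarrow> v + 1 < w \<Longrightarrow> 5 \<le> deg v"
  using deg_with[OF assms, of "{u}"] deg_with[OF assms, of "{w}"] deg_with[OF assms, of "{u, w}"]
    sectorD[OF assms(1)] sectorD[OF assms(2)] sym[of u v] by auto

text \<open>Let \<open>a\<close>, \<open>b\<close> be the degrees of \<open>y\<close>,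
  \<open>v\<close>. Two faces at \<open>y v\<close> other than triangles would give
  \<open>2 a b < 8 b + 2 a\<close>, which is impossible. One such face gives
  \<open>2 a b < 6 b + 4 a\<close>, hence \<open>b = 3\<close>, and also
  \<open>2 a b < 8 b + 3 a\<close>, which then reads \<open>a < 8\<close>.\<close>

lemma nontri_end:
  assumes "sector y u v" "sector y v w" "6 \<le> deg y" "\<not> R u v \<or> \<not> R v w"
  shows "deg v = 3" "R u v \<or> R v w" "deg y \<le> 7"
proof -
  note su = sectorD[OF assms(1)] and sw = sectorD[OF assms(2)]
  have a3: "3 \<le> deg v" by (rule interior_deg[OF assms(1,2)])
  note low = int_mult_lower[OF assms(3) a3]
  have L: "gain y v 3 (if R u v then 1 else 0)"
    by (rule side_gain_mono[OF left_gain2[OF assms(1)]]) auto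
  have Rr: "gain v (y + n) (if R v w then 1 else 0) 3"
    by (rule side_gain_mono[OF right_gain2[OF assms(2)]]) auto
  show T: "R u v \<or> R v w"
    using chord_ineq[OF assms(1) L Rr] low a3 assms(3) by (auto split: if_splits)
  have "2 * (deg y * deg v) < 6 * deg v + 4 * deg y"
    using T
  proof
    assume "R u v"
    then have "\<not> R v w" using assms(4) by simp
    then show ?thesis using chord_ineq[OF assms(1) L right_gain3[OF assms(2)]] \<open>R u v\<close> by simp
  next
    assume "R v w"
    then have "\<not> R u v" using assms(4) by simp
    then show ?thesis using chord_ineq[OF assms(1) left_gain3[OF assms(1)] Rr] \<open>R v w\<close> by simp
  qed
  then show d: "deg v = 3"
    using int_mult_lower[OF assms(3), of 4 "deg v"] a3 assms(3) by (cases "4 \<le> deg v") auto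
  have "2 * (deg y * deg v) < 8 * deg v + 3 * deg y"
    using chord_ineq[OF assms(1) L Rr] T assms(4) by (auto split: if_splits)
  then show "deg y \<le> 7" using d by simp
qed

lemma nontri_sector:
  assumes "sector y u v" "sector y v w" "6 \<le> deg y"
  shows "\<not> R u v \<Longrightarrow> u = v - 2 \<and> w = v + 1" "\<not> R v w \<Longrightarrow> w = v + 2 \<and> u = v - 1"
proof -
  note su = sectorD[OF assms(1)] and sw = sectorD[OF assms(2)]
  note g = tri_gap_deg[OF assms(1,2)]
  { assume n: "\<not> R u v"
    then have "deg v = 3" "R v w" using nontri_end[OF assms] by auto
    then show "u = v - 2 \<and> w = v + 1"
      using sector_quad_left[OF assms(1,2) n] g(2) sw(2) by force }
  { assume n: "\<not> R v w"
    then have "deg v = 3" "R u v" using nontri_end[OF assms] by auto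
    then show "w = v + 2 \<and> u = v - 1"
      using sector_quad_right[OF assms(1,2) n] g(1) su(2) by force }
qed

text \<open>Both sides use a worst-case gain, so the inequality holds whatever the faces at the
  chord are.\<close>

lemma tri_tri_ineq:
  assumes "sector y u v" "sector y v w"
  shows "2 * (deg y * deg v) < 8 * deg v + 4 * deg y"
proof -
  have L: "gain y v 3 1" using sectorD[OF assms(1)] by (intro gain_last_any) auto
  have R: "gain v (y + n) 1 3" using sectorD[OF assms(1)] sectorD[OF assms(2)] by (intro gain_first_any) auto
  show ?thesis using chord_ineq[OF assms(1) L R] by simp
qed

text \<open>The hypotheses leave \<open>v\<close> and \<open>w\<close> no neighbours strictly
  between them except \<open>v + 1\<close> and \<open>w - 1\<close>, so \<open>narrow_arc\<close>
  applies to the edge \<open>v w\<close>.\<close>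

lemma narrow_tri_sector:
  assumes "sector y u v" "sector y v w" "sector y w x" "R v w" "deg v \<le> 4"
    and w: "deg w \<le> 4 \<or> (\<forall>e. v < e \<longrightarrow> e < w \<longrightarrow> R e w \<longrightarrow> e = w - 1)"
  shows "w \<le> v + 3"
proof (cases "w = v + 1")
  case False
  note sv = sectorD[OF assms(1)] and sw = sectorD[OF assms(2)] and sx = sectorD[OF assms(3)]
  show ?thesis
  proof (rule narrow_arc)
    fix e assume e: "v < e" "e < w" "R v e"
    then show "e = v + 1"
      using nbrs_with[OF assms(1,2), of "{w}" e] assms(4,5) sw sv False by auto
  next
    fix e assume e: "v < e" "e < w" "R e w"
    show "e = w - 1"
      using w
    proof
      assume "deg w \<le> 4"
      then show ?thesis
        using nbrs_with[OF assms(2,3), of "{v}" e] e assms(4) sw sv False sym[of w e] sym[of v w] by auto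
    qed (use e in auto)
  qed (use sv sw interior_deg[OF assms(1,2)] assms(4) in auto)
qed simp

text \<open>All faces involved are triangles by \<open>nontri_end\<close>, and
  \<open>tri_tri_ineq\<close> gives \<open>deg v \<le> 3\<close>, whereas a gap would need degree
  4.\<close>

lemma consecutive_nbrs_deg_ge8:
  assumes "sector y u v" "sector y v w" "8 \<le> deg y"
  shows "v = u + 1" "w = v + 1"
proof -
  note su = sectorD[OF assms(1)] and sw = sectorD[OF assms(2)]
  have T: "R u v" "R v w" using nontri_end(3)[OF assms(1,2)] assms(3) by auto
  have "deg v \<le> 3"
    using tri_tri_ineq[OF assms(1,2)] int_mult_lower[OF assms(3), of 4 "deg v"] assms(3)
    by (cases "4 \<le> deg v") auto
  then show "v = u + 1" "w = v + 1" using tri_gap_deg[OF assms(1,2)] T su(2) sw(2) by force+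
qed

text \<open>A gap next to \<open>v\<close> leaves no slack: whether \<open>deg v\<close> is 4 or 3,
  the chord inequality needs deviation 3 at \<open>y\<close> on both sides, and this is reached only
  if the next faces, at the chords \<open>y u\<close> and \<open>y w\<close>, are triangles as
  well.\<close>

lemma gap_deg7:
  assumes "sector y u v" "sector y v w" "deg y = 7" "u + 1 < v \<or> v + 1 < w"
  shows "tri y u" "tri w (y + n)" "u + 1 = v \<or> v + 1 = w"
proof -
  note su = sectorD[OF assms(1)] and sw = sectorD[OF assms(2)]
  have a3: "3 \<le> deg v" by (rule interior_deg[OF assms(1,2)])
  note nt = nontri_end[OF assms(1,2), unfolded assms(3)]
  note g = tri_gap_deg[OF assms(1,2)]
  have a4: "deg v \<le> 4" using tri_tri_ineq[OF assms(1,2)] assms(3) by auto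
  have *: "14 * deg v < (2 + (if tri y u then 3 else 2) + (if tri w (y + n) then 3 else 2)) * deg v
      + (2 + (if R u v then 1 else 0) + (if R v w then 1 else 0)) * 7"
    using chord_ineq[OF assms(1) left_gain2[OF assms(1)] right_gain2[OF assms(2)]] assms(3) by simp
  have "(R u v \<and> R v w \<and> deg v = 4) \<or> (deg v = 3 \<and> \<not> (R u v \<and> R v w))"
  proof (cases "R u v \<and> R v w")
    case True
    then have "4 \<le> deg v" using assms(4) g(1,2) by blast
    then show ?thesis using True a4 by simp
  qed (use nt(1) in simp)
  then show "tri y u" "tri w (y + n)" using * by (auto split: if_splits)
  show "u + 1 = v \<or> v + 1 = w"
  proof (rule ccontr)
    assume c: "\<not> ?thesis"
    then have "u + 1 < v" "v + 1 < w" using su(2) sw(2) by auto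
    then show False using nontri_sector[OF assms(1,2)] assms(3) g(3) a4 by fastforce
  qed
qed

lemma width_deg7:
  assumes "sector y u v" "sector y v w" "sector y w x" "deg y = 7"
  shows "w \<le> v + 3"
proof (cases "R v w")
  case True
  have "deg v \<le> 4" "deg w \<le> 4"
    using tri_tri_ineq[OF assms(1,2)] tri_tri_ineq[OF assms(2,3)] assms(4) by auto
  then show ?thesis using narrow_tri_sector[OF assms(1-3) True] by blast
next
  case False
  then show ?thesis using nontri_sector(2)[OF assms(1,2)] assms(4) by simp
qed

text \<open>Here \<open>deg v = 5\<close>, so the neighbours of \<open>v\<close> are exactly
  \<open>y\<close>, \<open>v - 1\<close>, \<open>v + 1\<close>, \<open>u\<close>, \<open>w\<close>;
  but \<open>outer_big_pred\<close> and \<open>outer_big_succ\<close> make \<open>v - 2\<close> and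
  \<open>v + 2\<close> neighbours too.\<close>

lemma double_gap_deg6:
  assumes "sector y u v" "sector y v w" "deg y = 6" "u + 1 < v" "v + 1 < w"
  shows "u = v - 2" "w = v + 2"
proof -
  note su = sectorD[OF assms(1)] and sw = sectorD[OF assms(2)]
  have T: "R u v" "R v w" using nontri_sector[OF assms(1,2)] assms(3-5) by auto
  have d: "deg v = 5"
    using tri_gap_deg(3)[OF assms(1,2)] T assms(4,5) tri_tri_ineq[OF assms(1,2)] assms(3) by auto
  note nb = nbrs_with[OF assms(1,2), of "{u, w}"]
  have A: "{u, w} \<subseteq> {y..<y+n}" "\<And>k. k \<in> {u, w} \<Longrightarrow> R v k" "{u, w} \<inter> {y, v - 1, v + 1} = {}"
    "deg v \<le> 3 + int (card {u, w})"
    using su sw T sym[of u v] assms(4,5) d by auto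
  show "u = v - 2"
    using nb[OF A, of "v - 2"] outer_big_pred(2)[of v] d su sw assms(4,5) by auto
  show "w = v + 2"
    using nb[OF A, of "v + 2"] outer_big_succ(2)[of v] d su sw assms(4,5) by auto
qed

text \<open>The sectors of width 1 on both sides improve the chord inequalities at \<open>v\<close>
  and at \<open>w\<close> to \<open>12 b < 6 b + 30\<close>, so both degrees are at most 4.\<close>

lemma width_deg6:
  assumes "sector y u v" "sector y v w" "sector y w x" "deg y = 6" "v = u + 1" "x = w + 1"
  shows "w \<le> v + 3"
proof (cases "R v w")
  case True
  have "R u v" "R w x" using assms(5,6) R_succ by auto
  have L: "gain y v 3 1" using sectorD[OF assms(1)] by (intro gain_last_any) auto
  have "gain y v 1 2" using left_gain1[OF assms(1) \<open>R u v\<close>] not_tri_short[of u] assms(5) by simp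
  moreover have "gain v (y + n) 1 3"
    using sectorD[OF assms(1)] sectorD[OF assms(2)] by (intro gain_first_any) auto
  ultimately have "deg v \<le> 4" using chord_ineq[OF assms(1)] assms(4) by fastforce
  have "gain w (y + n) 2 1" using right_gain1[OF assms(3) \<open>R w x\<close>] not_tri_short[of w] assms(6) by simp
  moreover have "gain y w 3 1" using sectorD[OF assms(1)] sectorD[OF assms(2)] by (intro gain_last_any) auto
  ultimately have "deg w \<le> 4" using chord_ineq[OF assms(2)] assms(4) by fastforce
  then show ?thesis using narrow_tri_sector[OF assms(1-3) True \<open>deg v \<le> 4\<close>] by blast
next
  case False
  then show ?thesis using nontri_sector(2)[OF assms(1,2)] assms(4) by simp
qed

end

section \<open>Maximal degree at most five, and the bound on the number of vertices\<close>

context curved_polygon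
begin

text \<open>In a wider sector the face at \<open>y\<close> is the triangle \<open>y\<close>,
  \<open>v\<close>, \<open>w\<close>, and \<open>w\<close> has no neighbour inside the sector except
  \<open>w - 1\<close>. If \<open>deg v = 4\<close>, then \<open>narrow_tri_sector\<close> applies;
  if \<open>deg v = 5\<close>, all neighbours of \<open>v\<close> are known and \<open>v + 2\<close>
  is not among them, against \<open>outer_big_succ\<close>.\<close>

lemma width_deg5:
  assumes s: "sector y u v" "sector y v w" "sector y w x" "sector y x z"
    and y: "deg y = 5" "u = y + 1" "deg v \<le> 5" "deg w \<le> 5"
  shows "w \<le> v + 3"
proof (rule ccontr)
  assume c: "\<not> w \<le> v + 3"
  note su = sectorD[OF s(1)] and sv = sectorD[OF s(2)] and sw = sectorD[OF s(3)] and sx = sectorD[OF s(4)]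
  have u: "v = y + 2" using first_sector[of y v] s(1) y by simp
  have "\<not> tri y u" using not_tri_short y(2) by simp
  then have L2: "gain y v 2 1"
    using left_gain2[OF s(1)] R_succ[of "y + 1"] y(2) u by (simp add: add.commute)
  have T: "R v w"
  proof (rule ccontr)
    assume n: "\<not> R v w"
    then have "deg v \<le> 3" using chord_ineq[OF s(1) L2 right_gain3[OF s(2) n]] y(1) by simp
    then show False using sector_quad_right[OF s(1,2) n] c by simp
  qed
  \<comment> \<open>A further neighbour \<open>e\<close> gives \<open>deg w = 5\<close>, hence
    \<open>deg (w + 1) = 2\<close>. If \<open>y\<close>, \<open>w\<close>, \<open>x\<close> is a
    triangle, then \<open>x = w + 1\<close>, which contradicts \<open>interior_deg\<close>;
    otherwise the chord inequality at \<open>w\<close> reads \<open>50 < 50\<close>.\<close>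
  have e_w: "e = w - 1" if e: "v < e" "e < w" "R e w" for e
  proof (rule ccontr)
    assume ne: "e \<noteq> w - 1"
    have A: "{v, e} \<subseteq> {y..<y+n}" "\<And>k. k \<in> {v, e} \<Longrightarrow> R w k" "{v, e} \<inter> {y, w - 1, w + 1} = {}"
      "card {v, e} = 2"
      using e ne T c sv sw sym[of v w] sym[of e w] by auto
    have d: "deg w = 5" using deg_with[OF s(2,3) A(1-3)] A(4) y(4) by simp
    have d2: "deg (w + 1) = 2" using outer_big_succ(1)[of w] d by simp
    show False
    proof (cases "R w x")
      case True
      have "x = w + 1"
        using nbrs_with[OF s(2,3) A(1-3), of x] A(4) d True sw e sv by auto
      then show False using interior_deg[OF s(3,4)] d2 by simp
    next
      case False
      have "gain y w 1 3" using su sv by (intro gain_first_any) auto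
      from chord_ineq[OF s(2) this right_gain3[OF s(3) False]] d y(1) show False by simp
    qed
  qed
  have u1: "u = v - 1" using u y(2) by simp
  have A: "{w} \<subseteq> {y..<y+n}" "\<And>k. k \<in> {w} \<Longrightarrow> R v k" "{w} \<inter> {y, v - 1, v + 1} = {}"
    using T c sv sw by auto
  have d4: "4 \<le> deg v" using deg_with[OF s(1,2) A] by simp
  show False
  proof (cases "deg v = 4")
    case True
    then show False using narrow_tri_sector[OF s(1-3) T] e_w c by auto
  next
    case False
    then have d: "deg v = 5" using d4 y(3) by simp
    \<comment> \<open>Otherwise the chord inequality at \<open>v\<close> reads
      \<open>50 < 50\<close>.\<close>
    have "tri v w"
    proof (rule ccontr)
      assume "\<not> tri v w"
      then have "gain v (y + n) 2 1" using right_gain1[OF s(2) T] by simp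
      from chord_ineq[OF s(1) L2 this] d y(1) show False by simp
    qed
    then obtain t where t: "v < t" "t < w" "R v t" "R t w" unfolding apex_def by blast
    then have tw: "t = w - 1" using e_w by blast
    have B: "{w, t} \<subseteq> {y..<y+n}" "\<And>k. k \<in> {w, t} \<Longrightarrow> R v k" "{w, t} \<inter> {y, v - 1, v + 1} = {}"
      "card {w, t} = 2"
      using A t tw c su sv by auto
    have "v + 2 \<in> {w, t}"
      using nbrs_with[OF s(1,2) B(1-3), of "v + 2"] B(4) d outer_big_succ(2)[of v] su sv c by auto
    then show False using tw c by auto
  qed
qed

lemma width_deg5':
  assumes s: "sector y t u" "sector y u v" "sector y v w" "sector y w x"
    and y: "deg y = 5" "x = y + n - 1" "deg v \<le> 5" "deg w \<le> 5"
  shows "w \<le> v + 3"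
proof -
  interpret M: curved_polygon n "\<lambda>i j. R (- i) (- j)" by (rule mirror)
  have "M.deg (- (y + n)) = 5" using mirror_degree[of "- (y + n)"] deg_shift[of y] y(1) by (simp add: add.commute)
  moreover have "- x = - (y + n) + 1" using y(2) by simp
  ultimately have "- v \<le> - w + 3"
    using M.width_deg5[OF sector_mirror[OF s(4)] sector_mirror[OF s(3)] sector_mirror[OF s(2)]
        sector_mirror[OF s(1)]] y mirror_degree[of "- v"] mirror_degree[of "- w"] by simp
  then show ?thesis by simp
qed

text \<open>The missing triangle \<open>y\<close>, \<open>u\<close>, \<open>v\<close> lowers the
  deviation at \<open>y\<close> to 2. This forces a triangle at the outer edge \<open>y\<close>,
  \<open>y + 1\<close>, its apex is \<open>u\<close>, and then \<open>8 b < 4 b + 12\<close> leaves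
  \<open>y + 1\<close> with degree 2.\<close>

lemma first_sector_deg4:
  assumes s: "sector y (y + 1) u" "sector y u v" "sector y v (y + n - 1)" and y: "deg y = 4"
    and nt: "\<not> R u v"
  shows "u = y + 2"
proof -
  note su = sectorD[OF s(1)] and sv = sectorD[OF s(2)] and sw = sectorD[OF s(3)]
  have y_nbr: "t \<in> {y + 1, u, v, y + n - 1}" if "R y t" "y < t" "t < y + n" for t
    using sector_gap[OF s(1), of t] sector_gap[OF s(2), of t] sector_gap[OF s(3), of t] that by force
  have ntri: "\<not> tri u (y + n)"
  proof
    assume "tri u (y + n)"
    then obtain t where t: "u < t" "t < y + n" "R u t" "R y t"
      unfolding apex_def using periodic2 sym by blast
    then have "t = y + n - 1" using y_nbr[of t] nt su sv by auto
    then show False using noncrossing[of u v t "y + n"] t sv sw by auto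
  qed
  have g: "gain (y + 1) (y + n) (if R (y + 1) u then 1 else 0) 2"
  proof -
    have no: "\<not> R x (y + n)" if "y + 1 < x" "x < u" for x
      using sector_gap[OF s(1), of x] that periodic2[of x y] sym[of x y] by simp
    have "gain (y + 1) (y + n) (if R (y + 1) u then 1 else 0) (if tri u (y + n) then 3 else 2)"
      by (rule gain_first) (use su no in auto)
    then show ?thesis using ntri by simp
  qed
  have tr: "tri (y + 1) (y + n)"
  proof (rule ccontr)
    assume c: "\<not> tri (y + 1) (y + n)"
    then have "\<not> R (y + 1) u" using su unfolding apex_def by blast
    then show False using outer_ineq[OF g] outer_nontri(1)[OF c] y by simp
  qed
  then obtain t where t: "y + 1 < t" "t < y + n" "R (y + 1) t" "R y t"
    unfolding apex_def using periodic2 sym by blast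
  have "t \<le> u" using noncrossing[of y "y + 1" u t] t su by force
  then have tu: "t = u" using y_nbr[of t] t su sv sw by auto
  then have "deg (y + 1) = 2"
    using outer_ineq[OF g] t y deg_ge2[of "y + 1"] by simp
  then show ?thesis using deg2_nbrs[of "y + 1" u] t tu su by auto
qed

lemma last_sector_deg4:
  assumes s: "sector y (y + 1) u" "sector y u v" "sector y v (y + n - 1)" and y: "deg y = 4"
    and nt: "\<not> R u v"
  shows "v = y + n - 2"
proof -
  interpret M: curved_polygon n "\<lambda>i j. R (- i) (- j)" by (rule mirror)
  define z where "z = - (y + n)"
  have "M.deg z = 4" using mirror_degree[of z] deg_shift[of y] y by (simp add: z_def add.commute)
  moreover have e: "- (y + n - 1) = z + 1" "- (y + 1) = z + n - 1" unfolding z_def by simp_all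
  moreover have "M.sector z (z + 1) (- v)" "M.sector z (- v) (- u)" "M.sector z (- u) (z + n - 1)"
    using sector_mirror[OF s(1)] sector_mirror[OF s(2)] sector_mirror[OF s(3)]
    unfolding e z_def[symmetric] by simp_all
  ultimately have "- v = z + 2"
    using M.first_sector_deg4[of z "- v" "- u"] nt sym[of u v] by simp
  then have "- v = - (y + n) + 2" unfolding z_def .
  then show ?thesis by simp
qed

text \<open>The outer sectors have width 1, so only the middle one matters. If one of
  \<open>u\<close>, \<open>v\<close> has degree 3, its width is 2. Otherwise the middle face is a
  quadrilateral \<open>y\<close>, \<open>u\<close>, \<open>m\<close>, \<open>v\<close>, and the same
  argument about vertices of degree 4, now applied at \<open>u\<close> and at \<open>v\<close>,
  bounds their distances to \<open>m\<close> by 2.\<close>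

lemma bound_deg4_quad:
  assumes s: "sector y (y + 1) u" "sector y u v" "sector y v (y + n - 1)" and y: "deg y = 4"
    and nt: "\<not> R u v" and max: "\<And>i. deg i \<le> 4"
  shows "n \<le> 10"
proof -
  note su = sectorD[OF s(1)] and sv = sectorD[OF s(2)] and sw = sectorD[OF s(3)]
  have u: "u = y + 2" by (rule first_sector_deg4[OF s y nt])
  have v: "v = y + n - 2" by (rule last_sector_deg4[OF s y nt])
  show ?thesis
  proof (cases "deg u \<le> 3 \<or> deg v \<le> 3")
    case True
    then show ?thesis
      using sector_quad_right[OF s(1,2) nt] sector_quad_left[OF s(2,3) nt] u v by auto
  next
    case False
    then have d: "deg u = 4" "deg v = 4" using max[of u] max[of v] by auto
    have uv: "u + 1 < v" using sv R_succ[of u] nt by (cases "v = u + 1") auto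
    have "u + 1 < y + n" using uv sv by simp
    then obtain m where m: "u < m" "m < y + n" "R u m" "\<And>x. m < x \<Longrightarrow> x < y + n \<Longrightarrow> \<not> R u x"
      using last_nbr[of u "y + n"] by metis
    have no: "\<not> R x (y + n)" if "u < x" "x < v" for x
      using sector_gap[OF s(2), of x] that periodic2[of x y] sym[of x y] by simp
    have "m \<noteq> v" using m nt by blast
    moreover have "m \<le> v" using nbr_order[of "y + n" u m v] m sv su by simp
    ultimately have mv: "m < v" by simp
    \<comment> \<open>Otherwise \<open>gain_remote\<close> with \<open>e = - 1\<close> applies and
      the chord inequality at \<open>u\<close> reads \<open>32 < 32\<close>.\<close>
    have "R m v"
    proof (rule ccontr)
      assume "\<not> R m v"
      then have g: "gain u (y + n) 0 1"
        using gain_remote[of "y + n" u m v "- 1"] m sv su mv no by simp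
      have "gain y u 2 1"
        using left_gain2[OF s(1)] not_tri_short[of y] R_succ[of "y + 1"] u by (simp add: add.commute)
      from chord_ineq[OF s(1) this g] d y show False by simp
    qed
    have nmy: "\<not> R m y" using sector_gap[OF s(2), of m] m mv sym[of m y] by simp
    have "m = u + 1 \<or> m = u + 2"
    proof (rule ccontr)
      assume c: "\<not> ?thesis"
      have ex: "k = m" if "R u k" "u + 1 < k" "k < y + n" for k
      proof -
        have "m \<noteq> k \<Longrightarrow> 3 + int (card {m, k}) \<le> deg u"
          using that m c su sv mv by (intro deg_with[OF s(1,2)]) auto
        then show ?thesis using d by (cases "m = k") auto
      qed
      have gap1: "\<not> R u x" if "u + 1 < x" "x < m" for x using ex[of x] that m by auto
      have gap2: "\<not> R u x" if "m < x" "x < y + n" for x using ex[of x] that m c by auto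
      \<comment> \<open>Seen from \<open>u\<close>, the four neighbours in order are
        \<open>u + 1\<close>, \<open>m\<close>, \<open>y + n\<close>, \<open>u + n - 1\<close>, so
        \<open>m\<close> and \<open>y + n\<close> bound the middle sector.\<close>
      have "R u (u + n - 1)" using R_pred[of u] periodic2[of u "u - 1"] by (simp add: algebra_simps)
      moreover have "u + 1 < m" "u < y + n" "y + n < u + n - 1" "u + n - 1 < u + n" "m < u + n"
        using m c su sv mv u by linarith+
      moreover have "R u (y + n)" by (rule su)
      ultimately have "sector u (u + 1) m" "sector u m (y + n)" "sector u (y + n) (u + n - 1)"
        unfolding sector_def using m(2,3) gap1 gap2 R_succ[of u] u by auto
      moreover have "\<not> R m (y + n)" using nmy periodic2 by blast
      ultimately have "m = u + 2" using first_sector_deg4[of u m "y + n"] d by blast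
      then show False using c by simp
    qed
    moreover have "m = v - 1 \<or> m = v - 2"
    proof (rule ccontr)
      assume c: "\<not> ?thesis"
      have ex: "k = m" if "R v k" "y < k" "k < v - 1" for k
      proof -
        have "R v m" using \<open>R m v\<close> sym by blast
        then have "R v x" if "x \<in> {m, k}" for x using that \<open>R v k\<close> by blast
        moreover have "{m, k} \<subseteq> {y..<y+n}" using that m c su sv mv by simp
        moreover have "{m, k} \<inter> {y, v - 1, v + 1} = {}" using that m c su sv mv by simp
        ultimately have "3 + int (card {m, k}) \<le> deg v" by (intro deg_with[OF s(2,3)])
        then show ?thesis using d by (cases "m = k") simp_all
      qed
      have gap1: "\<not> R v x" if "y + n < x" "x < m + n" for x
        using ex[of "x - n"] that periodic_minus(2)[of v x] mv c by auto
      have gap2: "\<not> R v x" if "m + n < x" "x < v + n - 1" for x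
        using ex[of "x - n"] that periodic_minus(2)[of v x] m su by auto
      have r: "R v (v + n - 1)" "R v (m + n)" "R v (y + n)"
        using R_pred[of v] periodic2[of v "v - 1"] \<open>R m v\<close> sym[of m v] periodic2[of v m] sv
        by (simp_all add: algebra_simps)
      have "sector v (v + 1) (y + n)"
        unfolding sector_def using r su sv R_succ[of v] v n3 by auto
      moreover have "sector v (y + n) (m + n)"
        unfolding sector_def using r su sv mv m gap1 by auto
      moreover have "sector v (m + n) (v + n - 1)"
        unfolding sector_def using r c su sv mv m gap2 by auto
      moreover have "\<not> R (y + n) (m + n)" using nmy periodic periodic2 sym[of y m] by blast
      ultimately have "m + n = v + n - 2" using last_sector_deg4[of v "y + n" "m + n"] d by blast
      then show False using c by simp
    qed
    ultimately show ?thesis using u v by auto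
  qed
qed

text \<open>On the arc of the chord \<open>y u\<close> the hypotheses leave only the outer
  neighbours of \<open>y\<close> and \<open>u\<close>, so \<open>narrow_arc\<close> applies.\<close>

lemma left_width:
  assumes s: "sector y (y + 1) u" "sector y u v" and y: "3 \<le> deg y"
    and u: "deg u \<le> 3 \<or> deg u \<le> 4 \<and> R u v \<and> u + 1 < v"
  shows "u \<le> y + 3"
proof -
  note su = sectorD[OF s(1)] and sv = sectorD[OF s(2)]
  have nbr: "x = u - 1" if "y < x" "x < u" "R x u" for x
    using u
  proof
    assume "deg u \<le> 3"
    then show ?thesis using nbrs3[OF s, of x] that su sym[of u x] by auto
  next
    assume "deg u \<le> 4 \<and> R u v \<and> u + 1 < v"
    then show ?thesis using nbrs_with[OF s, of "{v}" x] that su sv sym[of u x] by auto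
  qed
  have nbr': "x = y + 1" if "y < x" "x < u" "R y x" for x
    using sector_gap[OF s(1), of x] that by force
  show ?thesis
    using su y nbr nbr' by (intro narrow_arc) auto
qed

lemma right_width:
  assumes s: "sector y u v" "sector y v (y + n - 1)" and y: "3 \<le> deg y"
    and v: "deg v \<le> 3 \<or> deg v \<le> 4 \<and> R u v \<and> u + 1 < v"
  shows "y + n \<le> v + 3"
proof -
  interpret M: curved_polygon n "\<lambda>i j. R (- i) (- j)" by (rule mirror)
  define z where "z = - (y + n)"
  have "3 \<le> M.deg z" using mirror_degree[of z] deg_shift[of y] y by (simp add: z_def add.commute)
  moreover have e: "- (y + n - 1) = z + 1" unfolding z_def by simp
  moreover have "M.sector z (z + 1) (- v)" "M.sector z (- v) (- u)"
    using sector_mirror[OF s(1)] sector_mirror[OF s(2)]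
    unfolding e z_def[symmetric] by simp_all
  ultimately have "- v \<le> z + 3"
    using M.left_width[of z "- v" "- u"] v sym[of u v] mirror_degree[of "- v"] by auto
  then have "- v \<le> - (y + n) + 3" unfolding z_def .
  then show ?thesis by simp
qed

lemma bound_deg4_small:
  assumes s: "sector y (y + 1) u" "sector y u v" "sector y v (y + n - 1)" and y: "deg y = 4"
    and T: "v = u + 1" and max: "\<And>i. deg i \<le> 4" and u: "deg u \<le> 3"
  shows "n \<le> 10"
proof -
  note su = sectorD[OF s(1)] and sv = sectorD[OF s(2)] and sw = sectorD[OF s(3)]
  have u3: "u \<le> y + 3" using left_width[OF s(1,2)] y u by simp
  show ?thesis
  proof (cases "deg v \<le> 3")
    case True
    then have "y + n \<le> v + 3" using right_width[OF s(2,3)] y by simp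
    then show ?thesis using u3 T by simp
  next
    case False
    then have d: "deg v = 4" using max[of v] by simp
    define z where "z = y + n - 1"
    \<comment> \<open>Otherwise the outer edge \<open>u\<close>, \<open>v\<close> has gain
      \<open>(2, 1)\<close> on its far side, and its inequality for degrees 3 and 4 reads
      \<open>24 < 24\<close>.\<close>
    have z: "R v z"
    proof (rule ccontr)
      assume nz: "\<not> R v z"
      have ntri: "\<not> tri v (y + n)" using right_nontri[OF s(3)] nz z_def by simp
      have no: "\<not> R v k" if "y + n < k" "k < u + n" for k
        using noncrossing[of y "k - n" u v] periodic_minus(2)[of v k] sym[of v "k - n"] that su sv by auto
      have "gain v (u + n) (if tri v (y + n) then 3 else 2) (if R (y + n) (u + n) then 1 else 0)"
        by (rule gain_last) (use su sv no T in auto)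
      then have "gain v (u + n) 2 1"
        using ntri su periodic periodic2 by simp
      then show False using outer_ineq[of u 2 1] T d u interior_deg[OF s(1,2)] by simp
    qed
    show ?thesis
    proof (cases "z = v + 1")
      case True then show ?thesis using z_def T u3 by simp
    next
      case False
      have dz: "deg z \<le> 3" using outer_not_both_ge4[of z] y z_def deg_shift[of y] max[of z] by auto
      have "z \<le> v + 3"
      proof (rule narrow_arc)
        fix x assume "v < x" "x < z" "R v x"
        then show "x = v + 1"
          using nbrs_with[OF s(2,3), of "{z}" x] z d su sv sw False z_def T by auto
      next
        fix x assume x: "v < x" "x < z" "R x z"
        show "x = z - 1"
        proof (rule ccontr)
          assume c: "x \<noteq> z - 1"
          have "int (card {v, x, z - 1, z + 1}) \<le> deg z"
            using x z R_succ[of z] R_pred[of z] sym[of x z] sym[of v z] su sv sw z_def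
            by (intro deg_ge[of _ v]) auto
          then show False using dz c x False z_def by simp
        qed
      qed (use z sw sv su z_def d in auto)
      then show ?thesis using z_def T u3 by simp
    qed
  qed
qed

lemma bound_deg4_small':
  assumes s: "sector y (y + 1) u" "sector y u v" "sector y v (y + n - 1)" and y: "deg y = 4"
    and T: "v = u + 1" and max: "\<And>i. deg i \<le> 4" and v: "deg v \<le> 3"
  shows "n \<le> 10"
proof -
  interpret M: curved_polygon n "\<lambda>i j. R (- i) (- j)" by (rule mirror)
  have mdeg: "M.deg (- v) \<le> 3" "\<And>i. M.deg i \<le> 4"
    using max v by (simp_all add: mirror_degree)
  define z where "z = - (y + n)"
  have y': "M.deg z = 4" using mirror_degree[of z] deg_shift[of y] y by (simp add: z_def add.commute)
  have e: "- (y + n - 1) = z + 1" "- (y + 1) = z + n - 1" unfolding z_def by simp_all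
  have s': "M.sector z (z + 1) (- v)" "M.sector z (- v) (- u)" "M.sector z (- u) (z + n - 1)"
    using sector_mirror[OF s(1)] sector_mirror[OF s(2)] sector_mirror[OF s(3)]
    unfolding e z_def[symmetric] by simp_all
  have "- u = - v + 1" using T by simp
  from M.bound_deg4_small[OF s' y' this mdeg(2,1)] show ?thesis .
qed

lemma bound_deg4:
  assumes s: "sector y (y + 1) u" "sector y u v" "sector y v (y + n - 1)" and y: "deg y = 4"
    and max: "\<And>i. deg i \<le> 4"
  shows "n \<le> 10"
proof (cases "R u v")
  case False
  then show ?thesis using bound_deg4_quad[OF s y _ max] by blast
next
  case True
  note sv = sectorD[OF s(2)]
  show ?thesis
  proof (cases "v = u + 1")
    case t: True
    then have "deg u \<le> 3 \<or> deg v \<le> 3" using outer_not_both_ge4[of u] by auto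
    then show ?thesis using bound_deg4_small[OF s y t max] bound_deg4_small'[OF s y t max] by blast
  next
    case False
    then have "u + 1 < v" using sv by simp
    then have "u \<le> y + 3" "y + n \<le> v + 3"
      using left_width[OF s(1,2)] right_width[OF s(2,3)] True max y by simp_all
    moreover have "v \<le> u + 3" using narrow_tri_sector[OF s True] max by blast
    ultimately show ?thesis by simp
  qed
qed

text \<open>In a cycle with at least six vertices the outer neighbours of the two ends of an edge
  are at distance 3. The ideal values \<open>- 1\<close> and \<open>2\<close> are then admissible,
  and the inequality reads \<open>8 < 8\<close>.\<close>

lemma bound_deg2:
  assumes d: "\<And>i. deg i = 2"
  shows "n \<le> 5"
proof (rule ccontr)
  assume c: "\<not> n \<le> 5"
  define g :: "int \<Rightarrow> int" where "g u = (if u \<le> 2 then - 1 else 2)" for u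
  have a: "u = 2" if "1 < u" "u < n" "R 1 u" for u
    using deg2_nbrs[OF d, of 1 u] that by auto
  have b: "u = n - 1" if "1 < u" "u < n" "R u n" for u
    using deg2_nbrs[OF d, of 0 u] that periodic2[of u 0] sym[of 0 u] by auto
  have e: "\<not> R 2 (n - 1)" "\<not> R 3 (n - 1)"
    using deg2_nbrs[OF d, of 2 "n - 1"] deg2_nbrs[OF d, of 3 "n - 1"] c by auto
  have f: "t = 3" if "1 < t" "t < n" "R 2 t" for t
    using deg2_nbrs[OF d, of 2 t] irrefl[of 2] that by (cases "t = 2") auto
  have s1: "{u \<in> {1<..<n}. R 1 u} = {2}" using a c R_succ[of 1] by auto
  have s2: "{u \<in> {1<..<n}. R u n} = {n - 1}" using b c R_succ[of "n - 1"] by auto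
  have "gain_map R 1 n g"
    unfolding gain_map_def
  proof (intro conjI ballI impI)
    fix u w assume "u \<in> {1<..<n}" "w \<in> {1<..<n}" "R 1 u \<or> R u n" "R 1 w \<or> R w n" "R u w"
    then have "u = 2 \<or> u = n - 1" "w = 2 \<or> w = n - 1" "\<not> (u = 2 \<and> w = n - 1)"
      using a[of u] a[of w] b[of u] b[of w] e by auto
    then show "g w - g u \<le> 1" using c unfolding g_def by auto
  next
    fix u t w assume "u \<in> {1<..<n}" "t \<in> {1<..<n}" "w \<in> {1<..<n}" "R 1 u" "R u t" "R t w" "R w n"
    then show "g w - g u \<le> 2" using a[of u] b[of w] f[of t] e by auto
  next
    fix u assume "u \<in> {1<..<n}" "R 1 u"
    then have "u = 2" using a[of u] by simp
    then show "- 1 \<le> g u" "g u \<le> 1" by (simp_all add: g_def)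
  next
    fix u assume "u \<in> {1<..<n}" "R u n"
    then have "u = n - 1" using b[of u] by simp
    then show "0 \<le> g u" "g u \<le> 2" using c by (simp_all add: g_def)
  qed
  then have "gain 1 n 0 0"
    unfolding side_gain_def s1 s2 using c by (intro exI[of _ g]) (simp add: g_def)
  then show False using outer_ineq[of 0 0 0] d by simp
qed

theorem polygon_bound: "n \<le> 10"
proof -
  have range: "deg i \<in> {2..9}" for i
  proof -
    have "curved_edge n R i (i + 1)" using n3 R_succ[of i] by (intro curved) auto
    from degree_le_9[OF this] deg_ge2[of i] show ?thesis by simp
  qed
  then have "range deg \<subseteq> {2..9}" by blast
  then have fin: "finite (range deg)" by (rule finite_subset) simp
  then have "Max (range deg) \<in> range deg" by (intro Max_in) auto
  then obtain y where y: "deg y = Max (range deg)" by auto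
  then have max: "deg i \<le> deg y" for i using fin by simp
  obtain v where v0: "v 0 = y + 1" and vl: "v (nat (deg y) - 1) = y + n - 1"
    and sec: "\<And>t. t < nat (deg y) - 1 \<Longrightarrow> sector y (v t) (v (Suc t))"
    using sector_enumeration[of y] by blast
  consider "deg y = 2" | "deg y = 3" | "deg y = 4" | "deg y = 5" | "deg y = 6" | "deg y = 7"
    | "deg y = 8" | "deg y = 9" using range[of y] by fastforce
  then show ?thesis
  proof cases
    case 1
    then have "deg i = 2" for i using max[of i] deg_ge2[of i] by simp
    then show ?thesis using bound_deg2 by fastforce
  next
    case 2
    have s: "sector y (y + 1) (v 1)" "sector y (v 1) (y + n - 1)"
      using sec[of 0] sec[of 1] v0 vl 2 by (simp_all add: numeral_2_eq_2)
    then show ?thesis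
      using left_width[OF s] right_width[OF s] max[of "v 1"] 2 by simp
  next
    case 3
    have "sector y (y + 1) (v 1)" "sector y (v 1) (v 2)" "sector y (v 2) (y + n - 1)"
      using sec[of 0] sec[of 1] sec[of 2] v0 vl 3 by (simp_all add: eval_nat_numeral)
    then show ?thesis using bound_deg4[of y "v 1" "v 2"] 3 max by simp
  next
    case 4
    have s: "sector y (v 0) (v 1)" "sector y (v 1) (v 2)" "sector y (v 2) (v 3)" "sector y (v 3) (v 4)"
      using sec[of 0] sec[of 1] sec[of 2] sec[of 3] 4 by (simp_all add: eval_nat_numeral)
    have "v 4 = y + n - 1" using vl 4 by (simp add: eval_nat_numeral)
    \<comment> \<open>The sector widths are at most 1, 3, 3, 1, and they add up to
      \<open>n - 2\<close>.\<close>
    then show ?thesis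
      using width_deg5[OF s 4 v0] width_deg5'[OF s 4] max[of "v 1"] max[of "v 2"] max[of "v 3"] 4 v0
        first_sector[of y "v 1"] last_sector[of y "v 3"] s(1,4) by simp
  next
    case 5
    have s: "sector y (v 0) (v 1)" "sector y (v 1) (v 2)" "sector y (v 2) (v 3)" "sector y (v 3) (v 4)"
      "sector y (v 4) (v 5)"
      using sec[of 0] sec[of 1] sec[of 2] sec[of 3] sec[of 4] 5 by (simp_all add: eval_nat_numeral)
    have vl: "v 5 = y + n - 1" using vl 5 by (simp add: eval_nat_numeral)
    note lt = s[THEN sectorD(2)]
    have e: "v 1 = y + 2" "v 4 = y + n - 2"
      using first_sector[of y "v 1"] last_sector[of y "v 4"] s(1,5) v0 vl 5 by simp_all
    have D1: "v 1 = v 2 - 2 \<and> v 3 = v 2 + 2" if "v 1 + 1 < v 2" "v 2 + 1 < v 3"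
      using double_gap_deg6[OF s(2,3) 5 that] by simp
    have D2: "v 2 = v 3 - 2 \<and> v 4 = v 3 + 2" if "v 2 + 1 < v 3" "v 3 + 1 < v 4"
      using double_gap_deg6[OF s(3,4) 5 that] by simp
    have W1: "v 2 \<le> v 1 + 3" if "v 3 = v 2 + 1"
      using width_deg6[OF s(1-3) 5] e(1) v0 that by simp
    have W2: "v 3 \<le> v 2 + 3" if "v 2 = v 1 + 1" "v 4 = v 3 + 1"
      using width_deg6[OF s(2-4) 5 that] .
    have W3: "v 4 \<le> v 3 + 3" if "v 3 = v 2 + 1"
      using width_deg6[OF s(3-5) 5 that] e(2) vl by simp
    \<comment> \<open>Width 3 on both sides of the outer edge \<open>v 2\<close>, \<open>v 3\<close>
      would give both of its ends degree at least 4.\<close>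
    have alt: "v 2 \<le> v 1 + 2 \<or> v 4 \<le> v 3 + 2" if "v 3 = v 2 + 1"
    proof (rule ccontr)
      assume c: "\<not> ?thesis"
      have d6: "6 \<le> deg y" using 5 by simp
      have R1: "R (v 1) (v 2)" using nontri_sector(1)[OF s(2,3) d6] c by linarith
      have R3: "R (v 3) (v 4)" using nontri_sector(2)[OF s(3,4) d6] c by linarith
      have "4 \<le> deg (v 2)" using tri_gap_deg(1)[OF s(2,3) R1] c by linarith
      moreover have "4 \<le> deg (v 3)" using tri_gap_deg(2)[OF s(3,4) R3] c by linarith
      ultimately show False using outer_not_both_ge4[of "v 2"] that by simp
    qed
    \<comment> \<open>Neighbouring gaps have width 2 each, a gap between sectors of width 1 has
      width at most 3. The only sum above 6 that this leaves, \<open>3 + 1 + 3\<close>, is excluded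
      by \<open>alt\<close>.\<close>
    have "v 4 - v 1 \<le> 6"
    proof (cases "v 3 = v 2 + 1")
      case True
      then show ?thesis using W1 W3 alt by linarith
    next
      case False
      then have g: "v 2 + 1 < v 3" using lt(3) by linarith
      consider "v 2 = v 1 + 1" "v 4 = v 3 + 1" | "v 1 + 1 < v 2" | "v 3 + 1 < v 4" "v 2 = v 1 + 1"
        using lt(2,4) by linarith
      then show ?thesis
      proof cases
        case 1 then show ?thesis using W2 by linarith
      next
        case 2
        then have "v 1 = v 2 - 2 \<and> v 3 = v 2 + 2" using D1 g by blast
        moreover have "v 4 \<le> v 3 + 2" using D2[OF g] lt(4) by linarith
        ultimately show ?thesis by linarith
      next
        case 3 then show ?thesis using D2[OF g] by linarith
      qed
    qed
    then show ?thesis using e by linarith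
  next
    case 6
    have s: "sector y (v 0) (v 1)" "sector y (v 1) (v 2)" "sector y (v 2) (v 3)" "sector y (v 3) (v 4)"
      "sector y (v 4) (v 5)" "sector y (v 5) (v 6)"
      using sec[of 0] sec[of 1] sec[of 2] sec[of 3] sec[of 4] sec[of 5] 6 by (simp_all add: eval_nat_numeral)
    have vl: "v 6 = y + n - 1" using vl 6 by (simp add: eval_nat_numeral)
    note lt = s[THEN sectorD(2)]
    have nt: "\<not> tri y (v 0)" "\<not> tri (v 6) (y + n)"
      using not_tri_short[of y] not_tri_short[of "y + n - 1"] v0 vl by simp_all
    \<comment> \<open>No triangle precedes the first sector or follows the last one, so
      \<open>gap_deg7\<close> forbids gaps next to \<open>v 1\<close> and
      \<open>v 5\<close>.\<close>
    have "v 1 = v 0 + 1" "v 2 = v 1 + 1" using gap_deg7(1)[OF s(1,2) 6] nt lt by force+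
    moreover have "v 5 = v 4 + 1" "v 6 = v 5 + 1" using gap_deg7(2)[OF s(5,6) 6] nt lt by force+
    moreover have "v 3 = v 2 + 1 \<or> v 4 = v 3 + 1" using gap_deg7(3)[OF s(3,4) 6] lt by force
    moreover have "v 3 \<le> v 2 + 3" "v 4 \<le> v 3 + 3"
      using width_deg7[OF s(2-4) 6] width_deg7[OF s(3-5) 6] by simp_all
    ultimately show ?thesis using v0 vl by auto
  next
    case 7
    have s: "sector y (v 0) (v 1)" "sector y (v 1) (v 2)" "sector y (v 2) (v 3)" "sector y (v 3) (v 4)"
      "sector y (v 4) (v 5)" "sector y (v 5) (v 6)" "sector y (v 6) (v 7)"
      using sec[of 0] sec[of 1] sec[of 2] sec[of 3] sec[of 4] sec[of 5] sec[of 6] 7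
      by (simp_all add: eval_nat_numeral)
    have vl: "v 7 = y + n - 1" using vl 7 by (simp add: eval_nat_numeral)
    show ?thesis
      using consecutive_nbrs_deg_ge8[OF s(1,2)] consecutive_nbrs_deg_ge8[OF s(3,4)] consecutive_nbrs_deg_ge8[OF s(5,6)]
        consecutive_nbrs_deg_ge8[OF s(6,7)] 7 v0 vl by simp
  next
    case 8
    have s: "sector y (v 0) (v 1)" "sector y (v 1) (v 2)" "sector y (v 2) (v 3)" "sector y (v 3) (v 4)"
      "sector y (v 4) (v 5)" "sector y (v 5) (v 6)" "sector y (v 6) (v 7)" "sector y (v 7) (v 8)"
      using sec[of 0] sec[of 1] sec[of 2] sec[of 3] sec[of 4] sec[of 5] sec[of 6] sec[of 7] 8
      by (simp_all add: eval_nat_numeral)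
    have vl: "v 8 = y + n - 1" using vl 8 by (simp add: eval_nat_numeral)
    show ?thesis
      using consecutive_nbrs_deg_ge8[OF s(1,2)] consecutive_nbrs_deg_ge8[OF s(3,4)] consecutive_nbrs_deg_ge8[OF s(5,6)]
        consecutive_nbrs_deg_ge8[OF s(7,8)] 8 v0 vl by simp
  qed
qed

end

section \<open>Long cycles in outerplanar graphs\<close>

definition cycle :: "'a set \<Rightarrow> 'a set set \<Rightarrow> 'a list \<Rightarrow> bool" where
  "cycle V E xs \<longleftrightarrow> distinct xs \<and> 3 \<le> length xs \<and> path_edges (xs @ [hd xs]) \<subseteq> E \<and> set xs \<subseteq> V"

lemma cycle_append_commute:
  assumes "cycle V E (us @ vs)"
  shows "cycle V E (vs @ us)"
proof (cases "us = [] \<or> vs = []")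
  case True
  then show ?thesis using assms by auto
next
  case False
  then obtain u us' v vs' where uv: "us = u # us'" "vs = v # vs'" by (meson neq_Nil_conv)
  have "path_edges ((us @ vs) @ [u]) = path_edges (us @ [v]) \<union> path_edges (vs @ [u])"
    using path_edges_append[of us v "vs' @ [u]"] uv by simp
  moreover have "path_edges ((vs @ us) @ [v]) = path_edges (vs @ [u]) \<union> path_edges (us @ [v])"
    using path_edges_append[of vs u "us' @ [v]"] uv by simp
  ultimately show ?thesis using assms uv unfolding cycle_def by auto
qed

lemma cycle_rotate: "cycle V E xs \<Longrightarrow> cycle V E (rotate m xs)"
  using cycle_append_commute[of V E "take (m mod length xs) xs" "drop (m mod length xs) xs"]
  by (simp add: rotate_drop_take)

text \<open>Induction along the walk; if its new first vertex already occurs on the path, the path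
  is shortened to begin there.\<close>

lemma first_hit:
  assumes "(v, w) \<in> (adj_rel F)\<^sup>*" "w \<in> S"
  shows "\<exists>us z. distinct (us @ [z]) \<and> path_edges (us @ [z]) \<subseteq> F \<and> hd (us @ [z]) = v \<and> z \<in> S \<and> set us \<inter> S = {}"
  using assms
proof (induction rule: converse_rtrancl_induct)
  case base
  then show ?case by (intro exI[of _ "[]"] exI[of _ w]) simp
next
  case (step v v')
  then obtain us z where I: "distinct (us @ [z])" "path_edges (us @ [z]) \<subseteq> F" "hd (us @ [z]) = v'" "z \<in> S"
    "set us \<inter> S = {}" by blast
  show ?case
  proof (cases "v \<in> S")
    case True
    then show ?thesis by (intro exI[of _ "[]"] exI[of _ v]) simp
  next
    case vS: False
    show ?thesis
    proof (cases "v \<in> set us")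
      case True
      then obtain as bs where "us = as @ v # bs" by (meson split_list)
      moreover from this have "path_edges ((v # bs) @ [z]) \<subseteq> F"
        using I(2) path_edges_append[of as v "bs @ [z]"] by simp
      ultimately show ?thesis using I
        by (intro exI[of _ "v # bs"] exI[of _ z]) auto
    next
      case False
      have "{v, v'} \<in> F" using step(1) unfolding adj_rel_def by simp
      moreover obtain ws where "us @ [z] = v' # ws" using I(3) by (cases "us @ [z]") auto
      ultimately have "path_edges ((v # us) @ [z]) \<subseteq> F" using I(2) by simp
      then show ?thesis using I vS False
        by (intro exI[of _ "v # us"] exI[of _ z]) auto
    qed
  qed
qed

context
  fixes V :: "'a set" and E :: "'a set set"
  assumes simple: "simple_graph V E" and two_conn: "two_connected V E"
begin

lemma edge_vertices: "{x, y} \<in> E \<Longrightarrow> x \<in> V \<and> y \<in> V \<and> x \<noteq> y"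
  using simple unfolding simple_graph_def by fastforce

lemma third_vertex:
  assumes "x \<in> V" "y \<in> V"
  obtains w where "w \<in> V" "w \<noteq> x" "w \<noteq> y"
proof -
  have "\<not> V \<subseteq> {x, y}"
  proof
    assume V: "V \<subseteq> {x, y}"
    then have "finite V" by (rule finite_subset) simp
    moreover have "card V \<le> card {x, y}" using V by (intro card_mono) auto
    moreover have "card {x, y} \<le> 2" by (simp add: card_insert_if)
    ultimately show False using two_conn unfolding two_connected_def by simp
  qed
  then show ?thesis using that by blast
qed

lemma connected_avoiding:
  assumes "x \<in> V" "u \<in> V" "w \<in> V" "u \<noteq> x" "w \<noteq> x"
  shows "(u, w) \<in> (adj_rel {e \<in> E. x \<notin> e})\<^sup>*"
  using two_conn assms unfolding two_connected_def connected_graph_def by blast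

lemma connected_all: "u \<in> V \<Longrightarrow> w \<in> V \<Longrightarrow> (u, w) \<in> (adj_rel E)\<^sup>*"
  using two_conn unfolding two_connected_def connected_graph_def by blast

lemma path_avoiding:
  assumes "x \<in> V" "u \<in> V" "w \<in> S" "w \<in> V" "u \<noteq> x" "w \<noteq> x" "u \<notin> S"
  obtains us z where "us \<noteq> []" "distinct (us @ [z])" "path_edges (us @ [z]) \<subseteq> E" "hd us = u" "z \<in> S"
    "set us \<inter> S = {}" "x \<notin> set (us @ [z])" "set (us @ [z]) \<subseteq> V"
proof -
  obtain us z where p: "distinct (us @ [z])" "path_edges (us @ [z]) \<subseteq> {e \<in> E. x \<notin> e}" "hd (us @ [z]) = u"
    "z \<in> S" "set us \<inter> S = {}"
    using first_hit[OF connected_avoiding[OF assms(1,2,4,5,6)] assms(3)] by blast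
  have ne: "us \<noteq> []" using p assms(7) by auto
  then have "2 \<le> length (us @ [z])" by (cases us) auto
  then have U: "set (us @ [z]) = \<Union> (path_edges (us @ [z]))" using Union_path_edges by metis
  have "x \<notin> set (us @ [z])" unfolding U using p(2) by blast
  moreover have "set (us @ [z]) \<subseteq> V" unfolding U using p(2) simple unfolding simple_graph_def by blast
  ultimately show ?thesis using that[of us z] p ne by auto
qed

text \<open>A vertex \<open>x\<close> has two neighbours \<open>y\<close> and \<open>z\<close>, the
  second because \<open>x\<close> is still joined to the rest after \<open>y\<close> is deleted. A
  path from \<open>y\<close> to \<open>z\<close> avoiding \<open>x\<close> closes up to a
  cycle.\<close>

lemma cycle_exists: "\<exists>xs. cycle V E xs"
proof -
  obtain x where x: "x \<in> V" using two_conn unfolding two_connected_def connected_graph_def by blast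
  have step: "\<exists>y. {x, y} \<in> F" if "(x, w) \<in> (adj_rel F)\<^sup>*" "w \<noteq> x" for w F
    using that by (cases rule: converse_rtranclE) (auto simp: adj_rel_def)
  obtain w where "w \<in> V" "w \<noteq> x" using third_vertex[OF x x] by blast
  then obtain y where y: "{x, y} \<in> E" using step[OF connected_all[OF x]] by blast
  then have yV: "y \<in> V" "x \<noteq> y" using edge_vertices by blast+
  obtain w' where "w' \<in> V" "w' \<noteq> x" "w' \<noteq> y" using third_vertex[OF x yV(1)] by blast
  then obtain z where z: "{x, z} \<in> E" "y \<notin> {x, z}"
    using step[OF connected_avoiding[OF yV(1) x]] yV(2) by blast
  then have zV: "z \<in> V" "z \<noteq> x" "y \<notin> {z}" using edge_vertices by blast+
  obtain us z' where p: "us \<noteq> []" "distinct (us @ [z'])" "path_edges (us @ [z']) \<subseteq> E" "hd us = y" "z' \<in> {z}"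
    "x \<notin> set (us @ [z'])" "set (us @ [z']) \<subseteq> V"
    using path_avoiding[OF x yV(1) _ zV(1) _ zV(2,3)] yV(2) by (metis singletonI)
  obtain us' where us: "us = y # us'" using p(1,4) by (cases us) auto
  have "path_edges ((x # us @ [z]) @ [x]) = {{x, y}} \<union> path_edges (us @ [z]) \<union> {{z, x}}"
    using us path_edges_append[of "x # us" z "[x]"] by simp
  then have "cycle V E (x # us @ [z])"
    unfolding cycle_def using p us y z(1) x by (auto simp: insert_commute)
  then show ?thesis by blast
qed

text \<open>Deleting \<open>h\<close> keeps the graph connected, so an ear that leaves the cycle at
  \<open>h\<close> through \<open>v\<close> returns at some other vertex \<open>z\<close>. If
  \<open>h\<close> and \<open>z\<close> are consecutive, the ear replaces the edge between them and
  no vertex is lost; otherwise it forms a theta graph with the two arcs of the cycle.\<close>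

lemma cycle_extend:
  assumes op: "outerplanar V E" and xs: "cycle V E xs" and h: "h \<in> set xs" and v: "{h, v} \<in> E" "v \<notin> set xs"
  shows "\<exists>ys. cycle V E ys \<and> insert v (set xs) \<subseteq> set ys"
proof -
  obtain as bs where "xs = as @ h # bs" using h by (meson split_list)
  then have "cycle V E ((h # bs) @ as)" using xs cycle_append_commute by blast
  moreover define Q where "Q = bs @ as"
  ultimately have cyc: "cycle V E (h # Q)" by simp
  have set: "set xs = insert h (set Q)" unfolding Q_def \<open>xs = as @ h # bs\<close> by auto
  have V: "h \<in> V" "v \<in> V" "v \<noteq> h" using edge_vertices[OF v(1)] by auto
  obtain q where q: "q \<in> set Q" using cyc unfolding cycle_def by (cases Q) auto
  then have qV: "q \<in> V" "q \<noteq> h" using cyc unfolding cycle_def by auto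
  obtain us z where p: "us \<noteq> []" "distinct (us @ [z])" "path_edges (us @ [z]) \<subseteq> E" "hd us = v" "z \<in> set Q"
    "set us \<inter> set Q = {}" "h \<notin> set (us @ [z])" "set (us @ [z]) \<subseteq> V"
    using path_avoiding[OF V(1,2) q qV(1) V(3) qV(2)] v(2) set by auto
  obtain us' where us: "us = v # us'" using p(1,4) by (cases us) auto
  obtain Q1 Q2 where Q: "Q = Q1 @ z # Q2" using p(5) by (meson split_list)
  have cQ: "distinct (h # Q)" "path_edges (h # Q1 @ [z]) \<subseteq> E" "path_edges (z # Q2 @ [h]) \<subseteq> E" "set Q \<subseteq> V"
    using cyc path_edges_append[of "h # Q1" z "Q2 @ [h]"] unfolding cycle_def Q by auto
  have ear: "path_edges (h # us @ [z]) \<subseteq> E" using us p(3) v(1) by simp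
  consider "Q1 = []" | "Q2 = []" | "Q1 \<noteq> []" "Q2 \<noteq> []" by blast
  then show ?thesis
  proof cases
    case 1
    have "path_edges ((h # us @ z # Q2) @ [h]) = path_edges (h # us @ [z]) \<union> path_edges (z # Q2 @ [h])"
      using path_edges_append[of "h # us" z "Q2 @ [h]"] by simp
    then have "cycle V E (h # us @ z # Q2)"
      unfolding cycle_def using ear cQ p V us Q by auto
    then show ?thesis using set Q 1 us by (intro exI[of _ "h # us @ z # Q2"]) auto
  next
    case 2
    have "path_edges ((h # Q1 @ z # rev us) @ [h]) = path_edges (h # Q1 @ [z]) \<union> path_edges (rev (h # us @ [z]))"
      using path_edges_append[of "h # Q1" z "rev us @ [h]"] by simp
    then have "cycle V E (h # Q1 @ z # rev us)"
      unfolding cycle_def using ear cQ p V us Q path_edges_rev[of "h # us @ [z]"] by auto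
    then show ?thesis using set Q 2 us by (intro exI[of _ "h # Q1 @ z # rev us"]) auto
  next
    case 3
    have len: "3 \<le> length (h # ws @ [z])" if "ws \<noteq> []" for ws using that by (cases ws) auto
    have "path_edges (h # rev Q2 @ [z]) \<subseteq> E" using cQ(3) path_edges_rev[of "z # Q2 @ [h]"] by simp
    then have "link V E h (h # Q1 @ [z]) z" "link V E h (h # rev Q2 @ [z]) z" "link V E h (h # us @ [z]) z"
      unfolding link_def using len 3 cQ p V ear Q by auto
    then show ?thesis
      using outerplanar_no_theta[OF simple op, of h "h # Q1 @ [z]" z "h # rev Q2 @ [z]" "h # us @ [z]"] cQ(1) p Q
      by auto
  qed
qed

text \<open>A walk leads from the cycle to each new vertex of \<open>S\<close>, and
  \<open>cycle_extend\<close> absorbs the vertices of that walk one at a time.\<close>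

theorem cycle_through:
  assumes "outerplanar V E" "finite S" "S \<subseteq> V"
  shows "\<exists>xs. cycle V E xs \<and> S \<subseteq> set xs"
  using assms(2,3)
proof (induction S rule: finite_induct)
  case empty
  then show ?case using cycle_exists by simp
next
  case (insert v S)
  then obtain xs where xs: "cycle V E xs" "S \<subseteq> set xs" by blast
  then obtain u where u: "u \<in> set xs" "u \<in> V" unfolding cycle_def by (cases xs) auto
  have "(u, v) \<in> (adj_rel E)\<^sup>*" using connected_all u(2) insert by blast
  then have "\<exists>ys. cycle V E ys \<and> insert v (set xs) \<subseteq> set ys"
  proof (induction rule: rtrancl_induct)
    case base
    then show ?case using xs u by auto
  next
    case (step y z)
    then obtain ys where ys: "cycle V E ys" "insert y (set xs) \<subseteq> set ys" by blast
    show ?case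
    proof (cases "z \<in> set ys")
      case True
      then show ?thesis using ys by blast
    next
      case False
      then obtain zs where "cycle V E zs" "insert z (set ys) \<subseteq> set zs"
        using cycle_extend[OF assms(1) ys(1), of y z] ys(2) step(2) unfolding adj_rel_def by blast
      then show ?thesis using ys(2) by blast
    qed
  qed
  then show ?case using xs(2) by blast
qed

end

section \<open>Cycles as polygons\<close>

definition cyc_nth :: "'a list \<Rightarrow> int \<Rightarrow> 'a" where
  "cyc_nth xs i = xs ! nat (i mod int (length xs))"

lemma cyc_nth_shift:
  assumes "0 \<le> t" "t < int (length xs)"
  shows "cyc_nth xs (i + t) = rotate (nat (i mod int (length xs))) xs ! nat t"
proof -
  let ?n = "int (length xs)"
  have n: "0 < ?n" using assms by linarith
  have "(nat (i mod ?n) + nat t) mod length xs = nat ((i + t) mod ?n)"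
  proof -
    have "int ((nat (i mod ?n) + nat t) mod length xs) = (i mod ?n + t) mod ?n"
      using n assms(1) by (simp add: zmod_int)
    then show ?thesis by (simp add: mod_add_left_eq)
  qed
  then show ?thesis unfolding cyc_nth_def using assms by (simp add: nth_rotate nat_less_iff)
qed

lemma cyc_nth_add_length: "cyc_nth xs (i + int (length xs)) = cyc_nth xs i"
  unfolding cyc_nth_def by simp

lemma split_at_three:
  assumes "0 < k" "k < j" "j < l" "l < length zs"
  obtains P Q R S where "zs = zs ! 0 # P @ zs ! k # Q @ zs ! j # R @ zs ! l # S"
proof -
  have 1: "zs = take l zs @ zs ! l # drop (Suc l) zs" using id_take_nth_drop[of l zs] assms by simp
  have 2: "take l zs = take j zs @ zs ! j # drop (Suc j) (take l zs)"
    using id_take_nth_drop[of j "take l zs"] assms by (simp add: min_def)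
  have 3: "take j zs = take k zs @ zs ! k # drop (Suc k) (take j zs)"
    using id_take_nth_drop[of k "take j zs"] assms by (simp add: min_def)
  have 4: "take k zs = zs ! 0 # drop (Suc 0) (take k zs)"
    using id_take_nth_drop[of 0 "take k zs"] assms by simp
  have "zs = zs ! 0 # drop (Suc 0) (take k zs) @ zs ! k # drop (Suc k) (take j zs) @ zs ! j #
      drop (Suc j) (take l zs) @ zs ! l # drop (Suc l) zs"
    using 1 2 3 4 by (metis append.assoc append_Cons)
  then show ?thesis
    using that[of "drop (Suc 0) (take k zs)" "drop (Suc k) (take j zs)" "drop (Suc j) (take l zs)" "drop (Suc l) zs"]
    by blast
qed

theorem cycle_polygon:
  assumes G: "simple_graph V E" "outerplanar V E" and xs: "cycle V E xs"
  shows "polygon (int (length xs)) (\<lambda>i j. {cyc_nth xs i, cyc_nth xs j} \<in> E)"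
proof
  let ?n = "int (length xs)" and ?c = "cyc_nth xs"
  have len: "3 \<le> length xs" using xs unfolding cycle_def by simp
  show "3 \<le> ?n" using len by simp
  show "{?c i, ?c j} \<in> E \<longleftrightarrow> {?c j, ?c i} \<in> E" for i j by (simp add: insert_commute)
  show "{?c (i + ?n), ?c j} \<in> E \<longleftrightarrow> {?c i, ?c j} \<in> E" for i j by (simp add: cyc_nth_add_length)
  show "{?c i, ?c i} \<notin> E" for i using G(1) unfolding simple_graph_def by force
  show "{?c i, ?c (i + 1)} \<in> E" for i
  proof -
    define zs where "zs = rotate (nat (i mod ?n)) xs"
    have cz: "cycle V E zs" unfolding zs_def by (rule cycle_rotate[OF xs])
    have lz: "length zs = length xs" unfolding zs_def by simp
    obtain a b r where "zs = a # b # r" using len lz by (cases zs; cases "tl zs") auto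
    then have "{zs ! 0, zs ! 1} \<in> E" using cz unfolding cycle_def by simp
    then show ?thesis
      using cyc_nth_shift[of 0 xs i] cyc_nth_shift[of 1 xs i] len unfolding zs_def by (cases "xs = []") auto
  qed
  fix i k j l :: int
  assume o: "i < k" "k < j" "j < l" "l < i + ?n" and ij: "{?c i, ?c j} \<in> E"
  show "{?c k, ?c l} \<notin> E"
  proof
    assume kl: "{?c k, ?c l} \<in> E"
    define zs where "zs = rotate (nat (i mod ?n)) xs"
    have cz: "cycle V E zs" unfolding zs_def by (rule cycle_rotate[OF xs])
    have lz: "length zs = length xs" unfolding zs_def by simp
    have c: "?c t = zs ! nat (t - i)" if "i \<le> t" "t < i + ?n" for t
      using cyc_nth_shift[of "t - i" xs i] that unfolding zs_def by simp
    obtain P Q R S where z: "zs = zs ! 0 # P @ zs ! nat (k - i) # Q @ zs ! nat (j - i) # R @ zs ! nat (l - i) # S"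
    proof (rule split_at_three[of "nat (k - i)" "nat (j - i)" "nat (l - i)" zs])
      show "0 < nat (k - i)" "nat (k - i) < nat (j - i)" "nat (j - i) < nat (l - i)" "nat (l - i) < length zs"
        using o lz by linarith+
    qed
    have e: "?c i = zs ! 0" "?c k = zs ! nat (k - i)" "?c j = zs ! nat (j - i)" "?c l = zs ! nat (l - i)"
      using c[of i] c[of k] c[of j] c[of l] o len by (cases "xs = []"; auto)+
    define a b c' d where abcd: "a = zs ! 0" "b = zs ! nat (k - i)" "c' = zs ! nat (j - i)" "d = zs ! nat (l - i)"
    have z: "zs = a # P @ b # Q @ c' # R @ d # S" using z unfolding abcd .
    show False
    proof (rule outerplanar_no_crossing[OF G])
      show "distinct (a # P @ b # Q @ c' # R @ d # S)" "set (a # P @ b # Q @ c' # R @ d # S) \<subseteq> V"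
        "path_edges (a # P @ b # Q @ c' # R @ d # S @ [a]) \<subseteq> E"
        using cz unfolding cycle_def z by simp_all
      show "{a, c'} \<in> E" "{b, d} \<in> E" using ij kl e unfolding abcd by simp_all
    qed
  qed
qed

section \<open>Bounds on the curvature\<close>

lemma infsum_finite_support:
  fixes f :: "'a \<Rightarrow> real"
  assumes "finite F" "F \<subseteq> V" "\<And>v. v \<in> V - F \<Longrightarrow> f v = 0"
  shows "infsum f V = sum f F"
proof -
  have "infsum f V = infsum f F" using assms by (intro infsum_cong_neutral) auto
  then show ?thesis using assms(1) by simp
qed

definition transport_cost :: "'a set \<Rightarrow> 'a set set \<Rightarrow> ('a \<times> 'a \<Rightarrow> real) \<Rightarrow> real" where
  "transport_cost V E A = (\<Sum>\<^sub>\<infinity>(u, v)\<in>V \<times> V. A (u, v) * real (graph_dist E u v))"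

lemma coupling_finite_support:
  assumes "is_coupling V m1 m2 A"
  obtains U where "finite U" "U \<subseteq> V" "\<forall>u\<in>V. \<forall>v\<in>V. A (u, v) \<noteq> 0 \<longrightarrow> u \<in> U \<and> v \<in> U"
proof -
  let ?P = "{p \<in> V \<times> V. A p \<noteq> 0}"
  have "finite ?P" using assms unfolding is_coupling_def by simp
  then have "finite (fst ` ?P \<union> snd ` ?P)" by simp
  moreover have "fst ` ?P \<union> snd ` ?P \<subseteq> V" by auto
  moreover have "\<forall>u\<in>V. \<forall>v\<in>V. A (u, v) \<noteq> 0 \<longrightarrow> u \<in> fst ` ?P \<union> snd ` ?P \<and> v \<in> fst ` ?P \<union> snd ` ?P"
    by force
  ultimately show ?thesis by (rule that)
qed

lemma coupling_sums:
  assumes "is_coupling V m1 m2 A" "finite U" "U \<subseteq> V"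
    "\<forall>u\<in>V. \<forall>v\<in>V. A (u, v) \<noteq> 0 \<longrightarrow> u \<in> U \<and> v \<in> U"
  shows "u \<in> V \<Longrightarrow> m1 u = (\<Sum>v\<in>U. A (u, v))" "v \<in> V \<Longrightarrow> m2 v = (\<Sum>u\<in>U. A (u, v))"
    "transport_cost V E A = (\<Sum>u\<in>U. \<Sum>v\<in>U. A (u, v) * real (graph_dist E u v))"
    "u \<in> V \<Longrightarrow> v \<in> V \<Longrightarrow> 0 \<le> A (u, v)"
proof -
  show "m1 u = (\<Sum>v\<in>U. A (u, v))" if "u \<in> V"
  proof -
    have "(\<Sum>\<^sub>\<infinity>v\<in>V. A (u, v)) = (\<Sum>v\<in>U. A (u, v))"
      using assms(2-4) that by (intro infsum_finite_support) auto
    then show ?thesis using assms(1) that unfolding is_coupling_def by metis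
  qed
  show "m2 v = (\<Sum>u\<in>U. A (u, v))" if "v \<in> V"
  proof -
    have "(\<Sum>\<^sub>\<infinity>u\<in>V. A (u, v)) = (\<Sum>u\<in>U. A (u, v))"
      using assms(2-4) that by (intro infsum_finite_support) auto
    then show ?thesis using assms(1) that unfolding is_coupling_def by metis
  qed
  have "transport_cost V E A = (\<Sum>(u, v)\<in>U \<times> U. A (u, v) * real (graph_dist E u v))"
    unfolding transport_cost_def
    by (rule infsum_finite_support) (use assms(2-4) in auto)
  then show "transport_cost V E A = (\<Sum>u\<in>U. \<Sum>v\<in>U. A (u, v) * real (graph_dist E u v))"
    by (simp add: sum.cartesian_product)
  show "0 \<le> A (u, v)" if "u \<in> V" "v \<in> V"
    using assms(1) that unfolding is_coupling_def by auto
qed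

lemma couplingI_finite:
  assumes U: "finite U" "U \<subseteq> V" and A: "\<And>p. p \<notin> U \<times> U \<Longrightarrow> A p = 0" "\<And>u v. u \<in> U \<Longrightarrow> v \<in> U \<Longrightarrow> 0 \<le> A (u, v)"
    and m1: "\<And>u. u \<in> V \<Longrightarrow> m1 u = (\<Sum>v\<in>U. A (u, v))" and m2: "\<And>v. v \<in> V \<Longrightarrow> m2 v = (\<Sum>u\<in>U. A (u, v))"
    and le: "\<And>u. u \<in> U \<Longrightarrow> m1 u \<le> 1"
  shows "is_coupling V m1 m2 A"
    and "transport_cost V E A = (\<Sum>u\<in>U. \<Sum>v\<in>U. A (u, v) * real (graph_dist E u v))"
proof -
  have le1: "A (u, v) \<le> 1" if "u \<in> U" "v \<in> U" for u v
  proof -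
    have "A (u, v) \<le> (\<Sum>v\<in>U. A (u, v))" using that A(2) U(1) by (intro member_le_sum) auto
    then show ?thesis using le[OF that(1)] m1[of u] that U by force
  qed
  have "A p \<in> {0..1}" for p
    using A le1 by (cases "p \<in> U \<times> U") auto
  moreover have "finite {p \<in> V \<times> V. A p \<noteq> 0}"
    using A(1) by (intro finite_subset[OF _ finite_cartesian_product[OF U(1) U(1)]]) auto
  moreover have "(\<Sum>\<^sub>\<infinity>v\<in>V. A (u, v)) = m1 u" if "u \<in> V" for u
    using m1[OF that] A(1) U by (subst infsum_finite_support[of U]) auto
  moreover have "(\<Sum>\<^sub>\<infinity>u\<in>V. A (u, v)) = m2 v" if "v \<in> V" for v
    using m2[OF that] A(1) U by (subst infsum_finite_support[of U]) auto
  ultimately show c: "is_coupling V m1 m2 A" unfolding is_coupling_def by blast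
  show "transport_cost V E A = (\<Sum>u\<in>U. \<Sum>v\<in>U. A (u, v) * real (graph_dist E u v))"
    using A(1) by (intro coupling_sums(3)[OF c U]) blast
qed

lemma transport_cost_nonneg:
  assumes "is_coupling V m1 m2 A" shows "0 \<le> transport_cost V E A"
proof -
  obtain U where U: "finite U" "U \<subseteq> V" "\<forall>u\<in>V. \<forall>v\<in>V. A (u, v) \<noteq> 0 \<longrightarrow> u \<in> U \<and> v \<in> U"
    using coupling_finite_support[OF assms] by metis
  show ?thesis unfolding coupling_sums(3)[OF assms U]
    using coupling_sums(4)[OF assms U] U(2) by (intro sum_nonneg mult_nonneg_nonneg) auto
qed

lemma wasserstein_le:
  assumes "is_coupling V m1 m2 A" shows "wasserstein V E m1 m2 \<le> transport_cost V E A"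
  unfolding wasserstein_def transport_cost_def[symmetric]
  using assms transport_cost_nonneg by (intro cINF_lower bdd_belowI2[where m = 0]) auto

text \<open>\<open>A0\<close> witnesses that the infimum is taken over a nonempty set; over the
  empty set it would carry no information.\<close>

lemma wasserstein_ge:
  assumes "is_coupling V m1 m2 A0" "\<And>A. is_coupling V m1 m2 A \<Longrightarrow> c \<le> transport_cost V E A"
  shows "c \<le> wasserstein V E m1 m2"
  unfolding wasserstein_def transport_cost_def[symmetric]
  using assms by (intro cINF_greatest) auto

text \<open>Weak Kantorovich duality: the Lipschitz inequality is summed against the coupling, whose
  marginals turn the left side into a difference of expectations.\<close>

lemma transport_cost_ge_Lipschitz:
  assumes c: "is_coupling V m1 m2 A" and f: "\<And>u v. u \<in> V \<Longrightarrow> v \<in> V \<Longrightarrow> f v - f u \<le> real (graph_dist E u v)"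
    and W: "finite W" "W \<subseteq> V" "\<And>v. v \<in> V - W \<Longrightarrow> m1 v = 0 \<and> m2 v = 0"
  shows "(\<Sum>v\<in>W. m2 v * f v) - (\<Sum>v\<in>W. m1 v * f v) \<le> transport_cost V E A"
proof -
  obtain U0 where U0: "finite U0" "U0 \<subseteq> V" "\<forall>u\<in>V. \<forall>v\<in>V. A (u, v) \<noteq> 0 \<longrightarrow> u \<in> U0 \<and> v \<in> U0"
    using coupling_finite_support[OF c] by metis
  define U where "U = U0 \<union> W"
  have U: "finite U" "U \<subseteq> V" "\<forall>u\<in>V. \<forall>v\<in>V. A (u, v) \<noteq> 0 \<longrightarrow> u \<in> U \<and> v \<in> U"
    using U0 W unfolding U_def by auto
  note S = coupling_sums[OF c U]
  have s2: "(\<Sum>v\<in>W. m2 v * f v) = (\<Sum>v\<in>U. \<Sum>u\<in>U. A (u, v) * f v)"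
  proof -
    have "(\<Sum>v\<in>W. m2 v * f v) = (\<Sum>v\<in>U. m2 v * f v)"
      using W U by (intro sum.mono_neutral_left) (auto simp: U_def)
    also have "\<dots> = (\<Sum>v\<in>U. \<Sum>u\<in>U. A (u, v) * f v)"
      using S(2) U(2) by (intro sum.cong) (auto simp: sum_distrib_right)
    finally show ?thesis .
  qed
  have s1: "(\<Sum>v\<in>W. m1 v * f v) = (\<Sum>u\<in>U. \<Sum>v\<in>U. A (u, v) * f u)"
  proof -
    have "(\<Sum>v\<in>W. m1 v * f v) = (\<Sum>v\<in>U. m1 v * f v)"
      using W U by (intro sum.mono_neutral_left) (auto simp: U_def)
    also have "\<dots> = (\<Sum>u\<in>U. \<Sum>v\<in>U. A (u, v) * f u)"
      using S(1) U(2) by (intro sum.cong) (auto simp: sum_distrib_right)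
    finally show ?thesis .
  qed
  have "(\<Sum>v\<in>W. m2 v * f v) - (\<Sum>v\<in>W. m1 v * f v)
      = (\<Sum>u\<in>U. \<Sum>v\<in>U. A (u, v) * (f v - f u))"
    unfolding s1 s2 by (subst (1) sum.swap) (simp add: sum_subtractf right_diff_distrib)
  also have "\<dots> \<le> (\<Sum>u\<in>U. \<Sum>v\<in>U. A (u, v) * real (graph_dist E u v))"
    using S(4) f subsetD[OF U(2)] by (intro sum_mono mult_left_mono) simp_all
  finally show ?thesis using S(3) by simp
qed

lemma coupling_mix:
  assumes A: "is_coupling V m1 m2 A" and B: "is_coupling V n1 n2 B" and t: "0 \<le> t" "t \<le> 1"
  shows "is_coupling V (\<lambda>v. t * m1 v + (1 - t) * n1 v) (\<lambda>v. t * m2 v + (1 - t) * n2 v)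
      (\<lambda>p. t * A p + (1 - t) * B p)" (is ?c)
    and "transport_cost V E (\<lambda>p. t * A p + (1 - t) * B p) = t * transport_cost V E A + (1 - t) * transport_cost V E B"
      (is ?t)
proof -
  obtain U1 where U1: "finite U1" "U1 \<subseteq> V" "\<forall>u\<in>V. \<forall>v\<in>V. A (u, v) \<noteq> 0 \<longrightarrow> u \<in> U1 \<and> v \<in> U1"
    using coupling_finite_support[OF A] by metis
  obtain U2 where U2: "finite U2" "U2 \<subseteq> V" "\<forall>u\<in>V. \<forall>v\<in>V. B (u, v) \<noteq> 0 \<longrightarrow> u \<in> U2 \<and> v \<in> U2"
    using coupling_finite_support[OF B] by metis
  define U where "U = U1 \<union> U2"
  have U: "finite U" "U \<subseteq> V" "\<forall>u\<in>V. \<forall>v\<in>V. A (u, v) \<noteq> 0 \<longrightarrow> u \<in> U \<and> v \<in> U"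
    "\<forall>u\<in>V. \<forall>v\<in>V. B (u, v) \<noteq> 0 \<longrightarrow> u \<in> U \<and> v \<in> U"
    using U1 U2 unfolding U_def by auto
  note SA = coupling_sums[OF A U(1-3)] and SB = coupling_sums[OF B U(1,2,4)]
  let ?M = "\<lambda>p. t * A p + (1 - t) * B p"
  have in01: "?M p \<in> {0..1}" if "p \<in> V \<times> V" for p
  proof -
    have "A p \<in> {0..1}" "B p \<in> {0..1}" using A B that unfolding is_coupling_def by auto
    then show ?thesis using t convex_bound_le[of "A p" 1 "B p" t "1 - t"] by auto
  qed
  have zero: "?M (u, v) = 0" if "u \<in> V" "v \<in> V" "u \<notin> U \<or> v \<notin> U" for u v
    using U(3,4) that by (cases "A (u, v) = 0"; cases "B (u, v) = 0") auto
  have fin: "finite {p \<in> V \<times> V. ?M p \<noteq> 0}"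
    using zero by (intro finite_subset[OF _ finite_cartesian_product[OF U(1) U(1)]]) blast
  have r: "(\<Sum>\<^sub>\<infinity>v\<in>V. ?M (u, v)) = t * m1 u + (1 - t) * n1 u" if "u \<in> V" for u
  proof -
    have "(\<Sum>\<^sub>\<infinity>v\<in>V. ?M (u, v)) = (\<Sum>v\<in>U. ?M (u, v))"
      using zero that U by (intro infsum_finite_support) auto
    then show ?thesis using SA(1)[OF that] SB(1)[OF that] by (simp add: sum.distrib sum_distrib_left)
  qed
  have l: "(\<Sum>\<^sub>\<infinity>u\<in>V. ?M (u, v)) = t * m2 v + (1 - t) * n2 v" if "v \<in> V" for v
  proof -
    have "(\<Sum>\<^sub>\<infinity>u\<in>V. ?M (u, v)) = (\<Sum>u\<in>U. ?M (u, v))"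
      using zero that U by (intro infsum_finite_support) auto
    then show ?thesis using SA(2)[OF that] SB(2)[OF that] by (simp add: sum.distrib sum_distrib_left)
  qed
  show c: ?c unfolding is_coupling_def using in01 fin r l by blast
  have "transport_cost V E ?M = (\<Sum>u\<in>U. \<Sum>v\<in>U. ?M (u, v) * real (graph_dist E u v))"
    using zero by (intro coupling_sums(3)[OF c U(1,2)]) blast
  also have "\<dots> = t * (\<Sum>u\<in>U. \<Sum>v\<in>U. A (u, v) * real (graph_dist E u v)) +
      (1 - t) * (\<Sum>u\<in>U. \<Sum>v\<in>U. B (u, v) * real (graph_dist E u v))"
    by (simp add: sum_distrib_left sum.distrib distrib_right mult.assoc)
  finally show ?t using SA(3) SB(3) by simp
qed

lemma coupling_point:
  assumes "x \<in> V" "y \<in> V"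
  shows "is_coupling V (\<lambda>v. if v = x then 1 else 0) (\<lambda>v. if v = y then 1 else 0) (\<lambda>p. if p = (x, y) then 1 else 0)"
    and "transport_cost V E (\<lambda>p. if p = (x, y) then 1 else 0) = real (graph_dist E x y)"
proof -
  let ?A = "\<lambda>p. if p = (x, y) then 1 else 0 :: real"
  have U: "finite {x, y}" "{x, y} \<subseteq> V" using assms by auto
  have m: "(if u = x then 1 else 0) = (\<Sum>v\<in>{x, y}. ?A (u, v))" "(if v = y then 1 else 0) = (\<Sum>u\<in>{x, y}. ?A (u, v))"
    for u v by (cases "x = y"; auto)+
  note c = couplingI_finite[OF U, of ?A "\<lambda>v. if v = x then 1 else 0" "\<lambda>v. if v = y then 1 else 0"]
  show "is_coupling V (\<lambda>v. if v = x then 1 else 0) (\<lambda>v. if v = y then 1 else 0) ?A"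
    by (rule c(1)[OF _ _ m]) auto
  have "transport_cost V E ?A = (\<Sum>u\<in>{x, y}. \<Sum>v\<in>{x, y}. ?A (u, v) * real (graph_dist E u v))"
    by (rule c(2)[OF _ _ m]) auto
  then show "transport_cost V E ?A = real (graph_dist E x y)" by (cases "x = y") auto
qed

section \<open>Lazy walks and curvature on a connected locally finite graph\<close>

locale connected_lf_graph =
  fixes V :: "'a set" and E :: "'a set set"
  assumes simple: "simple_graph V E" and lf: "locally_finite V E" and conn: "connected_graph V E"
begin

abbreviation "dst \<equiv> graph_dist E"
abbreviation "N \<equiv> nbhd E"

lemma nbhd_iff: "v \<in> N u \<longleftrightarrow> {u, v} \<in> E" unfolding nbhd_def by simp

lemma nbhd_sym: "v \<in> N u \<longleftrightarrow> u \<in> N v" unfolding nbhd_def by (simp add: insert_commute)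

lemma nbhd_in: "v \<in> N u \<Longrightarrow> u \<in> V \<and> v \<in> V \<and> u \<noteq> v"
  using simple unfolding nbhd_def simple_graph_def by fastforce

lemma nbhd_subset: "N u \<subseteq> V" using nbhd_in by blast

lemma finite_nbhd: "u \<in> V \<Longrightarrow> finite (N u)" using lf unfolding locally_finite_def by blast

lemma adj_rel_iff: "(u, v) \<in> adj_rel E \<longleftrightarrow> v \<in> N u" unfolding adj_rel_def nbhd_def by simp

lemma dst_walk:
  assumes "u \<in> V" "v \<in> V" shows "(u, v) \<in> adj_rel E ^^ dst u v"
proof -
  have "(u, v) \<in> (adj_rel E)\<^sup>*" using conn assms unfolding connected_graph_def by blast
  then obtain n where "(u, v) \<in> adj_rel E ^^ n" using rtrancl_imp_relpow by blast
  then show ?thesis unfolding graph_dist_def by (rule LeastI)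
qed

lemma dst_le: "(u, v) \<in> adj_rel E ^^ n \<Longrightarrow> dst u v \<le> n"
  unfolding graph_dist_def by (rule Least_le)

lemma dst_same [simp]: "dst u u = 0"
  using dst_le[of u u 0] by simp

lemma dst_eq_0: "u \<in> V \<Longrightarrow> v \<in> V \<Longrightarrow> dst u v = 0 \<longleftrightarrow> u = v"
  using dst_walk[of u v] by auto

lemma dst_triangle:
  assumes "u \<in> V" "v \<in> V" "w \<in> V" shows "dst u w \<le> dst u v + dst v w"
  using dst_walk[OF assms(1,2)] dst_walk[OF assms(2,3)] by (intro dst_le) (auto simp: relpow_add)

lemma dst_sym_le: "u \<in> V \<Longrightarrow> v \<in> V \<Longrightarrow> dst v u \<le> dst u v"
proof -
  assume a: "u \<in> V" "v \<in> V"
  have "(w, z) \<in> adj_rel E ^^ k \<Longrightarrow> (z, w) \<in> adj_rel E ^^ k" for w z k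
  proof (induction k arbitrary: z)
    case (Suc k)
    then obtain t where "(w, t) \<in> adj_rel E ^^ k" "(t, z) \<in> adj_rel E" by auto
    then have "(z, t) \<in> adj_rel E" "(t, w) \<in> adj_rel E ^^ k"
      using Suc.IH nbhd_sym[of z t] by (auto simp: adj_rel_iff)
    then show ?case by (rule relpow_Suc_I2)
  qed simp
  then show ?thesis using dst_walk[OF a] dst_le by blast
qed

lemma dst_sym: "u \<in> V \<Longrightarrow> v \<in> V \<Longrightarrow> dst u v = dst v u"
  using dst_sym_le[of u v] dst_sym_le[of v u] by simp

lemma dst_adj: "v \<in> N u \<Longrightarrow> dst u v = 1"
  using dst_le[of u v 1] dst_eq_0[of u v] nbhd_in[of v u] adj_rel_iff[of u v] by simp

lemma dst_1: "u \<in> V \<Longrightarrow> v \<in> V \<Longrightarrow> dst u v = 1 \<Longrightarrow> v \<in> N u"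
  using dst_walk[of u v] adj_rel_iff[of u v] by simp

lemma dst_2:
  assumes "u \<in> V" "v \<in> V" "dst u v = 2"
  shows "\<exists>w. w \<in> N u \<and> v \<in> N w"
  using dst_walk[OF assms(1,2)] unfolding assms(3) by (auto simp: numeral_2_eq_2 adj_rel_iff)

lemma nbhd_nonempty:
  assumes "u \<in> V" "v \<in> V" "u \<noteq> v" shows "N u \<noteq> {}"
proof -
  have "(u, v) \<in> (adj_rel E)\<^sup>*" using conn assms unfolding connected_graph_def by blast
  then show ?thesis using assms(3) by (cases rule: converse_rtranclE) (auto simp: adj_rel_iff)
qed

text \<open>The normalised graph Laplacian; by \<open>lazy_walk_sum\<close> it is the slope in
  \<open>1 - \<alpha>\<close> of an expectation under the lazy walk.\<close>

definition lap :: "('a \<Rightarrow> real) \<Rightarrow> 'a \<Rightarrow> real" where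
  "lap f x = (\<Sum>v\<in>N x. f v - f x) / real (degree E x)"

lemma lazy_walk_sum:
  assumes x: "x \<in> V" "N x \<noteq> {}" and W: "finite W" "insert x (N x) \<subseteq> W"
  shows "(\<Sum>v\<in>W. lazy_walk E \<alpha> x v * f v) = f x + (1 - \<alpha>) * lap f x"
proof -
  have fin: "finite (N x)" and nx: "x \<notin> N x" using finite_nbhd[OF x(1)] nbhd_in by blast+
  have d: "real (degree E x) \<noteq> 0" using fin x(2) unfolding degree_def by simp
  have "(\<Sum>v\<in>W. lazy_walk E \<alpha> x v * f v) = (\<Sum>v\<in>insert x (N x). lazy_walk E \<alpha> x v * f v)"
    using W by (intro sum.mono_neutral_right) (auto simp: lazy_walk_def)
  also have "\<dots> = \<alpha> * f x + (\<Sum>v\<in>N x. lazy_walk E \<alpha> x v * f v)"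
    using fin nx by (simp add: lazy_walk_def)
  also have "(\<Sum>v\<in>N x. lazy_walk E \<alpha> x v * f v) = (\<Sum>v\<in>N x. (1 - \<alpha>) / real (degree E x) * f v)"
    using nx by (intro sum.cong) (auto simp: lazy_walk_def)
  also have "\<dots> = (1 - \<alpha>) * ((\<Sum>v\<in>N x. f v) / real (degree E x))"
    by (simp add: sum_distrib_left sum_divide_distrib)
  also have "(\<Sum>v\<in>N x. f v) / real (degree E x) = lap f x + f x"
    using d unfolding lap_def by (simp add: sum_subtractf diff_divide_distrib degree_def)
  finally show ?thesis by (simp add: algebra_simps)
qed

lemma lazy_walk_01:
  assumes "x \<in> V" "N x \<noteq> {}" "0 \<le> \<alpha>" "\<alpha> \<le> 1"
  shows "0 \<le> lazy_walk E \<alpha> x v" "lazy_walk E \<alpha> x v \<le> 1"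
proof -
  have "1 \<le> real (degree E x)" using finite_nbhd[OF assms(1)] assms(2) unfolding degree_def
    by (simp add: Suc_le_eq card_gt_0_iff)
  then have "(1 - \<alpha>) / real (degree E x) \<le> 1 - \<alpha>" "0 \<le> (1 - \<alpha>) / real (degree E x)"
    using assms(3,4) by (simp_all add: divide_le_eq mult_le_cancel_left1)
  then show "0 \<le> lazy_walk E \<alpha> x v" "lazy_walk E \<alpha> x v \<le> 1"
    using assms(3,4) unfolding lazy_walk_def by (smt (verit))+
qed

text \<open>The independent coupling shows that couplings exist, as \<open>wasserstein_ge\<close>
  demands.\<close>

lemma product_coupling:
  assumes xy: "x \<in> V" "y \<in> V" "x \<noteq> y" and \<alpha>: "0 \<le> \<alpha>" "\<alpha> \<le> 1"
  shows "is_coupling V (lazy_walk E \<alpha> x) (lazy_walk E \<alpha> y) (\<lambda>(u, v). lazy_walk E \<alpha> x u * lazy_walk E \<alpha> y v)"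
    (is "is_coupling V ?m ?n ?A")
    and "transport_cost V E (\<lambda>(u, v). lazy_walk E \<alpha> x u * lazy_walk E \<alpha> y v)
      = (\<Sum>u\<in>insert x (N x) \<union> insert y (N y). \<Sum>v\<in>insert x (N x) \<union> insert y (N y).
          lazy_walk E \<alpha> x u * lazy_walk E \<alpha> y v * real (dst u v))"
proof -
  let ?U = "insert x (N x) \<union> insert y (N y)"
  have nx: "N x \<noteq> {}" "N y \<noteq> {}" using nbhd_nonempty[of x y] nbhd_nonempty[of y x] xy by auto
  have U: "finite ?U" "?U \<subseteq> V" using finite_nbhd xy nbhd_subset by auto
  have sub: "insert x (N x) \<subseteq> ?U" "insert y (N y) \<subseteq> ?U" by blast+
  have s: "(\<Sum>u\<in>?U. ?m u) = 1" "(\<Sum>u\<in>?U. ?n u) = 1"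
    using lazy_walk_sum[OF xy(1) nx(1) U(1) sub(1), of \<alpha> "\<lambda>_. 1"]
      lazy_walk_sum[OF xy(2) nx(2) U(1) sub(2), of \<alpha> "\<lambda>_. 1"]
    by (simp_all add: lap_def)
  note nn = lazy_walk_01[OF xy(1) nx(1) \<alpha>] lazy_walk_01[OF xy(2) nx(2) \<alpha>]
  have z: "?A p = 0" if "p \<notin> ?U \<times> ?U" for p
    using that by (cases p) (auto simp: lazy_walk_def)
  have r: "?m u = (\<Sum>v\<in>?U. ?A (u, v))" for u using s(2) by (simp add: sum_distrib_left[symmetric])
  have l: "?n v = (\<Sum>u\<in>?U. ?A (u, v))" for v using s(1) by (simp add: sum_distrib_right[symmetric])
  have p: "0 \<le> ?A (u, v)" for u v using nn by simp
  note c = couplingI_finite[OF U z p r l nn(2)]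
  show "is_coupling V ?m ?n ?A" by (rule c(1))
  show "transport_cost V E ?A = (\<Sum>u\<in>?U. \<Sum>v\<in>?U. ?m u * ?n v * real (dst u v))"
    using c(2) by simp
qed

lemma wasserstein_ge_Lipschitz:
  assumes xy: "x \<in> V" "y \<in> V" "x \<noteq> y" and \<alpha>: "0 \<le> \<alpha>" "\<alpha> \<le> 1"
    and f: "\<And>u v. u \<in> V \<Longrightarrow> v \<in> V \<Longrightarrow> f v - f u \<le> real (dst u v)"
  shows "f y - f x + (1 - \<alpha>) * (lap f y - lap f x)
    \<le> wasserstein V E (lazy_walk E \<alpha> x) (lazy_walk E \<alpha> y)"
proof (rule wasserstein_ge[OF product_coupling(1)[OF xy \<alpha>]])
  fix A assume A: "is_coupling V (lazy_walk E \<alpha> x) (lazy_walk E \<alpha> y) A"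
  let ?U = "insert x (N x) \<union> insert y (N y)"
  have nx: "N x \<noteq> {}" "N y \<noteq> {}" using nbhd_nonempty[of x y] nbhd_nonempty[of y x] xy by auto
  have U: "finite ?U" "?U \<subseteq> V" using finite_nbhd xy nbhd_subset by auto
  have "lazy_walk E \<alpha> x v = 0 \<and> lazy_walk E \<alpha> y v = 0" if "v \<in> V - ?U" for v
    using that by (auto simp: lazy_walk_def)
  from transport_cost_ge_Lipschitz[OF A f U this]
  have "(\<Sum>v\<in>?U. lazy_walk E \<alpha> y v * f v) - (\<Sum>v\<in>?U. lazy_walk E \<alpha> x v * f v) \<le> transport_cost V E A" by blast
  moreover have sub: "insert x (N x) \<subseteq> ?U" "insert y (N y) \<subseteq> ?U" by blast+
  ultimately show "f y - f x + (1 - \<alpha>) * (lap f y - lap f x) \<le> transport_cost V E A"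
    unfolding lazy_walk_sum[OF xy(1) nx(1) U(1) sub(1)] lazy_walk_sum[OF xy(2) nx(2) U(1) sub(2)]
    by (simp add: algebra_simps)
qed

text \<open>Mixing a coupling of the walks with idleness \<open>\<alpha>\<close> with the point coupling at \<open>(x, y)\<close> gives one
  of the walks with idleness \<open>\<beta> \<ge> \<alpha>\<close>; hence \<open>\<kappa>\<^sub>\<alpha> / (1 - \<alpha>)\<close> is nondecreasing and its limit is the supremum.\<close>

lemma lazy_walk_mix:
  assumes "\<alpha> < 1" "t = (1 - \<beta>) / (1 - \<alpha>)"
  shows "lazy_walk E \<beta> x = (\<lambda>v. t * lazy_walk E \<alpha> x v + (1 - t) * (if v = x then 1 else 0))"
proof
  fix v
  have t: "t * (1 - \<alpha>) = 1 - \<beta>" using assms by simp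
  then have "t * \<alpha> + (1 - t) = \<beta>" by (simp add: algebra_simps)
  moreover have "t * ((1 - \<alpha>) / d) = (1 - \<beta>) / d" for d using t by (metis times_divide_eq_right)
  ultimately show "lazy_walk E \<beta> x v = t * lazy_walk E \<alpha> x v + (1 - t) * (if v = x then 1 else 0)"
    unfolding lazy_walk_def using t by simp
qed

lemma scaled_curvature_mono:
  assumes xy: "x \<in> V" "y \<in> V" "x \<noteq> y" and \<alpha>: "0 \<le> \<alpha>" "\<alpha> \<le> \<beta>" "\<beta> < 1"
  shows "lazy_curvature V E \<alpha> x y / (1 - \<alpha>) \<le> lazy_curvature V E \<beta> x y / (1 - \<beta>)"
proof -
  define t where "t = (1 - \<beta>) / (1 - \<alpha>)"
  have t: "0 < t" "t \<le> 1" using \<alpha> unfolding t_def by simp_all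
  have a1: "\<alpha> < 1" "\<alpha> \<le> 1" using \<alpha> by simp_all
  let ?W = "\<lambda>\<alpha>. wasserstein V E (lazy_walk E \<alpha> x) (lazy_walk E \<alpha> y)"
  have d: "0 < real (dst x y)" using dst_eq_0[OF xy(1,2)] xy(3) by simp
  have "(?W \<beta> - (1 - t) * real (dst x y)) / t \<le> ?W \<alpha>"
  proof (rule wasserstein_ge[OF product_coupling(1)[OF xy \<alpha>(1) a1(2)]])
    fix A assume A: "is_coupling V (lazy_walk E \<alpha> x) (lazy_walk E \<alpha> y) A"
    note m = coupling_mix[OF A coupling_point(1)[OF xy(1,2)] less_imp_le[OF t(1)] t(2)]
    have "?W \<beta> \<le> t * transport_cost V E A + (1 - t) * real (dst x y)"
      using wasserstein_le[OF m(1), of E] m(2)[of E] coupling_point(2)[OF xy(1,2), of E]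
        lazy_walk_mix[OF a1(1) t_def] by simp
    then show "(?W \<beta> - (1 - t) * real (dst x y)) / t \<le> transport_cost V E A"
      using t by (simp add: divide_le_eq mult.commute)
  qed
  then have "?W \<beta> \<le> t * ?W \<alpha> + (1 - t) * real (dst x y)"
    using t by (simp add: divide_le_eq mult.commute)
  then have "?W \<beta> / real (dst x y) \<le> (t * ?W \<alpha> + (1 - t) * real (dst x y)) / real (dst x y)"
    using d by (intro divide_right_mono) auto
  also have "\<dots> = t * (?W \<alpha> / real (dst x y)) + (1 - t)" using d by (simp add: add_divide_distrib)
  finally have "t * lazy_curvature V E \<alpha> x y \<le> lazy_curvature V E \<beta> x y"
    unfolding lazy_curvature_def by (simp add: algebra_simps)
  then show ?thesis using \<alpha> unfolding t_def by (simp add: field_simps)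
qed

text \<open>When \<open>f\<close> attains the distance, the factor \<open>1 - \<alpha>\<close>
  splits off the duality bound and cancels, so the right side does not depend on
  \<open>\<alpha>\<close>.\<close>

lemma scaled_curvature_le:
  assumes xy: "x \<in> V" "y \<in> V" "x \<noteq> y" and \<alpha>: "0 \<le> \<alpha>" "\<alpha> < 1"
    and f: "\<And>u v. u \<in> V \<Longrightarrow> v \<in> V \<Longrightarrow> f v - f u \<le> real (dst u v)" "f y - f x = real (dst x y)"
  shows "lazy_curvature V E \<alpha> x y / (1 - \<alpha>) \<le> (lap f x - lap f y) / real (dst x y)"
proof -
  have d: "0 < real (dst x y)" using dst_eq_0[OF xy(1,2)] xy(3) by simp
  let ?W = "wasserstein V E (lazy_walk E \<alpha> x) (lazy_walk E \<alpha> y)"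
  have "real (dst x y) + (1 - \<alpha>) * (lap f y - lap f x) \<le> ?W"
    using wasserstein_ge_Lipschitz[OF xy \<alpha>(1) less_imp_le[OF \<alpha>(2)] f(1)] f(2) by simp
  then have "(real (dst x y) + (1 - \<alpha>) * (lap f y - lap f x)) / real (dst x y) \<le> ?W / real (dst x y)"
    using d by (intro divide_right_mono) auto
  then have "lazy_curvature V E \<alpha> x y \<le> (1 - \<alpha>) * ((lap f x - lap f y) / real (dst x y))"
    using d unfolding lazy_curvature_def by (simp add: field_simps)
  then show ?thesis using \<alpha> by (simp add: divide_le_eq mult.commute)
qed

lemma lly_curvature_bounds:
  assumes xy: "x \<in> V" "y \<in> V" "x \<noteq> y"
  shows "0 \<le> \<alpha> \<Longrightarrow> \<alpha> < 1 \<Longrightarrow> lazy_curvature V E \<alpha> x y / (1 - \<alpha>) \<le> lly_curvature V E x y"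
    and "(\<And>\<alpha>. 0 \<le> \<alpha> \<Longrightarrow> \<alpha> < 1 \<Longrightarrow> lazy_curvature V E \<alpha> x y / (1 - \<alpha>) \<le> B) \<Longrightarrow> lly_curvature V E x y \<le> B"
proof -
  define h where "h \<alpha> = lazy_curvature V E \<alpha> x y / (1 - \<alpha>)" for \<alpha>
  \<comment> \<open>The distance from \<open>x\<close> is an admissible test function; it shows that
    the quotients have a finite supremum \<open>L\<close>.\<close>
  define f where "f v = real (dst x v)" for v
  have "f v - f u \<le> real (dst u v)" if "u \<in> V" "v \<in> V" for u v
    using dst_triangle[OF xy(1) that] unfolding f_def by simp
  moreover have "f y - f x = real (dst x y)" unfolding f_def by simp
  ultimately have bound: "h \<alpha> \<le> (lap f x - lap f y) / real (dst x y)" if "0 \<le> \<alpha>" "\<alpha> < 1" for \<alpha>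
    unfolding h_def using scaled_curvature_le[OF xy that, of f] by blast
  then have bdd: "bdd_above (h ` {0..<1})" by (intro bdd_aboveI2) auto
  define L where "L = Sup (h ` {0..<1})"
  have le: "h \<alpha> \<le> L" if "0 \<le> \<alpha>" "\<alpha> < 1" for \<alpha>
    unfolding L_def using that bdd by (intro cSup_upper) auto
  have "(h \<longlongrightarrow> L) (at_left 1)"
  proof (rule order_tendstoI)
    fix a assume "a < L"
    then obtain \<alpha> where \<alpha>: "0 \<le> \<alpha>" "\<alpha> < 1" "a < h \<alpha>"
      unfolding L_def using less_cSup_iff[of "h ` {0..<1}" a] bdd by auto
    have "\<forall>\<^sub>F \<beta> in at_left 1. \<beta> \<in> {\<alpha><..<1}" using eventually_at_left_real[OF \<alpha>(2)] .
    then show "\<forall>\<^sub>F \<beta> in at_left 1. a < h \<beta>"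
    proof eventually_elim
      case (elim \<beta>)
      then have "h \<alpha> \<le> h \<beta>" unfolding h_def using \<alpha>(1) by (intro scaled_curvature_mono[OF xy]) auto
      then show ?case using \<alpha>(3) by simp
    qed
  next
    fix a assume a: "L < a"
    have "\<forall>\<^sub>F \<beta> :: real in at_left 1. \<beta> \<in> {0<..<1}" by (rule eventually_at_left_real) simp
    then show "\<forall>\<^sub>F \<beta> in at_left 1. h \<beta> < a"
    proof eventually_elim
      case (elim \<beta>)
      then show ?case using le[of \<beta>] a by simp
    qed
  qed
  then have L: "lly_curvature V E x y = L"
    unfolding lly_curvature_def h_def by (intro tendsto_Lim) (simp add: trivial_limit_at_left_real)
  show "lazy_curvature V E \<alpha> x y / (1 - \<alpha>) \<le> lly_curvature V E x y" if "0 \<le> \<alpha>" "\<alpha> < 1"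
    using le[OF that] unfolding L h_def .
  show "lly_curvature V E x y \<le> B"
    if "\<And>\<alpha>. 0 \<le> \<alpha> \<Longrightarrow> \<alpha> < 1 \<Longrightarrow> lazy_curvature V E \<alpha> x y / (1 - \<alpha>) \<le> B"
    unfolding L L_def using that by (intro cSup_least) (auto simp: h_def)
qed

lemma lly_curvature_le:
  assumes "x \<in> V" "y \<in> V" "x \<noteq> y"
    and "\<And>u v. u \<in> V \<Longrightarrow> v \<in> V \<Longrightarrow> f v - f u \<le> real (dst u v)" "f y - f x = real (dst x y)"
  shows "lly_curvature V E x y \<le> (lap f x - lap f y) / real (dst x y)"
  using scaled_curvature_le[OF assms(1-3) _ _ assms(4,5)] lly_curvature_bounds(2)[OF assms(1-3)] by blast

lemma lly_curvature_pos:
  assumes "x \<in> V" "y \<in> V" "x \<noteq> y" "0 \<le> \<alpha>" "\<alpha> < 1"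
    and "is_coupling V (lazy_walk E \<alpha> x) (lazy_walk E \<alpha> y) A" "transport_cost V E A < real (dst x y)"
  shows "0 < lly_curvature V E x y"
proof -
  have d: "0 < real (dst x y)" using dst_eq_0[OF assms(1,2)] assms(3) by simp
  have "wasserstein V E (lazy_walk E \<alpha> x) (lazy_walk E \<alpha> y) < real (dst x y)"
    using wasserstein_le[OF assms(6), of E] assms(7) by simp
  then have "0 < lazy_curvature V E \<alpha> x y" unfolding lazy_curvature_def using d by simp
  then have "0 < lazy_curvature V E \<alpha> x y / (1 - \<alpha>)" using assms(5) by simp
  then show ?thesis using lly_curvature_bounds(1)[OF assms(1-5)] by simp
qed

text \<open>McShane's extension, the minimum of \<open>g s + dst s v\<close> over \<open>s\<close>
  in \<open>S\<close>. Integer values suffice for the later test functions and keep the inequalities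
  for degrees in the integers.\<close>

lemma Lipschitz_extension:
  fixes g :: "'a \<Rightarrow> int"
  assumes S: "finite S" "S \<noteq> {}" "S \<subseteq> V" and g: "\<And>u v. u \<in> S \<Longrightarrow> v \<in> S \<Longrightarrow> g v - g u \<le> int (dst u v)"
  obtains f :: "'a \<Rightarrow> real" where "\<And>u v. u \<in> V \<Longrightarrow> v \<in> V \<Longrightarrow> f v - f u \<le> real (dst u v)"
    "\<And>v. v \<in> S \<Longrightarrow> f v = of_int (g v)"
proof -
  define F where "F v = Min ((\<lambda>s. g s + int (dst s v)) ` S)" for v
  have fin: "finite ((\<lambda>s. g s + int (dst s v)) ` S)" "(\<lambda>s. g s + int (dst s v)) ` S \<noteq> {}" for v
    using S by auto
  have L: "F v - F u \<le> int (dst u v)" if "u \<in> V" "v \<in> V" for u v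
  proof -
    obtain s where s: "s \<in> S" "F u = g s + int (dst s u)"
      using Min_in[OF fin[of u]] unfolding F_def by blast
    have "F v \<le> g s + int (dst s v)" unfolding F_def using s(1) fin(1) by (intro Min_le) auto
    also have "\<dots> \<le> g s + int (dst s u) + int (dst u v)"
      using dst_triangle[of s u v] s(1) S(3) that by auto
    finally show ?thesis using s(2) by simp
  qed
  have eq: "F v = g v" if "v \<in> S" for v
  proof (rule antisym)
    have "F v \<le> g v + int (dst v v)" unfolding F_def using that by (intro Min_le[OF fin(1)] imageI)
    then show "F v \<le> g v" by simp
    have "g v \<le> a" if a: "a \<in> (\<lambda>s. g s + int (dst s v)) ` S" for a
    proof -
      obtain s where "s \<in> S" "a = g s + int (dst s v)" using a by blast
      then show ?thesis using g[of s v] \<open>v \<in> S\<close> by simp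
    qed
    then show "g v \<le> F v" unfolding F_def using fin[of v] by (intro Min.boundedI) auto
  qed
  have "real_of_int (F v) - real_of_int (F u) \<le> real (dst u v)" if "u \<in> V" "v \<in> V" for u v
  proof -
    have "real_of_int (F v - F u) \<le> real_of_int (int (dst u v))"
      using L[OF that] by (simp only: of_int_le_iff)
    then show ?thesis by simp
  qed
  then show ?thesis using that[of "\<lambda>v. real_of_int (F v)"] eq by simp
qed

text \<open>Only values on \<open>N x \<union> N y\<close> enter the two Laplacians, and this set
  contains \<open>x\<close> and \<open>y\<close> themselves. Both denominators are cleared to obtain
  an integer inequality.\<close>

lemma positive_edge:
  fixes g :: "'a \<Rightarrow> int"
  assumes e: "y \<in> N x" and pos: "0 < lly_curvature V E x y"
    and g: "\<And>u v. u \<in> N x \<union> N y \<Longrightarrow> v \<in> N x \<union> N y \<Longrightarrow> g v - g u \<le> int (dst u v)" "g x = 0" "g y = 1"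
  shows "0 < int (degree E y) * (\<Sum>v\<in>N x. g v) - int (degree E x) * (\<Sum>v\<in>N y. g v - 1)"
proof -
  have xy: "x \<in> V" "y \<in> V" "x \<noteq> y" "x \<in> N y" using e nbhd_in[OF e] nbhd_sym by auto
  have S: "finite (N x \<union> N y)" "N x \<union> N y \<noteq> {}" "N x \<union> N y \<subseteq> V"
    using finite_nbhd xy e nbhd_subset by auto
  obtain f :: "'a \<Rightarrow> real" where f: "\<And>u v. u \<in> V \<Longrightarrow> v \<in> V \<Longrightarrow> f v - f u \<le> real (dst u v)"
    "\<And>v. v \<in> N x \<union> N y \<Longrightarrow> f v = of_int (g v)"
    using Lipschitz_extension[OF S g(1)] by blast
  have fxy: "f x = 0" "f y = 1" using f(2)[of x] f(2)[of y] e xy(4) g(2,3) by auto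
  have "lly_curvature V E x y \<le> (lap f x - lap f y) / real (dst x y)"
    using fxy dst_adj[OF e] by (intro lly_curvature_le[OF xy(1-3) f(1)]) auto
  then have p: "0 < lap f x - lap f y" using pos dst_adj[OF e] by simp
  have d: "0 < real (degree E x)" "0 < real (degree E y)"
    using finite_nbhd xy e unfolding degree_def by (auto simp: card_gt_0_iff)
  have lx: "lap f x = real_of_int (\<Sum>v\<in>N x. g v) / real (degree E x)"
    unfolding lap_def using f(2) fxy by simp
  have ly: "lap f y = real_of_int (\<Sum>v\<in>N y. g v - 1) / real (degree E y)"
    unfolding lap_def using f(2) fxy by simp
  have "0 < real (degree E y) * real_of_int (\<Sum>v\<in>N x. g v) - real (degree E x) * real_of_int (\<Sum>v\<in>N y. g v - 1)"
    using p d unfolding lx ly by (simp add: field_simps)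
  also have "\<dots> = real_of_int (int (degree E y) * (\<Sum>v\<in>N x. g v) - int (degree E x) * (\<Sum>v\<in>N y. g v - 1))"
    by simp
  finally show ?thesis by (simp only: of_int_0_less_iff)
qed

end

section \<open>From graphs to polygons\<close>

lemma cyc_nth_eq_iff:
  assumes "distinct xs" "xs \<noteq> []"
  shows "cyc_nth xs i = cyc_nth xs j \<longleftrightarrow> i mod int (length xs) = j mod int (length xs)"
proof -
  have n: "0 < int (length xs)" using assms(2) by simp
  then have "0 \<le> k mod int (length xs)" "nat (k mod int (length xs)) < length xs" for k
    by (simp_all add: nat_less_iff)
  then show ?thesis unfolding cyc_nth_def using nth_eq_iff_index_eq[OF assms(1)] eq_nat_nat_iff by metis
qed

lemma bij_cyc_nth:
  assumes "distinct xs" "xs \<noteq> []"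
  shows "bij_betw (cyc_nth xs) {s..<s + int (length xs)} (set xs)"
proof -
  let ?n = "int (length xs)"
  have n: "0 < ?n" using assms(2) by simp
  have inj: "inj_on (cyc_nth xs) {s..<s + ?n}"
  proof (rule inj_onI)
    fix i j assume ij: "i \<in> {s..<s + ?n}" "j \<in> {s..<s + ?n}" "cyc_nth xs i = cyc_nth xs j"
    then have "?n dvd i - j" using cyc_nth_eq_iff[OF assms] mod_eq_dvd_iff by metis
    moreover have "\<bar>i - j\<bar> < ?n" using ij by auto
    ultimately show "i = j" using zdvd_imp_le[of ?n "\<bar>i - j\<bar>"] by (cases "i = j") auto
  qed
  have "cyc_nth xs ` {s..<s + ?n} \<subseteq> set xs"
    using n unfolding cyc_nth_def by (auto intro!: nth_mem simp: nat_less_iff)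
  moreover have "card (cyc_nth xs ` {s..<s + ?n}) = card (set xs)"
    using card_image[OF inj] distinct_card[OF assms(1)] by simp
  ultimately have "cyc_nth xs ` {s..<s + ?n} = set xs" by (intro card_subset_eq) auto
  then show ?thesis using inj unfolding bij_betw_def by blast
qed

context connected_lf_graph
begin

text \<open>The assignments on the two sides are glued to one Lipschitz function on the neighbours
  of the ends, to which \<open>positive_edge\<close> applies. Assumption \<open>deep\<close>
  confines all walks relevant for its Lipschitz condition to the cycle.\<close>

lemma edge_curved:
  fixes xs :: "'a list"
  defines "n \<equiv> int (length xs)" and "c \<equiv> cyc_nth xs"
  defines "R \<equiv> \<lambda>i j. {c i, c j} \<in> E"
  assumes op: "outerplanar V E" and xs: "cycle V E xs"
    and deep: "N (c i) \<subseteq> set xs" "\<And>u. u \<in> N (c i) \<Longrightarrow> N u \<subseteq> set xs"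
    and ij: "i < j" "j < i + n" "R i j" and pos: "0 < lly_curvature V E (c i) (c j)"
  shows "int (degree E (c i)) = cyc_degree n R i" "curved_edge n R i j"
proof -
  interpret polygon n R
    unfolding n_def R_def c_def by (rule cycle_polygon[OF simple op xs])
  have xs': "distinct xs" "xs \<noteq> []" using xs unfolding cycle_def by auto
  have bij: "bij_betw c {s..<s+n} (set xs)" for s
    unfolding c_def n_def by (rule bij_cyc_nth[OF xs'])
  have inj: "inj_on c {s..<s+n}" for s using bij[of s] by (rule bij_betw_imp_inj_on)
  have R_iff: "R a b \<longleftrightarrow> c b \<in> N (c a)" for a b unfolding R_def nbhd_def by simp
  have nb: "N (c a) = c ` {k\<in>{s..<s+n}. R a k}" if sub: "N (c a) \<subseteq> set xs" for a s
  proof -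
    have xsc: "set xs = c ` {s..<s+n}" using bij[of s] by (simp add: bij_betw_def)
    show ?thesis
    proof
      show "N (c a) \<subseteq> c ` {k\<in>{s..<s+n}. R a k}"
      proof
        fix v assume v: "v \<in> N (c a)"
        then obtain k where "k \<in> {s..<s+n}" "v = c k" using sub xsc by blast
        then show "v \<in> c ` {k\<in>{s..<s+n}. R a k}" using v R_iff by simp
      qed
    qed (auto simp: R_iff)
  qed
  have degree: "int (degree E (c a)) = deg a" if "N (c a) \<subseteq> set xs" for a
  proof -
    have "card (N (c a)) = card {k\<in>{0..<0+n}. R a k}"
      unfolding nb[OF that, of 0] by (rule card_image) (rule inj_on_subset[OF inj], auto)
    then show ?thesis unfolding degree_def using deg_window[of a 0] by simp
  qed
  show "int (degree E (c i)) = cyc_degree n R i" by (rule degree[OF deep(1)])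
  have cji: "c j \<in> N (c i)" using ij(3) R_iff by blast
  have Nj: "N (c j) \<subseteq> set xs" by (rule deep(2)[OF cji])
  have Rji: "R j i" using ij(3) sym by blast
  show "curved_edge n R i j"
    unfolding curved_edge_def
  proof (intro allI impI)
    fix k1 l1 k2 l2
    assume "gain i j k1 l1" "gain j (i + n) l2 k2"
    then obtain g1 g2 where g1: "gain_map R i j g1"
        "(\<Sum>u\<in>{u\<in>{i<..<j}. R i u}. g1 u + 1) \<le> k1" "(\<Sum>u\<in>{u\<in>{i<..<j}. R u j}. 2 - g1 u) \<le> l1"
      and g2: "gain_map R j (i + n) g2"
        "(\<Sum>u\<in>{u\<in>{j<..<i+n}. R j u}. g2 u + 1) \<le> l2" "(\<Sum>u\<in>{u\<in>{j<..<i+n}. R u (i + n)}. 2 - g2 u) \<le> k2"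
      unfolding side_gain_def by blast
    \<comment> \<open>On the far side \<open>j\<close> is the first end and \<open>i + n\<close> the
      second, so the values 0 and 1 are exchanged by passing to \<open>1 - g2\<close>.\<close>
    define G where "G k = (if k = i then 0 else if k = j then 1 else if k < j then g1 k else 1 - g2 k)" for k
    have part: "k = i \<or> k = j \<or> k \<in> {i<..<j} \<or> k \<in> {j<..<i+n}" if "k \<in> {i..<i+n}" for k
      using that by auto
    have Rin: "R u (i + n) \<longleftrightarrow> R i u" for u using periodic2[of u i] sym[of u i] by simp
    have Gi: "- 1 \<le> G k \<and> G k \<le> 1" if k: "k \<in> {i..<i+n}" "R i k" for k
    proof -
      consider "k = i" | "k = j" | "k \<in> {i<..<j}" | "k \<in> {j<..<i+n}" using part[OF k(1)] by blast
      then show ?thesis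
      proof cases
        case 3 then show ?thesis using g1(1) that(2) unfolding gain_map_def G_def by simp
      next
        case 4
        then have "0 \<le> g2 k \<and> g2 k \<le> 2" using g2(1) that(2) Rin[of k] unfolding gain_map_def by blast
        then show ?thesis using 4 ij unfolding G_def by simp
      qed (simp_all add: G_def)
    qed
    have Gj: "0 \<le> G k \<and> G k \<le> 2" if k: "k \<in> {i..<i+n}" "R j k" for k
    proof -
      consider "k = i" | "k = j" | "k \<in> {i<..<j}" | "k \<in> {j<..<i+n}" using part[OF k(1)] by blast
      then show ?thesis
      proof cases
        case 3 then show ?thesis using g1(1) that(2) sym[of j k] unfolding gain_map_def G_def by simp
      next
        case 4
        then have "- 1 \<le> g2 k \<and> g2 k \<le> 1" using g2(1) that(2) unfolding gain_map_def by blast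
        then show ?thesis using 4 ij unfolding G_def by simp
      qed (simp_all add: G_def)
    qed
    \<comment> \<open>The edge \<open>i j\<close> separates its two sides: no edge joins their inner
      vertices, so the Lipschitz condition can be checked on each side alone.\<close>
    have nocross: "\<not> R u w" if "u \<in> {i<..<j}" "w \<in> {j<..<i+n}" for u w
      using noncrossing[of i u j w] that ij(3) by auto
    have nocross': "\<not> R w u" if "u \<in> {i<..<j}" "w \<in> {j<..<i+n}" for u w
      using nocross[OF that] sym by blast
    have adj: "G w - G u \<le> 1"
      if u: "u \<in> {i..<i+n}" "R i u \<or> R j u" and w: "w \<in> {i..<i+n}" "R i w \<or> R j w" and uw: "R u w" for u w
    proof -
      have RR: "R a b" if "R b a" for a b using that sym by blast
      consider "u = i" | "u = j" | "w = i" | "w = j" | "u \<in> {i<..<j}" "w \<in> {i<..<j}"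
        | "u \<in> {i<..<j}" "w \<in> {j<..<i+n}" | "u \<in> {j<..<i+n}" "w \<in> {i<..<j}"
        | "u \<in> {j<..<i+n}" "w \<in> {j<..<i+n}" using part[OF u(1)] part[OF w(1)] by blast
      then show ?thesis
      proof cases
        case 1 then show ?thesis using Gi[OF w(1)] uw by (simp add: G_def)
      next
        case 2 then show ?thesis using Gj[OF w(1)] uw ij by (simp add: G_def)
      next
        case 3 then show ?thesis using Gi[OF u(1)] RR[OF uw] by (simp add: G_def)
      next
        case 4 then show ?thesis using Gj[OF u(1)] RR[OF uw] ij by (simp add: G_def)
      next
        case 5
        have "R i u \<or> R u j" "R i w \<or> R w j" using u(2) w(2) RR by blast+
        then have "g1 w - g1 u \<le> 1" using g1(1) 5 uw unfolding gain_map_def by blast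
        then show ?thesis using 5 by (simp add: G_def)
      next
        case 6 then show ?thesis using nocross uw by blast
      next
        case 7 then show ?thesis using nocross' uw by blast
      next
        case 8
        have "R j u \<or> R u (i + n)" "R j w \<or> R w (i + n)" using u(2) w(2) Rin by blast+
        then have "g2 u - g2 w \<le> 1" using g2(1) 8 RR[OF uw] unfolding gain_map_def by blast
        then show ?thesis using 8 ij by (simp add: G_def)
      qed
    qed
    \<comment> \<open>A difference of 3 occurs only between the value -1 at a neighbour of
      \<open>i\<close> and the value 2 at a neighbour of \<open>j\<close>; a walk of length 2
      between them is what the last clause of \<open>gain_map\<close> excludes.\<close>
    have two: "False"
      if u: "u \<in> {i..<i+n}" "R i u \<or> R j u" and w: "w \<in> {i..<i+n}" "R i w \<or> R j w" and t: "t \<in> {i..<i+n}"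
        and r: "R u t" "R t w" and G: "G u < 0" "1 < G w" for u w t
    proof -
      have RR: "R a b" if "R b a" for a b using that sym by blast
      have u': "R i u" "\<not> R j u" "u \<noteq> i" "u \<noteq> j" using Gj[OF u(1)] u(2) G ij by (auto simp: G_def)
      have w': "R j w" "\<not> R i w" "w \<noteq> i" "w \<noteq> j" using Gi[OF w(1)] w(2) G ij by (auto simp: G_def)
      have t': "t \<noteq> i" "t \<noteq> j" using w' u' r RR by blast+
      consider "u \<in> {i<..<j}" | "u \<in> {j<..<i+n}" using part[OF u(1)] u' by blast
      then show False
      proof cases
        case 1
        have t1: "t \<in> {i<..<j}" using nocross[OF 1, of t] t t' r(1) by force
        have w1: "w \<in> {i<..<j}" using nocross[OF t1, of w] w(1) w' r(2) by force
        have "g1 w - g1 u \<le> 2"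
          using g1(1) 1 t1 w1 u'(1) r RR[OF w'(1)] unfolding gain_map_def by blast
        then show False using G 1 w1 by (simp add: G_def)
      next
        case 2
        have t1: "t \<in> {j<..<i+n}" using nocross'[of t u] 2 t t' r(1) by force
        have w1: "w \<in> {j<..<i+n}" using nocross'[of w t] t1 w(1) w' r(2) by force
        have "R u (i + n)" using u'(1) Rin by blast
        then have "g2 u - g2 w \<le> 2"
          using g2(1) 2 t1 w1 w'(1) RR[OF r(1)] RR[OF r(2)] unfolding gain_map_def by blast
        then show False using G 2 w1 ij by (simp add: G_def)
      qed
    qed
    define idx where "idx = the_inv_into {i..<i+n} c"
    have idx: "idx (c k) = k" if "k \<in> {i..<i+n}" for k
      unfolding idx_def by (rule the_inv_into_f_f[OF inj that])
    define g where "g v = G (idx v)" for v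
    have gc: "g (c k) = G k" if "k \<in> {i..<i+n}" for k unfolding g_def using idx[OF that] by simp
    have ii: "i \<in> {i..<i+n}" "j \<in> {i..<i+n}" using ij n3 by auto
    have mem: "\<exists>k\<in>{i..<i+n}. v = c k \<and> (R i k \<or> R j k)" if "v \<in> N (c i) \<union> N (c j)" for v
      using that nb[OF deep(1), of i] nb[OF Nj, of i] by blast
    have "0 < int (degree E (c j)) * (\<Sum>v\<in>N (c i). g v) - int (degree E (c i)) * (\<Sum>v\<in>N (c j). g v - 1)"
    proof (rule positive_edge[OF cji pos])
      show "g (c i) = 0" "g (c j) = 1" using gc ii ij by (simp_all add: G_def)
      fix u' w' assume u': "u' \<in> N (c i) \<union> N (c j)" and w': "w' \<in> N (c i) \<union> N (c j)"
      obtain u where u: "u \<in> {i..<i+n}" "u' = c u" "R i u \<or> R j u" using mem[OF u'] by blast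
      obtain w where w: "w \<in> {i..<i+n}" "w' = c w" "R i w \<or> R j w" using mem[OF w'] by blast
      have V: "u' \<in> V" "w' \<in> V" using u' w' nbhd_subset by blast+
      have bnd: "- 1 \<le> G k" "G k \<le> 2" if "k \<in> {i..<i+n}" "R i k \<or> R j k" for k
        using Gi[OF that(1)] Gj[OF that(1)] that(2) by auto
      have "G w - G u \<le> int (dst u' w')"
      proof (rule ccontr)
        assume less: "\<not> G w - G u \<le> int (dst u' w')"
        then have "dst u' w' < 3" using bnd[OF u(1,3)] bnd[OF w(1,3)] by linarith
        then consider "dst u' w' = 0" | "dst u' w' = 1" | "dst u' w' = 2" by linarith
        then show False
        proof cases
          case 1
          then have "c u = c w" using dst_eq_0[OF V] u w by simp
          then have "u = w" using idx[OF u(1)] idx[OF w(1)] by metis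
          then show False using less by simp
        next
          case 2
          then have "R u w" using dst_1[OF V] u w R_iff by simp
          then show False using adj[OF u(1,3) w(1,3)] less 2 by simp
        next
          case 3
          then have G: "G u < 0" "1 < G w" using less bnd[OF u(1,3)] bnd[OF w(1,3)] by linarith+
          obtain t' where t': "t' \<in> N u'" "w' \<in> N t'" using dst_2[OF V 3] by blast
          have "R i u" using Gj[OF u(1)] u(3) G by auto
          \<comment> \<open>Since \<open>u\<close> is a neighbour of \<open>i\<close>, the middle
            vertex of the walk also lies on the cycle.\<close>
          then have "N u' \<subseteq> set xs" using deep(2) u(2) R_iff by blast
          then obtain t where t: "t \<in> {i..<i+n}" "t' = c t"
            using t'(1) bij[of i] by (metis bij_betw_imp_surj_on imageE subsetD)
          then have "R u t" "R t w" using t' u w R_iff by simp_all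
          then show False using two[OF u(1,3) w(1,3) t(1)] G by blast
        qed
      qed
      then show "g w' - g u' \<le> int (dst u' w')" using gc[OF u(1)] gc[OF w(1)] u(2) w(2) by simp
    qed
    moreover have "(\<Sum>v\<in>N (c i). g v) \<le> 2 + k1 + k2 - deg i"
    proof -
      let ?X = "{k\<in>{i..<i+n}. R i k}" and ?A = "{u\<in>{i<..<j}. R i u}" and ?B = "{u\<in>{j<..<i+n}. R u (i + n)}"
      have X: "?X = insert j (?A \<union> ?B)"
      proof (intro equalityI subsetI)
        fix k assume "k \<in> ?X"
        then have k: "k \<in> {i..<i+n}" "R i k" by blast+
        then have "k \<noteq> i" using irrefl by metis
        then show "k \<in> insert j (?A \<union> ?B)" using part[OF k(1)] k(2) Rin[of k] by blast
      next
        fix k assume k: "k \<in> insert j (?A \<union> ?B)"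
        then have "R i k" using ij(3) Rin[of k] by blast
        moreover have "k \<in> {i..<i+n}" using k ij(1,2) by auto
        ultimately show "k \<in> ?X" by blast
      qed
      have "(\<Sum>v\<in>N (c i). g v) = (\<Sum>k\<in>?X. g (c k))"
        unfolding nb[OF deep(1), of i] by (rule sum.reindex_cong[of c]) (auto intro: inj_on_subset[OF inj])
      also have "\<dots> = (\<Sum>k\<in>?X. (G k + 1) - 1)" using gc by (intro sum.cong) auto
      also have "\<dots> = (\<Sum>k\<in>?X. G k + 1) - int (card ?X)" unfolding sum_subtractf by simp
      also have "(\<Sum>k\<in>?X. G k + 1) = (G j + 1) + ((\<Sum>k\<in>?A. G k + 1) + (\<Sum>k\<in>?B. G k + 1))"
        unfolding X by (subst sum.insert, simp, force, subst sum.union_disjoint) auto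
      also have "(\<Sum>k\<in>?A. G k + 1) = (\<Sum>k\<in>?A. g1 k + 1)" by (intro sum.cong) (auto simp: G_def)
      also have "(\<Sum>k\<in>?B. G k + 1) = (\<Sum>k\<in>?B. 2 - g2 k)" using ij by (intro sum.cong) (auto simp: G_def)
      finally show ?thesis using g1(2) g2(3) ij deg_window[of i i] by (simp add: G_def)
    qed
    moreover have "deg j - 2 - l1 - l2 \<le> (\<Sum>v\<in>N (c j). g v - 1)"
    proof -
      let ?X = "{k\<in>{i..<i+n}. R j k}" and ?A = "{u\<in>{i<..<j}. R u j}" and ?B = "{u\<in>{j<..<i+n}. R j u}"
      have RR: "R j u = R u j" for u by (rule sym)
      have X: "?X = insert i (?A \<union> ?B)"
      proof (intro equalityI subsetI)
        fix k assume "k \<in> ?X"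
        then have k: "k \<in> {i..<i+n}" "R j k" by blast+
        then have "k \<noteq> j" using irrefl by metis
        then show "k \<in> insert i (?A \<union> ?B)" using part[OF k(1)] k(2) RR[of k] by blast
      next
        fix k assume k: "k \<in> insert i (?A \<union> ?B)"
        then have "R j k" using Rji RR[of k] by blast
        moreover have "k \<in> {i..<i+n}" using k ij(1,2) by auto
        ultimately show "k \<in> ?X" by blast
      qed
      have "(\<Sum>v\<in>N (c j). g v - 1) = (\<Sum>k\<in>?X. g (c k) - 1)"
        unfolding nb[OF Nj, of i] by (rule sum.reindex_cong[of c]) (auto intro: inj_on_subset[OF inj])
      also have "\<dots> = (\<Sum>k\<in>?X. 1 - (2 - G k))" using gc by (intro sum.cong) auto
      also have "\<dots> = int (card ?X) - (\<Sum>k\<in>?X. 2 - G k)" unfolding sum_subtractf by simp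
      also have "(\<Sum>k\<in>?X. 2 - G k) = (2 - G i) + ((\<Sum>k\<in>?A. 2 - G k) + (\<Sum>k\<in>?B. 2 - G k))"
        unfolding X using ij by (subst sum.insert, simp, force, subst sum.union_disjoint) auto
      also have "(\<Sum>k\<in>?A. 2 - G k) = (\<Sum>k\<in>?A. 2 - g1 k)" by (intro sum.cong) (auto simp: G_def)
      also have "(\<Sum>k\<in>?B. 2 - G k) = (\<Sum>k\<in>?B. g2 k + 1)" using ij by (intro sum.cong) (auto simp: G_def)
      finally show ?thesis using g1(3) g2(2) deg_window[of j i] by (simp add: G_def)
    qed
    ultimately have "0 < deg j * (2 + k1 + k2 - deg i) - deg i * (deg j - 2 - l1 - l2)"
      using mult_left_mono[of "\<Sum>v\<in>N (c i). g v" "2 + k1 + k2 - deg i" "deg j"]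
        mult_left_mono[of "deg j - 2 - l1 - l2" "\<Sum>v\<in>N (c j). g v - 1" "deg i"]
        deg_ge2[of i] deg_ge2[of j] unfolding degree[OF deep(1)] degree[OF Nj] by linarith
    then show "2 * deg i * deg j < (2 + k1 + k2) * deg j + (2 + l1 + l2) * deg i"
      by (simp add: algebra_simps)
  qed
qed

lemma degree_bound:
  assumes op: "outerplanar V E" and two: "two_connected V E" and pos: "positively_LLY_curved V E"
    and y: "y \<in> V"
  shows "degree E y \<le> 9"
proof -
  \<comment> \<open>All vertices within distance 2 of \<open>y\<close>: a finite set by local
    finiteness, and what \<open>edge_curved\<close> asks of the cycle.\<close>
  let ?S = "insert y (N y \<union> (\<Union>u\<in>N y. N u))"
  have "finite ?S" using finite_nbhd y nbhd_in by blast
  moreover have "?S \<subseteq> V" using y nbhd_subset by blast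
  ultimately obtain xs where xs: "cycle V E xs" "?S \<subseteq> set xs"
    using cycle_through[OF simple two op] by blast
  define n where "n = int (length xs)"
  define R where "R = (\<lambda>i j. {cyc_nth xs i, cyc_nth xs j} \<in> E)"
  interpret polygon n R unfolding n_def R_def by (rule cycle_polygon[OF simple op xs(1)])
  have xs': "distinct xs" "xs \<noteq> []" using xs(1) unfolding cycle_def by auto
  then obtain i where i: "y = cyc_nth xs i"
    using bij_cyc_nth[OF xs', of 0] xs(2) unfolding bij_betw_def by blast
  have e: "{cyc_nth xs i, cyc_nth xs (i + 1)} \<in> E" using R_succ[of i] unfolding R_def .
  then have "cyc_nth xs i \<in> V" "cyc_nth xs (i + 1) \<in> V" "cyc_nth xs i \<noteq> cyc_nth xs (i + 1)"
    using nbhd_in[of "cyc_nth xs (i + 1)" "cyc_nth xs i"] nbhd_iff by auto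
  then have p: "0 < lly_curvature V E (cyc_nth xs i) (cyc_nth xs (i + 1))"
    using pos unfolding positively_LLY_curved_def by blast
  have deep: "N (cyc_nth xs i) \<subseteq> set xs" "\<And>u. u \<in> N (cyc_nth xs i) \<Longrightarrow> N u \<subseteq> set xs"
    using xs(2) unfolding i by blast+
  have ij: "i < i + 1" "i + 1 < i + int (length xs)" using n3 unfolding n_def by auto
  from edge_curved[OF op xs(1) deep ij e p]
  have "int (degree E y) = deg i" "curved_edge n R i (i + 1)" unfolding i n_def R_def by auto
  then have "int (degree E y) \<le> 9" using degree_le_9[of i] by simp
  then show ?thesis by simp
qed

lemma predecessor:
  assumes z: "z \<in> V" and v: "v \<in> V" "dst z v = Suc k"
  obtains u where "u \<in> V" "dst z u = k" "v \<in> N u"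
proof -
  obtain u where u: "(z, u) \<in> adj_rel E ^^ k" "v \<in> N u"
    using dst_walk[OF z v(1)] v(2) by (auto simp: adj_rel_iff)
  then have "u \<in> V" using nbhd_in by blast
  moreover have "dst z u \<le> k" using u(1) by (rule dst_le)
  moreover have "Suc k \<le> dst z u + 1" using dst_triangle[OF z \<open>u \<in> V\<close> v(1)] dst_adj[OF u(2)] v(2) by simp
  ultimately show ?thesis using that[of u] u(2) by simp
qed

text \<open>Positive curvature makes the Laplacian of the distance function drop along every edge leading away
  from \<open>z\<close>. As all degrees are at most 9, the Laplacian takes finitely many values in \<open>[-1, 1]\<close>, so the
  diameter is bounded.\<close>

lemma finite_vertices:
  assumes op: "outerplanar V E" and two: "two_connected V E" and pos: "positively_LLY_curved V E"
  shows "finite V"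
proof -
  obtain z where z: "z \<in> V" using conn unfolding connected_graph_def by blast
  define f where "f v = real (dst z v)" for v
  define q where "q v = (\<Sum>w\<in>N v. int (dst z w) - int (dst z v))" for v
  \<comment> \<open>The constant is the factorial of 9, a multiple of every possible degree; hence
    the integer \<open>D v\<close> is that multiple of the Laplacian of the distance from
    \<open>z\<close>.\<close>
  define D where "D v = q v * (362880 div int (degree E v))" for v
  have lip: "f v - f u \<le> real (dst u v)" if "u \<in> V" "v \<in> V" for u v
    using dst_triangle[OF z that] unfolding f_def by simp
  have deg: "degree E v \<in> {1..9}" if "v \<in> V" "N v \<noteq> {}" for v
    using degree_bound[OF op two pos that(1)] finite_nbhd[OF that(1)] that(2) unfolding degree_def
    by (simp add: Suc_le_eq card_gt_0_iff)
  have D: "real_of_int (D v) = 362880 * lap f v" "\<bar>D v\<bar> \<le> 362880" if v: "v \<in> V" "N v \<noteq> {}" for v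
  proof -
    have lap: "lap f v = real_of_int (q v) / real (degree E v)"
      unfolding lap_def q_def f_def by simp
    have d: "int (degree E v) \<in> {1,2,3,4,5,6,7,8,9}" using deg[OF v] by auto
    have dv: "(362880 div int (degree E v)) * int (degree E v) = 362880" using d by auto
    then have "real_of_int (362880 div int (degree E v)) * real (degree E v) = 362880"
      by (metis of_int_mult of_int_numeral of_int_of_nat_eq)
    moreover have "real (degree E v) \<noteq> 0" using d by auto
    ultimately have "real_of_int (362880 div int (degree E v)) = 362880 / real (degree E v)"
      by (simp add: field_simps)
    then show "real_of_int (D v) = 362880 * lap f v" unfolding D_def lap by simp
    have "\<bar>int (dst z w) - int (dst z v)\<bar> \<le> 1" if "w \<in> N v" for w
      using dst_triangle[of z v w] dst_triangle[of z w v] dst_adj[OF that] dst_adj[of v w] nbhd_sym[of w v]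
        nbhd_in[OF that] that z by auto
    then have "\<bar>q v\<bar> \<le> (\<Sum>w\<in>N v. 1)" unfolding q_def by (intro order_trans[OF sum_abs] sum_mono)
    then have "\<bar>q v\<bar> \<le> int (degree E v)" unfolding degree_def by simp
    then have "\<bar>D v\<bar> \<le> int (degree E v) * (362880 div int (degree E v))"
      unfolding D_def abs_mult using d by (intro mult_mono) auto
    then show "\<bar>D v\<bar> \<le> 362880" using dv by (simp add: mult.commute)
  qed
  have drop: "D v + 1 \<le> D u" if "u \<in> V" "v \<in> N u" "dst z v = Suc (dst z u)" for u v
  proof -
    have uv: "u \<in> V" "v \<in> V" "u \<noteq> v" "N u \<noteq> {}" "N v \<noteq> {}" using that nbhd_in[OF that(2)] nbhd_sym by auto
    have "f v - f u = real (dst u v)" using that(3) dst_adj[OF that(2)] unfolding f_def by simp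
    then have "lly_curvature V E u v \<le> (lap f u - lap f v) / real (dst u v)"
      by (intro lly_curvature_le[OF uv(1-3) lip])
    moreover have "0 < lly_curvature V E u v" using pos uv unfolding positively_LLY_curved_def by blast
    ultimately have "lap f v < lap f u" using dst_adj[OF that(2)] by simp
    then have "real_of_int (D v) < real_of_int (D u)" using D(1) uv by simp
    then show ?thesis by simp
  qed
  have nonempty: "N v \<noteq> {}" if "v \<in> V" for v
  proof -
    have "\<not> V \<subseteq> {v}"
    proof
      assume "V \<subseteq> {v}"
      moreover from this have "finite V" by (rule finite_subset) simp
      ultimately show False using two card_mono[of "{v}" V] unfolding two_connected_def by simp
    qed
    then show ?thesis using nbhd_nonempty that by blast
  qed
  have level: "D v \<le> 362880 - int k" if "v \<in> V" "dst z v = k" for v k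
    using that
  proof (induction k arbitrary: v)
    case 0
    then show ?case using D(2)[of v] nonempty by fastforce
  next
    case (Suc k)
    obtain u where u: "u \<in> V" "dst z u = k" "v \<in> N u" using predecessor[OF z Suc.prems] .
    then show ?case using Suc.IH[OF u(1,2)] drop[OF u(1,3)] Suc.prems(2) by simp
  qed
  \<comment> \<open>\<open>D\<close> is at most 362880 at the start, loses at least 1 per level and
    never falls below -362880.\<close>
  have bounded: "dst z v \<le> 725760" if "v \<in> V" for v
    using level[OF that refl] D(2)[OF that nonempty[OF that]] by linarith
  have "finite {v \<in> V. dst z v \<le> k}" for k
  proof (induction k)
    case 0
    have "{v \<in> V. dst z v \<le> 0} \<subseteq> {z}" using dst_eq_0 z by auto
    then show ?case by (rule finite_subset) simp
  next
    case (Suc k)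
    have "{v \<in> V. dst z v \<le> Suc k} \<subseteq> {v \<in> V. dst z v \<le> k} \<union> (\<Union>u\<in>{v \<in> V. dst z v \<le> k}. N u)"
    proof
      fix v assume v: "v \<in> {v \<in> V. dst z v \<le> Suc k}"
      show "v \<in> {v \<in> V. dst z v \<le> k} \<union> (\<Union>u\<in>{v \<in> V. dst z v \<le> k}. N u)"
      proof (cases "dst z v = Suc k")
        case True
        obtain u where "u \<in> V" "dst z u = k" "v \<in> N u" using predecessor[OF z _ True] v by blast
        then show ?thesis by auto
      next
        case False then show ?thesis using v by simp
      qed
    qed
    moreover have "finite (\<Union>u\<in>{v \<in> V. dst z v \<le> k}. N u)" using Suc finite_nbhd by blast
    ultimately show ?case using Suc finite_subset by blast
  qed
  moreover have "V = {v \<in> V. dst z v \<le> 725760}" using bounded by blast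
  ultimately show ?thesis by metis
qed

theorem vertex_bound:
  assumes op: "outerplanar V E" and two: "two_connected V E" and pos: "positively_LLY_curved V E"
  shows "finite V \<and> card V \<le> 10"
proof
  show fin: "finite V" by (rule finite_vertices[OF assms])
  obtain xs where xs: "cycle V E xs" "V \<subseteq> set xs" using cycle_through[OF simple two op fin] by blast
  then have eq: "set xs = V" unfolding cycle_def by blast
  define n where "n = int (length xs)"
  define R where "R = (\<lambda>i j. {cyc_nth xs i, cyc_nth xs j} \<in> E)"
  have xs': "distinct xs" using xs(1) unfolding cycle_def by simp
  interpret polygon n R unfolding n_def R_def by (rule cycle_polygon[OF simple op xs(1)])
  interpret curved_polygon n R
  proof
    fix i j assume ij: "i < j" "j < i + n" "R i j"
    then have e: "{cyc_nth xs i, cyc_nth xs j} \<in> E" unfolding R_def by simp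
    then have "cyc_nth xs i \<in> V" "cyc_nth xs j \<in> V" "cyc_nth xs i \<noteq> cyc_nth xs j"
      using nbhd_in[of "cyc_nth xs j" "cyc_nth xs i"] nbhd_iff by auto
    then have p: "0 < lly_curvature V E (cyc_nth xs i) (cyc_nth xs j)"
      using pos unfolding positively_LLY_curved_def by blast
    have deep: "N v \<subseteq> set xs" for v using nbhd_subset unfolding eq .
    from edge_curved(2)[OF op xs(1) deep deep ij(1) _ e p] ij(2)
    show "curved_edge n R i j" unfolding n_def R_def by simp
  qed
  have "card V = length xs" using distinct_card[OF xs'] eq by simp
  then show "card V \<le> 10" using polygon_bound unfolding n_def by simp
qed

end

section \<open>The fan on ten vertices\<close>

context connected_lf_graph
begin

lemma coupling_swap:
  assumes "is_coupling V m1 m2 A"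
  shows "is_coupling V m2 m1 (A \<circ> prod.swap)" "transport_cost V E (A \<circ> prod.swap) = transport_cost V E A"
proof -
  obtain U where U: "finite U" "U \<subseteq> V" "\<forall>u\<in>V. \<forall>v\<in>V. A (u, v) \<noteq> 0 \<longrightarrow> u \<in> U \<and> v \<in> U"
    using coupling_finite_support[OF assms] by metis
  have "{p \<in> V \<times> V. (A \<circ> prod.swap) p \<noteq> 0} \<subseteq> U \<times> U" using U(3) by auto
  then have "finite {p \<in> V \<times> V. (A \<circ> prod.swap) p \<noteq> 0}" using U(1) finite_subset by blast
  then show c: "is_coupling V m2 m1 (A \<circ> prod.swap)" using assms unfolding is_coupling_def by auto
  have "transport_cost V E (A \<circ> prod.swap) = (\<Sum>u\<in>U. \<Sum>v\<in>U. A (v, u) * real (dst u v))"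
    using U(3) by (subst coupling_sums(3)[OF c U(1,2)]) auto
  also have "\<dots> = (\<Sum>v\<in>U. \<Sum>u\<in>U. A (v, u) * real (dst v u))"
    using dst_sym U(2) by (subst sum.swap) (intro sum.cong, auto)
  finally show "transport_cost V E (A \<circ> prod.swap) = transport_cost V E A"
    using coupling_sums(3)[OF assms U] by simp
qed

text \<open>Transposing a coupling keeps its cost. The spokes of the fan then need to be checked
  only with the hub as first vertex.\<close>

lemma lly_curvature_sym: "x \<in> V \<Longrightarrow> y \<in> V \<Longrightarrow> lly_curvature V E x y = lly_curvature V E y x"
proof -
  have "wasserstein V E m1 m2 = wasserstein V E m2 m1" for m1 m2
  proof -
    have "transport_cost V E ` {A. is_coupling V m1 m2 A} = transport_cost V E ` {A. is_coupling V m2 m1 A}"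
      using coupling_swap by (auto simp: image_iff) metis+
    then show ?thesis unfolding wasserstein_def transport_cost_def[symmetric] by simp
  qed
  then show "x \<in> V \<Longrightarrow> y \<in> V \<Longrightarrow> lly_curvature V E x y = lly_curvature V E y x"
    unfolding lly_curvature_def lazy_curvature_def using dst_sym[of x y] by simp
qed

text \<open>The common part \<open>c\<close> of the two walks stays in place and the residuals are coupled independently; the
  pair \<open>(a, b)\<close> makes the cost strictly smaller than 2 per unit of transported mass.\<close>

lemma lly_curvature_pos_residual:
  assumes xy: "x \<in> V" "y \<in> V" "x \<noteq> y" and \<alpha>: "0 \<le> \<alpha>" "\<alpha> < 1"
    and U: "finite U" "U \<subseteq> V" "insert x (N x) \<subseteq> U" "insert y (N y) \<subseteq> U"
    and c: "\<And>u. u \<in> U \<Longrightarrow> 0 \<le> c u" "\<And>u. u \<in> U \<Longrightarrow> c u \<le> lazy_walk E \<alpha> x u"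
      "\<And>u. u \<in> U \<Longrightarrow> c u \<le> lazy_walk E \<alpha> y u"
    and S: "sum c U < 1" "2 * (1 - sum c U) \<le> real (dst x y)"
    and diam: "\<And>u v. u \<in> U \<Longrightarrow> v \<in> U \<Longrightarrow> dst u v \<le> 2"
    and ab: "a \<in> U" "b \<in> U" "dst a b \<le> 1" "c a < lazy_walk E \<alpha> x a" "c b < lazy_walk E \<alpha> y b"
  shows "0 < lly_curvature V E x y"
proof -
  let ?m = "lazy_walk E \<alpha> x" and ?n = "lazy_walk E \<alpha> y"
  define T where "T = 1 - sum c U"
  have T: "0 < T" using S(1) unfolding T_def by simp
  define B where "B u v = (?m u - c u) * (?n v - c v) / T" for u v
  define A where "A = (\<lambda>(u, v). if u \<in> U \<and> v \<in> U then (if u = v then c u else 0) + B u v else 0)"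
  have nx: "N x \<noteq> {}" "N y \<noteq> {}" using nbhd_nonempty[of x y] nbhd_nonempty[of y x] xy by auto
  have one: "sum ?m U = 1" "sum ?n U = 1"
    using lazy_walk_sum[OF xy(1) nx(1) U(1,3), of \<alpha> "\<lambda>_. 1"] lazy_walk_sum[OF xy(2) nx(2) U(1,4), of \<alpha> "\<lambda>_. 1"]
    by (simp_all add: lap_def)
  have Bnn: "0 \<le> B u v" if "u \<in> U" "v \<in> U" for u v
    unfolding B_def using c that T by (intro divide_nonneg_pos mult_nonneg_nonneg) auto
  have rowB: "(\<Sum>v\<in>U. B u v) = ?m u - c u" for u
  proof -
    have "(\<Sum>v\<in>U. B u v) = (?m u - c u) * (\<Sum>v\<in>U. ?n v - c v) / T"
      unfolding B_def by (simp add: sum_distrib_left sum_divide_distrib)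
    also have "(\<Sum>v\<in>U. ?n v - c v) = T" using one unfolding T_def by (simp add: sum_subtractf)
    finally show ?thesis using T by simp
  qed
  have colB: "(\<Sum>u\<in>U. B u v) = ?n v - c v" for v
  proof -
    have "(\<Sum>u\<in>U. B u v) = (\<Sum>u\<in>U. ?m u - c u) * (?n v - c v) / T"
      unfolding B_def by (simp add: sum_distrib_right sum_divide_distrib)
    also have "(\<Sum>u\<in>U. ?m u - c u) = T" using one unfolding T_def by (simp add: sum_subtractf)
    finally show ?thesis using T by simp
  qed
  have out: "?m u = 0" "?n u = 0" if "u \<notin> U" for u using U that by (auto simp: lazy_walk_def)
  have r: "?m u = (\<Sum>v\<in>U. A (u, v))" for u
  proof (cases "u \<in> U")
    case True
    then have "(\<Sum>v\<in>U. A (u, v)) = (\<Sum>v\<in>U. (if u = v then c u else 0) + B u v)"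
      unfolding A_def by (intro sum.cong) auto
    then show ?thesis using True U(1) rowB by (simp add: sum.distrib)
  qed (simp add: A_def out)
  have l: "?n v = (\<Sum>u\<in>U. A (u, v))" for v
  proof (cases "v \<in> U")
    case True
    then have "(\<Sum>u\<in>U. A (u, v)) = (\<Sum>u\<in>U. (if u = v then c u else 0) + B u v)"
      unfolding A_def by (intro sum.cong) auto
    then show ?thesis using True U(1) colB by (simp add: sum.distrib)
  qed (simp add: A_def out)
  have A0: "A p = 0" if "p \<notin> U \<times> U" for p using that unfolding A_def by (cases p) auto
  have Ann: "0 \<le> A (u, v)" if "u \<in> U" "v \<in> U" for u v
    unfolding A_def using Bnn[OF that] c(1) that by simp
  have le1: "?m u \<le> 1" for u by (rule lazy_walk_01(2)[OF xy(1) nx(1) \<alpha>(1)]) (use \<alpha> in simp)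
  have cpl: "is_coupling V ?m ?n A"
    by (rule couplingI_finite(1)[OF U(1,2) A0 Ann r l le1])
  have "transport_cost V E A = (\<Sum>u\<in>U. \<Sum>v\<in>U. A (u, v) * real (dst u v))"
    by (rule couplingI_finite(2)[OF U(1,2) A0 Ann r l le1])
  \<comment> \<open>Mass left in place costs nothing; writing the distance as
    \<open>2 - (2 - dst u v)\<close> separates the crude cost of 2 per unit from the saving.\<close>
  also have "\<dots> = (\<Sum>u\<in>U. \<Sum>v\<in>U. 2 * B u v - B u v * (2 - real (dst u v)))"
    unfolding A_def by (intro sum.cong) (auto simp: algebra_simps)
  also have "\<dots> = 2 * (\<Sum>u\<in>U. \<Sum>v\<in>U. B u v) - (\<Sum>u\<in>U. \<Sum>v\<in>U. B u v * (2 - real (dst u v)))"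
    by (simp add: sum_subtractf sum_distrib_left)
  also have "(\<Sum>u\<in>U. \<Sum>v\<in>U. B u v) = T"
    using one unfolding rowB T_def by (simp add: sum_subtractf)
  finally have cost: "transport_cost V E A = 2 * T - (\<Sum>u\<in>U. \<Sum>v\<in>U. B u v * (2 - real (dst u v)))" .
  have nn: "0 \<le> B u v * (2 - real (dst u v))" if "u \<in> U" "v \<in> U" for u v
    using Bnn[OF that] diam[OF that] by simp
  have "0 < B a b * (2 - real (dst a b))"
    unfolding B_def using ab T by (intro mult_pos_pos divide_pos_pos) auto
  also have "\<dots> \<le> (\<Sum>v\<in>U. B a v * (2 - real (dst a v)))"
    using ab U(1) nn by (intro member_le_sum) auto
  also have "\<dots> \<le> (\<Sum>u\<in>U. \<Sum>v\<in>U. B u v * (2 - real (dst u v)))"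
    using ab U(1) nn by (intro member_le_sum[of a U "\<lambda>u. \<Sum>v\<in>U. B u v * (2 - real (dst u v))"] sum_nonneg) auto
  finally have "transport_cost V E A < real (dst x y)"
    using cost S(2) unfolding T_def by simp
  then show ?thesis by (rule lly_curvature_pos[OF xy \<alpha> cpl])
qed

end

section \<open>The fan as a graph\<close>

definition fan_edges :: "nat set set" where
  "fan_edges = (\<lambda>i. {0, i}) ` {1..9} \<union> (\<lambda>i. {i, Suc i}) ` {1..8}"

lemma fan_edge_iff: "{u, v} \<in> fan_edges \<longleftrightarrow>
    u = 0 \<and> 1 \<le> v \<and> v \<le> 9 \<or> v = 0 \<and> 1 \<le> u \<and> u \<le> 9 \<or> 1 \<le> u \<and> v = Suc u \<and> v \<le> 9 \<or> 1 \<le> v \<and> u = Suc v \<and> u \<le> 9"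
proof
  assume "{u, v} \<in> fan_edges"
  then consider i where "1 \<le> i" "i \<le> 9" "{u, v} = {0, i}" | i where "1 \<le> i" "i \<le> 8" "{u, v} = {i, Suc i}"
    unfolding fan_edges_def by auto
  then show "u = 0 \<and> 1 \<le> v \<and> v \<le> 9 \<or> v = 0 \<and> 1 \<le> u \<and> u \<le> 9 \<or> 1 \<le> u \<and> v = Suc u \<and> v \<le> 9 \<or> 1 \<le> v \<and> u = Suc v \<and> u \<le> 9"
    by cases (auto simp: doubleton_eq_iff)
next
  assume "u = 0 \<and> 1 \<le> v \<and> v \<le> 9 \<or> v = 0 \<and> 1 \<le> u \<and> u \<le> 9 \<or> 1 \<le> u \<and> v = Suc u \<and> v \<le> 9 \<or> 1 \<le> v \<and> u = Suc v \<and> u \<le> 9"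
  then show "{u, v} \<in> fan_edges"
    unfolding fan_edges_def by (auto simp: insert_commute)
qed

lemma fan_edgeE:
  assumes "e \<in> fan_edges"
  obtains (spoke) i where "1 \<le> i" "i \<le> 9" "e = {0, i}" | (rim) i where "1 \<le> i" "i \<le> 8" "e = {i, Suc i}"
  using assms unfolding fan_edges_def by auto

lemma fan_simple: "simple_graph {..9} fan_edges"
  unfolding simple_graph_def by (auto elim!: fan_edgeE)

lemma fan_nbhd: "nbhd fan_edges 0 = {1..9}" "nbhd fan_edges 1 = {0, 2}" "nbhd fan_edges 9 = {0, 8}"
  "2 \<le> i \<Longrightarrow> i \<le> 8 \<Longrightarrow> nbhd fan_edges i = {0, i - 1, Suc i}"
  unfolding nbhd_def fan_edge_iff by auto

lemma rtrancl_adj_sym: "(u, v) \<in> (adj_rel F)\<^sup>* \<Longrightarrow> (v, u) \<in> (adj_rel F)\<^sup>*"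
proof (induction rule: rtrancl_induct)
  case (step y z)
  then have "(z, y) \<in> adj_rel F" unfolding adj_rel_def by (simp add: insert_commute)
  then show ?case using step(3) by simp
qed simp

lemma connected_from_root:
  assumes "r \<in> W" "\<And>v. v \<in> W \<Longrightarrow> (r, v) \<in> (adj_rel F)\<^sup>*"
  shows "connected_graph W F"
  unfolding connected_graph_def using assms rtrancl_adj_sym rtrancl_trans by (metis empty_iff)

lemma fan_connected: "connected_graph {..9} fan_edges"
proof (rule connected_from_root[of 0])
  fix v :: nat assume "v \<in> {..9}"
  then show "(0, v) \<in> (adj_rel fan_edges)\<^sup>*"
    by (cases "v = 0") (auto intro!: r_into_rtrancl simp: adj_rel_def fan_edge_iff)
qed simp

lemma fan_two_connected: "two_connected {..9} fan_edges"
  unfolding two_connected_def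
proof (intro conjI ballI)
  fix x :: nat assume x: "x \<in> {..9}"
  let ?F = "{e \<in> fan_edges. x \<notin> e}"
  show "connected_graph ({..9} - {x}) ?F"
  proof (cases "x = 0")
    case False
    show ?thesis
    proof (rule connected_from_root[of 0])
      fix v assume "v \<in> {..9} - {x}"
      then show "(0, v) \<in> (adj_rel ?F)\<^sup>*"
        using False by (cases "v = 0") (auto intro!: r_into_rtrancl simp: adj_rel_def fan_edge_iff)
    qed (use False in simp)
  next
    case True
    show ?thesis
    proof (rule connected_from_root[of 1])
      fix v assume v: "v \<in> {..9} - {x}"
      then have "1 \<le> v" "v \<le> 9" using True by auto
      then show "(1, v) \<in> (adj_rel ?F)\<^sup>*"
      proof (induction v rule: nat_induct_at_least)
        case (Suc v)
        then have "(v, Suc v) \<in> adj_rel ?F" using True by (simp add: adj_rel_def fan_edge_iff)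
        then show ?case using Suc by (meson Suc_leD rtrancl.rtrancl_into_rtrancl)
      qed simp
    qed (use True in simp)
  qed
qed (use fan_connected in auto)

interpretation fan: connected_lf_graph "{..9}" fan_edges
proof
  show "locally_finite {..9} fan_edges"
    unfolding locally_finite_def
  proof
    fix x :: nat
    have "nbhd fan_edges x \<subseteq> {..9}" unfolding nbhd_def fan_edge_iff by auto
    then show "finite (nbhd fan_edges x)" by (rule finite_subset) simp
  qed
qed (rule fan_simple fan_connected)+

lemma fan_dst_le2: "u \<le> 9 \<Longrightarrow> v \<le> 9 \<Longrightarrow> fan.dst u v \<le> 2"
proof -
  assume uv: "u \<le> 9" "v \<le> 9"
  have near: "fan.dst 0 w \<le> 1" if "w \<le> 9" for w
    using fan.dst_adj[of w 0] that by (cases "w = 0") (auto simp: fan_nbhd)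
  show ?thesis
    using fan.dst_triangle[of u 0 v] fan.dst_sym[of u 0] uv near[OF uv(1)] near[OF uv(2)] by simp
qed

lemma fan_degree: "degree fan_edges 0 = 9" "degree fan_edges 1 = 2" "degree fan_edges 9 = 2"
  "2 \<le> i \<Longrightarrow> i \<le> 8 \<Longrightarrow> degree fan_edges i = 3"
  unfolding degree_def fan_nbhd by (simp_all add: fan_nbhd(4))

lemma fan_degree_le3: "1 \<le> i \<Longrightarrow> i \<le> 9 \<Longrightarrow> 1 \<le> degree fan_edges i \<and> degree fan_edges i \<le> 3"
  using fan_degree by (cases "i = 1"; cases "i = 9") auto

section \<open>Positive curvature of the fan\<close>

text \<open>Both walks charge the hub, so even with empty common part the independent coupling costs
  less than 2, while nonadjacent vertices are at distance at least 2.\<close>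

lemma fan_positive_nonadjacent:
  assumes "1 \<le> x" "x \<le> 9" "1 \<le> y" "y \<le> 9" "x \<noteq> y" "y \<notin> fan.N x"
  shows "0 < lly_curvature {..9} fan_edges x y"
proof (rule fan.lly_curvature_pos_residual[where \<alpha> = "1/2" and U = "{..9}" and c = "\<lambda>_. 0" and a = 0 and b = 0])
  have "fan.dst x y \<noteq> 0" "fan.dst x y \<noteq> 1" using assms fan.dst_eq_0[of x y] fan.dst_1[of x y] by auto
  then show "2 * (1 - sum (\<lambda>_. 0) {..9}) \<le> real (fan.dst x y)" by simp
  show "0 < lazy_walk fan_edges (1/2) x 0" "0 < lazy_walk fan_edges (1/2) y 0"
    using assms fan_degree_le3[of x] fan_degree_le3[of y] by (auto simp: lazy_walk_def fan.nbhd_iff fan_edge_iff)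
qed (use assms fan.nbhd_subset fan_dst_le2 in \<open>auto simp: lazy_walk_def\<close>)

text \<open>With laziness 1/4 a neighbour of a vertex of degree at most 3 receives at least 1/4. So
  mass 1/4 stays at \<open>x\<close> and at \<open>y\<close>, the residuals have mass 1/2, and both
  charge the hub.\<close>

lemma fan_positive_rim:
  assumes "1 \<le> x" "x \<le> 9" "1 \<le> y" "y \<le> 9" "x \<noteq> y" "y \<in> fan.N x"
  shows "0 < lly_curvature {..9} fan_edges x y"
proof (rule fan.lly_curvature_pos_residual[where \<alpha> = "1/4" and U = "{..9}" and a = 0 and b = 0
      and c = "\<lambda>v. if v = x \<or> v = y then 1/4 else 0"])
  let ?c = "\<lambda>v. if v = x \<or> v = y then 1/4 else 0 :: real"
  have "sum ?c {..9} = sum ?c {x, y}" using assms by (intro sum.mono_neutral_right) auto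
  then have s: "sum ?c {..9} = 1/2" using assms by simp
  show "sum ?c {..9} < 1" using s by simp
  show "2 * (1 - sum ?c {..9}) \<le> real (fan.dst x y)" using s fan.dst_adj[OF assms(6)] by simp
  have d: "3/4 / real (degree fan_edges v) \<ge> 1/4" if "v \<in> {x, y}" for v
    using fan_degree_le3[of v] that assms by (auto simp: field_simps)
  have xy: "x \<in> fan.N y" using assms fan.nbhd_sym by blast
  show "?c u \<le> lazy_walk fan_edges (1/4) x u" "?c u \<le> lazy_walk fan_edges (1/4) y u" for u
    using d assms xy by (auto simp: lazy_walk_def)
  show "?c 0 < lazy_walk fan_edges (1/4) x 0" "?c 0 < lazy_walk fan_edges (1/4) y 0"
    using assms fan_degree_le3[of x] fan_degree_le3[of y] by (auto simp: lazy_walk_def fan.nbhd_iff fan_edge_iff)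
qed (use assms fan.nbhd_subset fan_dst_le2 in auto)

text \<open>With laziness 1/4 the walk at \<open>i\<close> has four equal masses 1/4, the one at the
  hub has 1/4 at the hub and 1/12 elsewhere; their common part is 1/2. The saving comes from a rim
  edge \<open>a b\<close> with \<open>b\<close> a neighbour of \<open>i\<close> and \<open>a\<close>
  away from \<open>i\<close>; for \<open>i = 8\<close> it is taken on the lower side.\<close>

lemma fan_positive_spoke:
  assumes "2 \<le> i" "i \<le> 8"
  shows "0 < lly_curvature {..9} fan_edges 0 i"
proof -
  define b where "b = (if i \<le> 7 then Suc i else 7)"
  define a where "a = (if i \<le> 7 then Suc (Suc i) else 6)"
  let ?c = "\<lambda>v. if v = 0 then 1/4 else if v \<in> {i - 1, i, Suc i} then 1/12 else 0 :: real"
  have ab: "a \<le> 9" "b \<le> 9" "1 \<le> a" "1 \<le> b" "a \<notin> {i - 1, i, Suc i}" "b \<in> {i - 1, Suc i}" "b \<in> fan.N a"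
    unfolding a_def b_def fan.nbhd_iff fan_edge_iff using assms by auto
  have m: "lazy_walk fan_edges (1/4) 0 v = (if v = 0 then 1/4 else 1/12)" if "v \<le> 9" for v
    using that by (simp add: lazy_walk_def fan_nbhd fan_degree)
  have n: "lazy_walk fan_edges (1/4) i v = (if v \<in> {0, i - 1, i, Suc i} then 1/4 else 0)" for v
    using assms by (simp add: lazy_walk_def fan_nbhd fan_degree)
  have "sum ?c {..9} = sum ?c {0, i - 1, i, Suc i}" using assms by (intro sum.mono_neutral_right) auto
  also have "\<dots> = 1/2"
  proof -
    obtain j where "i = Suc j" "1 \<le> j" using assms by (cases i) auto
    then show ?thesis by simp
  qed
  finally have s: "sum ?c {..9} = 1/2" .
  have i0: "i \<in> fan.N 0" using assms by (simp add: fan_nbhd)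
  show ?thesis
  proof (rule fan.lly_curvature_pos_residual[where \<alpha> = "1/4" and U = "{..9}" and a = a and b = b and c = ?c])
    show "sum ?c {..9} < 1" using s by simp
    show "2 * (1 - sum ?c {..9}) \<le> real (fan.dst 0 i)" using s fan.dst_adj[OF i0] by simp
    show "fan.dst a b \<le> 1" using fan.dst_adj[OF ab(7)] by simp
    show "?c a < lazy_walk fan_edges (1/4) 0 a" "?c b < lazy_walk fan_edges (1/4) i b"
      using ab m[of a] n[of b] assms by auto
    show "?c u \<le> lazy_walk fan_edges (1/4) 0 u" "?c u \<le> lazy_walk fan_edges (1/4) i u" if "u \<in> {..9}" for u
      using that m[of u] n[of u] by auto
  qed (use assms ab fan.nbhd_subset fan_dst_le2 in auto)
qed

text \<open>Here independent residuals have cost exactly 1, so the mass at \<open>t\<close> has to be moved to its neighbour \<open>s\<close>.\<close>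

lemma fan_positive_end_spoke:
  fixes e s t :: nat
  assumes est: "(e, s, t) = (1, 2, 3) \<or> (e, s, t) = (9, 8, 7)"
  shows "0 < lly_curvature {..9} fan_edges 0 e"
proof -
  have V: "{..9::nat} = {0, 1, 2, 3, 4, 5, 6, 7, 8, 9}" by auto
  \<comment> \<open>Laziness 1/10 makes the walk at the hub uniform, and the walk at
    \<open>e\<close> puts 9/20 on \<open>0\<close> and on \<open>s\<close>. Each of the six vertices
    other than \<open>0\<close>, \<open>e\<close>, \<open>s\<close>, \<open>t\<close> sends 1/24 to
    \<open>s\<close> and 7/120 to the hub, which fills both up to 9/20. The cost is at most 1/10 +
    1/2 + 7/20 = 19/20.\<close>
  define A where "A = (\<lambda>(u, v). if u \<notin> {..9} then 0
      else if v = s then (if u = s \<or> u = t then 1/10 else if u = 0 \<or> u = e then 0 else 1/24)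
      else if v = 0 then (if u = 0 then 1/10 else if u \<in> {e, s, t} then 0 else 7/120)
      else if v = e \<and> u = e then 1/10 else 0 :: real)"
  have m: "lazy_walk fan_edges (1/10) 0 u = (if u \<in> {..9} then 1/10 else 0)" for u
    by (auto simp: lazy_walk_def fan_nbhd fan_degree)
  have n: "lazy_walk fan_edges (1/10) e u = (if u = e then 1/10 else if u = 0 \<or> u = s then 9/20 else 0)" for u
    using est by (auto simp: lazy_walk_def fan_nbhd[unfolded One_nat_def] fan_degree[unfolded One_nat_def])
  have A0: "A p = 0" if "p \<notin> {..9} \<times> {..9}" for p
    using that est unfolding A_def by (cases p) auto
  have Ann: "0 \<le> A (u, v)" for u v unfolding A_def by simp
  have r: "lazy_walk fan_edges (1/10) 0 u = (\<Sum>v\<in>{..9}. A (u, v))" if "u \<in> {..9}" for u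
    using that est unfolding m V by (elim disjE insertE) (simp_all add: A_def)
  have l: "lazy_walk fan_edges (1/10) e v = (\<Sum>u\<in>{..9}. A (u, v))" if "v \<in> {..9}" for v
    using that est unfolding n V by (elim disjE insertE) (simp_all add: A_def)
  have le: "lazy_walk fan_edges (1/10) 0 u \<le> 1" for u unfolding m by simp
  note cpl = couplingI_finite[of "{..9}" "{..9}" A, OF _ _ A0 Ann r l le]
  have c: "is_coupling {..9} (lazy_walk fan_edges (1/10) 0) (lazy_walk fan_edges (1/10) e) A"
    by (rule cpl(1)) auto
  have e0: "e \<in> fan.N 0" using est by (auto simp: fan_nbhd)
  have "transport_cost {..9} fan_edges A = (\<Sum>u\<in>{..9}. \<Sum>v\<in>{..9}. A (u, v) * real (fan.dst u v))"
    by (rule cpl(2)) auto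
  also have "\<dots> \<le> (\<Sum>u\<in>{..9}. \<Sum>v\<in>{..9}. A (u, v) * (if u = v then 0 else if u = 0 \<or> v = 0 \<or> u = t then 1 else 2))"
  proof (intro sum_mono)
    fix u v :: nat assume uv: "u \<in> {..9}" "v \<in> {..9}"
    have near: "fan.dst u v \<le> 1" if "u \<noteq> v" "u = 0 \<or> v = 0 \<or> u = t \<and> v = s"
      using fan.dst_adj[of v u] that uv est by (auto simp: fan_nbhd fan.nbhd_iff fan_edge_iff)
    show "A (u, v) * real (fan.dst u v) \<le> A (u, v) * (if u = v then 0 else if u = 0 \<or> v = 0 \<or> u = t then 1 else 2)"
    proof (cases "A (u, v) = 0")
      case False
      then have "u = t \<Longrightarrow> v = s" using est unfolding A_def by (auto split: if_splits)
      then have "real (fan.dst u v) \<le> (if u = v then 0 else if u = 0 \<or> v = 0 \<or> u = t then 1 else 2)"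
        using near fan_dst_le2[of u v] uv by auto
      then show ?thesis using Ann by (intro mult_left_mono) auto
    qed simp
  qed
  also have "\<dots> < 1"
    using est unfolding V by (elim disjE) (simp_all add: A_def)
  finally show ?thesis
    using fan.dst_adj[OF e0] est by (intro fan.lly_curvature_pos[OF _ _ _ _ _ c]) auto
qed

lemma fan_positive: "positively_LLY_curved {..9} fan_edges"
proof -
  have spoke: "0 < lly_curvature {..9} fan_edges 0 y" if y: "1 \<le> y" "y \<le> 9" for y
  proof -
    consider "y = 1" | "y = 9" | "2 \<le> y \<and> y \<le> 8" using y by linarith
    then show ?thesis
      using fan_positive_end_spoke[of 1 2 3] fan_positive_end_spoke[of 9 8 7] fan_positive_spoke by cases simp_all
  qed
  have "0 < lly_curvature {..9} fan_edges x y" if "x \<in> {..9}" "y \<in> {..9}" "x \<noteq> y" "x \<noteq> 0" for x y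
  proof (cases "y = 0")
    case True
    then show ?thesis using fan.lly_curvature_sym[of 0 x] spoke[of x] that by simp
  next
    case False
    then show ?thesis
      using fan_positive_nonadjacent[of x y] fan_positive_rim[of x y] that by fastforce
  qed
  moreover have "0 < lly_curvature {..9} fan_edges 0 y" if "y \<in> {..9}" "y \<noteq> 0" for y
    using spoke[of y] that by simp
  ultimately show ?thesis unfolding positively_LLY_curved_def by metis
qed

section \<open>An outerplanar drawing of the fan\<close>

text \<open>Points in convex position with polynomial coordinates: all chords lie on or above the
  parabola, so infinity is reached from every vertex straight down.\<close>

definition parabola :: "nat \<Rightarrow> complex" where "parabola k = Complex (real k) ((real k)\<^sup>2)"

lemma parabola_chord:
  assumes "a < b" "z \<in> path_image (linepath (parabola a) (parabola b))"
  shows "real a \<le> Re z" "Re z \<le> real b" "Im z = (real a + real b) * Re z - real a * real b"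
proof -
  obtain t where t: "0 \<le> t" "t \<le> 1" "z = (1 - t) *\<^sub>R parabola a + t *\<^sub>R parabola b"
    using assms(2) by (auto simp: path_image_def linepath_def)
  have re: "Re z = real a + t * (real b - real a)" and im: "Im z = (1 - t) * (real a)\<^sup>2 + t * (real b)\<^sup>2"
    unfolding t parabola_def by (simp_all add: algebra_simps)
  have "0 \<le> t * (real b - real a)" "t * (real b - real a) \<le> 1 * (real b - real a)"
    using t assms(1) by (auto intro: mult_right_mono)
  then show "real a \<le> Re z" "Re z \<le> real b" unfolding re by simp_all
  show "Im z = (real a + real b) * Re z - real a * real b"
    unfolding re im by (simp add: algebra_simps power2_eq_square)
qed

lemma parabola_chord_vertex:
  assumes "a < b" "parabola k \<in> path_image (linepath (parabola a) (parabola b))"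
  shows "k = a \<or> k = b"
proof -
  have "(real k)\<^sup>2 = (real a + real b) * real k - real a * real b"
    using parabola_chord(3)[OF assms] by (simp add: parabola_def)
  then have "(real k - real a) * (real k - real b) = 0" by (simp add: algebra_simps power2_eq_square)
  then show ?thesis by simp
qed

lemma parabola_chord_above:
  assumes "a < b" "z \<in> path_image (linepath (parabola a) (parabola b))"
  shows "(Re z)\<^sup>2 \<le> Im z"
proof -
  note c = parabola_chord[OF assms]
  have "0 \<le> (Re z - real a) * (real b - Re z)" using c(1,2) by simp
  then show ?thesis unfolding c(3) by (simp add: algebra_simps power2_eq_square)
qed

lemma parabola_chord_start:
  assumes "a < b" "z \<in> path_image (linepath (parabola a) (parabola b))" "Re z = real a"
  shows "z = parabola a"
  using parabola_chord(3)[OF assms(1,2)] assms(3)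
  by (auto simp: parabola_def complex_eq_iff algebra_simps power2_eq_square)

lemma parabola_chord_end:
  assumes "a < b" "z \<in> path_image (linepath (parabola a) (parabola b))" "Re z = real b"
  shows "z = parabola b"
  using parabola_chord(3)[OF assms(1,2)] assms(3)
  by (auto simp: parabola_def complex_eq_iff algebra_simps power2_eq_square)

text \<open>\<open>Min\<close> and \<open>Max\<close> orient the segment, so that it depends only on
  the edge as a set.\<close>

definition chord :: "nat set \<Rightarrow> real \<Rightarrow> complex" where
  "chord e = linepath (parabola (Min e)) (parabola (Max e))"

lemma fan_edge_ordered:
  assumes "e \<in> fan_edges"
  obtains a b where "a < b" "e = {a, b}" "chord e = linepath (parabola a) (parabola b)" "b \<le> 9"
  using assms
proof (cases rule: fan_edgeE)
  case (spoke i)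
  then show ?thesis using that[of 0 i] by (simp add: chord_def)
next
  case (rim i)
  then show ?thesis using that[of i "Suc i"] by (simp add: chord_def)
qed

lemma spokes_meet:
  assumes "1 \<le> i" "1 \<le> j" "i \<noteq> j"
    and "z \<in> path_image (linepath (parabola 0) (parabola i))" "z \<in> path_image (linepath (parabola 0) (parabola j))"
  shows "z = parabola 0"
proof -
  have "real i * Re z = real j * Re z"
    using parabola_chord(3)[of 0 i z] parabola_chord(3)[of 0 j z] assms by simp
  then have "Re z = 0" using assms(3) by simp
  then show ?thesis using parabola_chord_start[of 0 i z] assms by simp
qed

lemma spoke_rim_meet:
  assumes "1 \<le> i" "1 \<le> j"
    and zi: "z \<in> path_image (linepath (parabola 0) (parabola i))"
    and zj: "z \<in> path_image (linepath (parabola j) (parabola (Suc j)))"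
  shows "z = parabola i \<and> (i = j \<or> i = Suc j)"
proof -
  have c: "0 < i" "j < Suc j" using assms by auto
  note ci = parabola_chord[OF c(1) zi] and cj = parabola_chord[OF c(2) zj]
  show ?thesis
  proof (cases "i \<le> j")
    case True
    then have "Re z = real i" "i = j" using ci(2) cj(1) by linarith+
    then show ?thesis using parabola_chord_end[OF c(1) zi] by simp
  next
    case False
    then have ij: "real (Suc j) \<le> real i" by simp
    have eq: "real i * Re z = (real j + real (Suc j)) * Re z - real j * real (Suc j)"
      using ci(3) cj(3) by simp
    \<comment> \<open>For \<open>i > j\<close> the spoke has slope at least \<open>j + 1\<close>,
      which pushes the common point to the right end of the rim edge.\<close>
    have "real (Suc j) * Re z \<le> real i * Re z" using ij ci(1) by (intro mult_right_mono) auto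
    then have "real j * (real (Suc j) - Re z) \<le> 0" unfolding eq by (simp add: algebra_simps)
    then have "real (Suc j) - Re z \<le> 0" using assms(2) by (simp add: mult_le_0_iff)
    then have re: "Re z = real (Suc j)" using cj(2) by simp
    then have "real i * real (Suc j) = real (Suc j) * real (Suc j)" using eq by (simp add: algebra_simps)
    then have "i = Suc j" by simp
    then show ?thesis using parabola_chord_end[OF c(1) zi] re by simp
  qed
qed

lemma rims_meet:
  assumes "i < j"
    and zi: "z \<in> path_image (linepath (parabola i) (parabola (Suc i)))"
    and zj: "z \<in> path_image (linepath (parabola j) (parabola (Suc j)))"
  shows "z = parabola j \<and> j = Suc i"
proof -
  have c: "i < Suc i" "j < Suc j" by auto
  note ci = parabola_chord[OF c(1) zi] and cj = parabola_chord[OF c(2) zj]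
  have "Re z = real j" "j = Suc i" using ci(2) cj(1) assms(1) by linarith+
  then show ?thesis using parabola_chord_start[OF c(2) zj] by simp
qed

lemma fan_drawing: "plane_drawing {..9} fan_edges parabola chord"
  unfolding plane_drawing_def
proof (intro conjI ballI impI)
  show inj: "inj_on parabola {..9}" by (rule inj_onI) (simp add: parabola_def)
  fix e assume "e \<in> fan_edges"
  then obtain a b where ab: "a < b" "e = {a, b}" "chord e = linepath (parabola a) (parabola b)" "b \<le> 9"
    by (rule fan_edge_ordered)
  have "parabola a \<noteq> parabola b" using ab(1) by (simp add: parabola_def)
  then show "arc (chord e)" unfolding ab(3) by (rule arc_linepath)
  show "{pathstart (chord e), pathfinish (chord e)} = parabola ` e" unfolding ab(3) unfolding ab(2) by simp
  show "path_image (chord e) \<inter> parabola ` {..9} = parabola ` e"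
    unfolding ab(3) unfolding ab(2) using parabola_chord_vertex[OF ab(1)] ab(1,4) by auto
next
  fix e f assume ef: "e \<in> fan_edges" "f \<in> fan_edges" "e \<noteq> f"
  have ends: "parabola ` g \<subseteq> path_image (chord g)" if "g \<in> fan_edges" for g
    using that by (rule fan_edge_ordered) auto
  have "parabola ` (e \<inter> f) \<subseteq> path_image (chord e) \<inter> path_image (chord f)"
    using ends[OF ef(1)] ends[OF ef(2)] by blast
  moreover have "z \<in> parabola ` (e \<inter> f)" if z: "z \<in> path_image (chord e)" "z \<in> path_image (chord f)" for z
    using ef(1)
  proof (cases rule: fan_edgeE)
    case e: (spoke i)
    then have ze: "z \<in> path_image (linepath (parabola 0) (parabola i))" using z(1) by (simp add: chord_def)
    from ef(2) show ?thesis
    proof (cases rule: fan_edgeE)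
      case f: (spoke j)
      then have zf: "z \<in> path_image (linepath (parabola 0) (parabola j))" using z(2) by (simp add: chord_def)
      have "i \<noteq> j" using e f ef(3) by blast
      then show ?thesis using spokes_meet[OF e(1) f(1) _ ze zf] e f by blast
    next
      case f: (rim j)
      then have zf: "z \<in> path_image (linepath (parabola j) (parabola (Suc j)))" using z(2) by (simp add: chord_def)
      then show ?thesis using spoke_rim_meet[OF e(1) f(1) ze zf] e f by blast
    qed
  next
    case e: (rim i)
    then have ze: "z \<in> path_image (linepath (parabola i) (parabola (Suc i)))" using z(1) by (simp add: chord_def)
    from ef(2) show ?thesis
    proof (cases rule: fan_edgeE)
      case f: (spoke j)
      then have zf: "z \<in> path_image (linepath (parabola 0) (parabola j))" using z(2) by (simp add: chord_def)
      then show ?thesis using spoke_rim_meet[OF f(1) e(1) zf ze] e f by blast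
    next
      case f: (rim j)
      then have zf: "z \<in> path_image (linepath (parabola j) (parabola (Suc j)))" using z(2) by (simp add: chord_def)
      have "i \<noteq> j" using e f ef(3) by blast
      then consider "i < j" | "j < i" by linarith
      then show ?thesis
        using rims_meet[OF _ ze zf] rims_meet[OF _ zf ze] e f by cases blast+
    qed
  qed
  ultimately show "path_image (chord e) \<inter> path_image (chord f) = parabola ` (e \<inter> f)" by blast
qed

text \<open>The open vertical ray below the parabola through the point is connected, unbounded and
  disjoint from \<open>S\<close>.\<close>

lemma below_parabola_outside:
  assumes S: "\<And>z. z \<in> S \<Longrightarrow> (Re z)\<^sup>2 \<le> Im z" and y: "y < x\<^sup>2"
  shows "Complex x y \<in> outside S"
proof -
  let ?r = "Complex x ` {..<x\<^sup>2}"
  have "continuous_on {..<x\<^sup>2} (Complex x)" unfolding Complex_eq by (intro continuous_intros)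
  then have "connected ?r" by (intro connected_continuous_image) auto
  moreover have "?r \<subseteq> - S" using S by fastforce
  ultimately have sub: "?r \<subseteq> connected_component_set (- S) (Complex x y)"
    using y by (intro connected_component_maximal) auto
  have "\<not> bounded ?r"
  proof
    assume "bounded ?r"
    then obtain B where B: "\<And>z. z \<in> ?r \<Longrightarrow> cmod z \<le> B" unfolding bounded_iff by blast
    have "- \<bar>B\<bar> - 1 < x\<^sup>2" using zero_le_power2[of x] by linarith
    then have "cmod (Complex x (- \<bar>B\<bar> - 1)) \<le> B" by (intro B) auto
    moreover have "\<bar>B\<bar> + 1 \<le> cmod (Complex x (- \<bar>B\<bar> - 1))"
      using abs_Im_le_cmod[of "Complex x (- \<bar>B\<bar> - 1)"] by simp
    ultimately show False by linarith
  qed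
  then show ?thesis using sub bounded_subset unfolding outside by blast
qed

lemma fan_outerplanar: "outerplanar {..9} fan_edges"
  unfolding outerplanar_def
proof (intro exI conjI)
  show "plane_drawing {..9} fan_edges parabola chord" by (rule fan_drawing)
  let ?S = "drawing_points {..9} fan_edges parabola chord"
  have above: "(Re z)\<^sup>2 \<le> Im z" if "z \<in> ?S" for z
  proof -
    consider k where "z = parabola k" | e where "e \<in> fan_edges" "z \<in> path_image (chord e)"
      using \<open>z \<in> ?S\<close> unfolding drawing_points_def by blast
    then show ?thesis
    proof cases
      case 1 then show ?thesis by (simp add: parabola_def)
    next
      case 2
      from 2(1) obtain a b where "a < b" "chord e = linepath (parabola a) (parabola b)" by (rule fan_edge_ordered)
      then show ?thesis using parabola_chord_above 2(2) by simp
    qed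
  qed
  show "parabola ` {..9} \<subseteq> frontier (outside ?S)"
  proof
    fix z assume z: "z \<in> parabola ` {..9}"
    then obtain k where k: "z = parabola k" by blast
    have "z \<in> ?S" using z unfolding drawing_points_def by blast
    then have "z \<notin> interior (outside ?S)" using interior_subset outside_no_overlap by blast
    moreover have "z \<in> closure (outside ?S)"
      unfolding closure_approachable
    proof (intro allI impI)
      fix d :: real assume d: "0 < d"
      let ?w = "Complex (real k) ((real k)\<^sup>2 - d / 2)"
      have "?w \<in> outside ?S" using d by (intro below_parabola_outside above) auto
      moreover have "?w - z = Complex 0 (- (d / 2))" unfolding k parabola_def by (simp add: complex_eq_iff)
      then have "dist ?w z < d" unfolding dist_norm using d by (simp add: cmod_def)
      ultimately show "\<exists>w\<in>outside ?S. dist w z < d" by blast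
    qed
    ultimately show "z \<in> frontier (outside ?S)" unfolding frontier_def by blast
  qed
qed

theorem theorem5:
  shows "(\<forall>(V :: 'a set) E.
            simple_graph V E \<and> locally_finite V E \<and> two_connected V E \<and>
            positively_LLY_curved V E \<and> outerplanar V E
            \<longrightarrow> finite V \<and> card V \<le> 10) \<and>
         (\<exists>(V :: nat set) E.
            simple_graph V E \<and> two_connected V E \<and>
            positively_LLY_curved V E \<and> outerplanar V E \<and>
            finite V \<and> card V = 10)"
proof (intro conjI allI impI)
  fix V :: "'a set" and E
  assume a: "simple_graph V E \<and> locally_finite V E \<and> two_connected V E \<and>
      positively_LLY_curved V E \<and> outerplanar V E"
  then interpret connected_lf_graph V E
    by unfold_locales (auto simp: two_connected_def)
  show "finite V" "card V \<le> 10" using vertex_bound a by blast+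
next
  show "\<exists>(V :: nat set) E. simple_graph V E \<and> two_connected V E \<and> positively_LLY_curved V E \<and>
      outerplanar V E \<and> finite V \<and> card V = 10"
    using fan_simple fan_two_connected fan_positive fan_outerplanar
    by (intro exI[of _ "{..9}"] exI[of _ fan_edges]) simp
qed

end
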